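(* Let $r,s$ be positive integers, $n=r+s$, let $\bm{\lambda}=(\lambda_1,\lambda_2)$ with $\lambda_1\vdash r$ and $\lambda_2\vdash s$, and let $\bm{T}=(T_1,T_2)$ be a standard $\bm{\lambda}$-tableau. Write $c_i=c_i(\bm{T})$ and consider the rational function with values in the group algebra $\mathbb{C}[S_r\times S_s]$ $$\Phi_{\bm{T}}(z_1,\dots,z_n)=\left(\prod_{1\le i<j\le r}\left(1-\frac{(i\,j)}{z_i+c_i-(z_j+c_j)}\right)\right)\left(\prod_{r+1\le i<j\le r+s}\left(1-\frac{(i\,j)}{z_i+c_i-(z_j+c_j)}\right)\right),$$ where in each of the two products the factors are ordered from left to right by the lexicographic order on the pairs $(i,j)$. Let $$\mathcal{H}_{\bm{T}}=\{(z_1,\dots,z_n)\in\mathbb{C}^n \mid z_i=z_j \text{ whenever } i \text{ and } j \text{ lie in the same principal hook of } \bm{T}\}.$$ Then the restriction of $\Phi_{\bm{T}}$ to the subspace $\mathcal{H}_{\bm{T}}$ is regular (well defined) at $z_1=z_2=\dots=z_n$, and the value of this restriction at $z_1=z_2=\dots=z_n$ equals the diagonal matrix element $F_{\bm{T}}\in\mathbb{C}[S_r\times S_s]$.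
   Context: The group $S_r\times S_s$ is regarded as the subgroup of permutations of $\{1,\dots,r+s\}$ in which $S_r$ permutes $\{1,\dots,r\}$ and $S_s$ permutes $\{r+1,\dots,r+s\}$. It is generated by the adjacent transpositions $s_i=(i\;i+1)$ for $1\le i\le r-1$ and for $r+1\le i\le r+s-1$. Here $(i\,j)$ denotes the transposition of $i$ and $j$. For a pair of partitions $\bm{\lambda}=(\lambda_1,\lambda_2)$ with $\lambda_1\vdash r$, $\lambda_2\vdash s$, a standard $\bm{\lambda}$-tableau is a pair $\bm{T}=(T_1,T_2)$, where $T_1$ is a bijective filling of the Young diagram of $\lambda_1$ with the numbers $1,\dots,r$ and $T_2$ is a bijective filling of the Young diagram of $\lambda_2$ with the numbers $r+1,\dots,r+s$, both having entries increasing from left to right along rows and from top to bottom along columns. The content of a box in row $i$ and column $j$ of either diagram is $j-i$, and $c_k(\bm{T})$ denotes the content of the box of $\bm{T}$ containing $k$. In a Young diagram, the hook of a box $(i,j)$ is the set of boxes of the diagram of the form $(i,j')$ with $j'\ge j$ or $(i',j)$ with $i'\ge i$. A principal hook of $\bm{T}$ is the hook, inside the Young diagram of $\lambda_1$ or inside the Young diagram of $\lambda_2$, of a diagonal box $(i,i)$ of that diagram. Principal hooks of $T_1$ and of $T_2$ are distinct from each other. Two numbers lie in the same principal hook if the boxes containing them do. The irreducible representation $V_{\bm{\lambda}}$ of $S_r\times S_s$ over $\mathbb{C}$ has a basis $\{v_{\bm{T}}\}$ (Young basis), indexed by the standard $\bm{\lambda}$-tableaux and orthonormal with respect to an $(S_r\times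 S_s)$-invariant Hermitian inner product $\langle\cdot,\cdot\rangle$, on which the generators act as follows. Put $d_i(\bm{T})=(c_{i+1}(\bm{T})-c_i(\bm{T}))^{-1}$, and let $\bm{T}'$ be obtained from $\bm{T}$ by exchanging $i$ and $i+1$. Then $s_iv_{\bm{T}}=d_i(\bm{T})v_{\bm{T}}+\sqrt{1-d_i(\bm{T})^2}\,v_{\bm{T}'}$ if $\bm{T}'$ is standard, and $s_iv_{\bm{T}}=d_i(\bm{T})v_{\bm{T}}$ if $\bm{T}'$ is not standard. The diagonal matrix element is $F_{\bm{T}}=\sum_{g\in S_r\times S_s}\langle v_{\bm{T}},g\,v_{\bm{T}}\rangle\, g\in\mathbb{C}[S_r\times S_s]$. Here $\Phi_{\bm{T}}$ restricted to $\mathcal{H}_{\bm{T}}$ is viewed as a $\mathbb{C}[S_r\times S_s]$-valued rational function on the vector space $\mathcal{H}_{\bm{T}}$; regular at $z_1=\dots=z_n$ means that, after cancellation, it has no pole at the points of the line $z_1=\dots=z_n$, and the value meant is that of the resulting regular function at such points. *)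

theory Defs
  imports
    Complex_Main
    "HOL-Library.FuncSet"
    "HOL-Combinatorics.Permutations"
begin

section \<open>Partitions and standard tableaux\<close>

definition partition_of :: "nat \<Rightarrow> nat list \<Rightarrow> bool" where
  "partition_of n lam \<longleftrightarrow> sorted_wrt (\<ge>) lam \<and> 0 \<notin> set lam \<and> sum_list lam = n"

text \<open>Boxes are pairs (row, column), both counted from 1.\<close>

definition diagram :: "nat list \<Rightarrow> (nat \<times> nat) set" where
  "diagram lam = {(i, j). 1 \<le> i \<and> i \<le> length lam \<and> 1 \<le> j \<and> j \<le> lam ! (i - 1)}"

type_synonym filling = "nat \<times> nat \<Rightarrow> nat"

text \<open>A filling is extensional, i.e. \<^term>\<open>undefined\<close> off the diagram, so that equality of
  fillings is equality on the diagram.\<close>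

definition std_filling :: "nat list \<Rightarrow> nat set \<Rightarrow> filling set" where
  "std_filling lam A = {T \<in> extensional (diagram lam). bij_betw T (diagram lam) A \<and>
     (\<forall>i j j'. (i, j) \<in> diagram lam \<and> (i, j') \<in> diagram lam \<and> j < j' \<longrightarrow> T (i, j) < T (i, j')) \<and>
     (\<forall>i i' j. (i, j) \<in> diagram lam \<and> (i', j) \<in> diagram lam \<and> i < i' \<longrightarrow> T (i, j) < T (i', j))}"

definition std_tableaux :: "nat \<Rightarrow> nat \<Rightarrow> nat list \<Rightarrow> nat list \<Rightarrow> (filling \<times> filling) set" where
  "std_tableaux r s lam mu = std_filling lam {1..r} \<times> std_filling mu {r+1..r+s}"

definition box_content :: "nat \<times> nat \<Rightarrow> int" where
  "box_content b = int (snd b) - int (fst b)"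

definition content :: "nat \<Rightarrow> nat list \<Rightarrow> nat list \<Rightarrow> filling \<times> filling \<Rightarrow> nat \<Rightarrow> int" where
  "content r lam mu T k =
     box_content (if k \<le> r then inv_into (diagram lam) (fst T) k
                  else inv_into (diagram mu) (snd T) k)"

definition swap_entries :: "nat list \<Rightarrow> nat list \<Rightarrow> nat \<Rightarrow> filling \<times> filling \<Rightarrow> filling \<times> filling" where
  "swap_entries lam mu i T =
     (\<lambda>b\<in>diagram lam. transpose i (i + 1) (fst T b),
      \<lambda>b\<in>diagram mu. transpose i (i + 1) (snd T b))"

definition hook :: "nat list \<Rightarrow> nat \<times> nat \<Rightarrow> (nat \<times> nat) set" where
  "hook lam = (\<lambda>(i, j). {(i', j') \<in> diagram lam. (i' = i \<and> j \<le> j') \<or> (j' = j \<and> i \<le> i')})"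

text \<open>Each principal hook is given by the set of its entries. As \<^term>\<open>fst T\<close> and
  \<^term>\<open>snd T\<close> have disjoint sets of entries, hooks of the two components stay distinct.\<close>

definition principal_hooks :: "nat list \<Rightarrow> nat list \<Rightarrow> filling \<times> filling \<Rightarrow> nat set set" where
  "principal_hooks lam mu T =
     {fst T ` hook lam (d, d) |d. (d, d) \<in> diagram lam} \<union>
     {snd T ` hook mu (d, d) |d. (d, d) \<in> diagram mu}"


section \<open>The group and its group algebra\<close>

definition SxS :: "nat \<Rightarrow> nat \<Rightarrow> (nat \<Rightarrow> nat) set" where
  "SxS r s = {p \<circ> q |p q. p permutes {1..r} \<and> q permutes {r+1..r+s}}"

text \<open>Elements of the group algebra of a finite group \<open>G\<close> of permutations are coefficient
  functions vanishing off \<open>G\<close>.\<close>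

type_synonym grp_alg = "(nat \<Rightarrow> nat) \<Rightarrow> complex"

definition delta :: "(nat \<Rightarrow> nat) \<Rightarrow> grp_alg" where
  "delta g = (\<lambda>x. if x = g then 1 else 0)"

definition ga_mult :: "(nat \<Rightarrow> nat) set \<Rightarrow> grp_alg \<Rightarrow> grp_alg \<Rightarrow> grp_alg" where
  "ga_mult G a b = (\<lambda>x. \<Sum>g\<in>G. \<Sum>h\<in>G. a g * b h * delta (g \<circ> h) x)"

definition ga_prod_list :: "(nat \<Rightarrow> nat) set \<Rightarrow> grp_alg list \<Rightarrow> grp_alg" where
  "ga_prod_list G as = foldr (ga_mult G) as (delta id)"


section \<open>The Young basis\<close>

text \<open>\<open>V\<close> is a subspace of an ambient complex vector space; \<open>ip\<close> is linear in its second argument.\<close>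

locale unitary_irrep = vector_space scale
  for scale :: "complex \<Rightarrow> 'v::ab_group_add \<Rightarrow> 'v" (infixr "*s" 75) +
  fixes G :: "(nat \<Rightarrow> nat) set"
    and V :: "'v set"
    and ip :: "'v \<Rightarrow> 'v \<Rightarrow> complex"
    and act :: "(nat \<Rightarrow> nat) \<Rightarrow> 'v \<Rightarrow> 'v"
  assumes subspace_V: "subspace V"
    and act_closed: "\<lbrakk>g \<in> G; x \<in> V\<rbrakk> \<Longrightarrow> act g x \<in> V"
    and act_add: "\<lbrakk>g \<in> G; x \<in> V; y \<in> V\<rbrakk> \<Longrightarrow> act g (x + y) = act g x + act g y"
    and act_scale: "\<lbrakk>g \<in> G; x \<in> V\<rbrakk> \<Longrightarrow> act g (a *s x) = a *s act g x"
    and act_id: "x \<in> V \<Longrightarrow> act id x = x"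
    and act_comp: "\<lbrakk>g \<in> G; h \<in> G; x \<in> V\<rbrakk> \<Longrightarrow> act (g \<circ> h) x = act g (act h x)"
    and ip_add: "\<lbrakk>x \<in> V; y \<in> V; z \<in> V\<rbrakk> \<Longrightarrow> ip x (y + z) = ip x y + ip x z"
    and ip_scale: "\<lbrakk>x \<in> V; y \<in> V\<rbrakk> \<Longrightarrow> ip x (a *s y) = a * ip x y"
    and ip_cnj: "\<lbrakk>x \<in> V; y \<in> V\<rbrakk> \<Longrightarrow> ip y x = cnj (ip x y)"
    and ip_pos: "\<lbrakk>x \<in> V; x \<noteq> 0\<rbrakk> \<Longrightarrow> Re (ip x x) > 0"
    and ip_invariant: "\<lbrakk>g \<in> G; x \<in> V; y \<in> V\<rbrakk> \<Longrightarrow> ip (act g x) (act g y) = ip x y"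
    and nonzero: "V \<noteq> {0}"
    and irreducible: "\<lbrakk>subspace W; W \<subseteq> V; \<forall>g\<in>G. act g ` W \<subseteq> W\<rbrakk> \<Longrightarrow> W = {0} \<or> W = V"

definition axial_inv :: "nat \<Rightarrow> nat list \<Rightarrow> nat list \<Rightarrow> filling \<times> filling \<Rightarrow> nat \<Rightarrow> real" where
  "axial_inv r lam mu T i = 1 / of_int (content r lam mu T (i + 1) - content r lam mu T i)"

locale young_basis = unitary_irrep scale "SxS r s" V ip act
  for scale :: "complex \<Rightarrow> 'v::ab_group_add \<Rightarrow> 'v" (infixr "*s" 75)
    and r s :: nat
    and V ip act +
  fixes lam mu :: "nat list"
    and v :: "filling \<times> filling \<Rightarrow> 'v"
  assumes span_v: "span (v ` std_tableaux r s lam mu) = V"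
    and orthonormal_v: "\<lbrakk>S \<in> std_tableaux r s lam mu; T \<in> std_tableaux r s lam mu\<rbrakk> \<Longrightarrow>
      ip (v S) (v T) = (if S = T then 1 else 0)"
    and act_generator: "\<lbrakk>i \<in> {1..<r} \<union> {r+1..<r+s}; T \<in> std_tableaux r s lam mu\<rbrakk> \<Longrightarrow>
      act (transpose i (i + 1)) (v T) =
        (if swap_entries lam mu i T \<in> std_tableaux r s lam mu
         then of_real (axial_inv r lam mu T i) *s v T +
              of_real (sqrt (1 - (axial_inv r lam mu T i)\<^sup>2)) *s v (swap_entries lam mu i T)
         else of_real (axial_inv r lam mu T i) *s v T)"

definition diag_element ::
  "(nat \<Rightarrow> nat) set \<Rightarrow> ('v \<Rightarrow> 'v \<Rightarrow> complex) \<Rightarrow> ((nat \<Rightarrow> nat) \<Rightarrow> 'v \<Rightarrow> 'v) \<Rightarrow> 'v \<Rightarrow> grp_alg" where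
  "diag_element G ip act x = (\<lambda>h. \<Sum>g\<in>G. ip x (act g x) * delta g h)"


section \<open>The rational function\<close>

definition lex_pairs :: "nat \<Rightarrow> nat \<Rightarrow> (nat \<times> nat) list" where
  "lex_pairs a b = [(i, j). i \<leftarrow> [a..<b+1], j \<leftarrow> [i+1..<b+1]]"

definition Phi_factor :: "(nat \<Rightarrow> int) \<Rightarrow> (nat \<Rightarrow> complex) \<Rightarrow> nat \<times> nat \<Rightarrow> grp_alg" where
  "Phi_factor c z = (\<lambda>(i, j) g.
     delta id g - 1 / (z i + of_int (c i) - (z j + of_int (c j))) * delta (transpose i j) g)"

definition Phi :: "nat \<Rightarrow> nat \<Rightarrow> (nat \<Rightarrow> int) \<Rightarrow> (nat \<Rightarrow> complex) \<Rightarrow> grp_alg" where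
  "Phi r s c z =
     ga_mult (SxS r s)
       (ga_prod_list (SxS r s) (map (Phi_factor c z) (lex_pairs 1 r)))
       (ga_prod_list (SxS r s) (map (Phi_factor c z) (lex_pairs (r + 1) (r + s))))"

text \<open>The points at which no denominator in \<^const>\<open>Phi\<close> vanishes.\<close>

definition Phi_dom :: "nat \<Rightarrow> nat \<Rightarrow> (nat \<Rightarrow> int) \<Rightarrow> (nat \<Rightarrow> complex) set" where
  "Phi_dom r s c = {z. \<forall>(i, j) \<in> set (lex_pairs 1 r) \<union> set (lex_pairs (r + 1) (r + s)).
     z i + of_int (c i) - (z j + of_int (c j)) \<noteq> 0}"

definition affine_space :: "nat \<Rightarrow> (nat \<Rightarrow> complex) set" where
  "affine_space n = {1..n} \<rightarrow>\<^sub>E UNIV"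

definition hook_space ::
  "nat \<Rightarrow> nat list \<Rightarrow> nat list \<Rightarrow> filling \<times> filling \<Rightarrow> (nat \<Rightarrow> complex) set" where
  "hook_space n lam mu T = {z \<in> affine_space n.
     \<forall>h \<in> principal_hooks lam mu T. \<forall>i\<in>h. \<forall>j\<in>h. z i = z j}"

definition diagonal_line :: "nat \<Rightarrow> (nat \<Rightarrow> complex) set" where
  "diagonal_line n = {z \<in> affine_space n. \<forall>i\<in>{1..n}. \<forall>j\<in>{1..n}. z i = z j}"

inductive poly_fun :: "nat \<Rightarrow> ((nat \<Rightarrow> complex) \<Rightarrow> complex) \<Rightarrow> bool" for n where
  const: "poly_fun n (\<lambda>z. a)"
| coord: "i \<in> {1..n} \<Longrightarrow> poly_fun n (\<lambda>z. z i)"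
| add: "poly_fun n p \<Longrightarrow> poly_fun n q \<Longrightarrow> poly_fun n (\<lambda>z. p z + q z)"
| mult: "poly_fun n p \<Longrightarrow> poly_fun n q \<Longrightarrow> poly_fun n (\<lambda>z. p z * q z)"

text \<open>\<open>H\<close> is a linear subspace of the \<open>n\<close>-dimensional affine space, and \<open>f\<close> is a rational function
  given by a formula that makes sense on the Zariski-open set \<open>U\<close>. The formula restricts to a rational
  function on \<open>H\<close> iff \<open>H\<close> meets \<open>U\<close>. That function is regular at \<open>p\<close> with value \<open>a\<close> iff
  it equals some quotient \<open>P / Q\<close> of polynomials with \<open>Q p \<noteq> 0\<close> and \<open>P p / Q p = a\<close>. Equality
  as rational functions is tested at the points of \<open>H \<inter> U\<close>, which is dense in \<open>H\<close>;
  hence \<open>a\<close> does not depend on the choice of \<open>P\<close> and \<open>Q\<close>. The point \<open>p\<close> need not lie in \<open>U\<close>.\<close>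

definition regular_value ::
  "nat \<Rightarrow> (nat \<Rightarrow> complex) set \<Rightarrow> (nat \<Rightarrow> complex) set \<Rightarrow>
   ((nat \<Rightarrow> complex) \<Rightarrow> complex) \<Rightarrow> (nat \<Rightarrow> complex) \<Rightarrow> complex \<Rightarrow> bool" where
  "regular_value n H U f p a \<longleftrightarrow>
     p \<in> H \<and> H \<inter> U \<noteq> {} \<and>
     (\<exists>P Q. poly_fun n P \<and> poly_fun n Q \<and> Q p \<noteq> 0 \<and>
        (\<forall>z \<in> H \<inter> U. f z * Q z = P z) \<and> P p / Q p = a)"

text \<open>Regularity of a function with values in the group algebra is meant coefficientwise.\<close>

definition ga_regular_value ::
  "nat \<Rightarrow> (nat \<Rightarrow> complex) set \<Rightarrow> (nat \<Rightarrow> complex) set \<Rightarrow>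
   ((nat \<Rightarrow> complex) \<Rightarrow> grp_alg) \<Rightarrow> (nat \<Rightarrow> complex) \<Rightarrow> grp_alg \<Rightarrow> bool" where
  "ga_regular_value n H U f p a \<longleftrightarrow> (\<forall>g. regular_value n H U (\<lambda>z. f z g) p (a g))"

end

theory Submission
  imports Defs "HOL-Combinatorics.Perm" "HOL-Library.Poly_Mapping"
begin

text \<open>
  Let \<open>x_k\<close> be the Jucys-Murphy elements \<open>\<Sum>j<k. (j k)\<close>, with \<open>j\<close> and \<open>k\<close> in the same block. By the Yang-Baxter
  equation the product \<open>\<Phi>\<close> is invariant under \<open>g \<mapsto> g\<inverse>\<close>, and the values of \<open>\<Phi>\<close> for two standard tableaux that
  differ by exchanging \<open>i\<close> and \<open>i + 1\<close> are related, up to a scalar, by multiplication on both sides by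
  \<open>s_i - 1 / (u_i - u_(i+1))\<close>, which is regular and invertible near the diagonal. So it suffices to prove regularity for the tableau filled hook by hook, arm before leg.
  There every singular factor \<open>(j, m)\<close> is followed by the factor \<open>(j + 1, m)\<close> of a neighbour of \<open>j\<close> in its hook, and
  the two together are regular. The value \<open>E\<close> satisfies \<open>x_k E = c_k E = E x_k\<close>: the last tail of \<open>\<Phi>\<close> is inverted by
  \<open>1 - x_m / u\<close> up to a scalar that vanishes as \<open>u \<rightarrow> c_m\<close>. Moreover the coefficient of the identity in \<open>E\<close> is \<open>1\<close>.

  Conversely, matrix elements \<open>\<langle>w', g w\<rangle>\<close> of joint eigenvectors of the \<open>x_k\<close> in a unitary representation are
  determined by the eigenvalues up to a scalar. This is an induction along \<open>S_(m-1) \<subseteq> S_m\<close>, based on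
  \<open>s_m x_m = x_(m+1) s_m - 1\<close> and on \<open>c_m \<noteq> c_(m+1)\<close>. Comparing the regular representation with the Young basis
  gives \<open>E = F_T\<close>, without using a classification of the irreducible representations.
\<close>

text \<open>The diagonal may lie outside the domain of Phi: two boxes of equal content in one
  diagram give a vanishing denominator. A box is determined by its content and its principal hook,
  so points of the hook space near the diagonal avoid all poles. They show that the restriction
  exists and that regular values are unique. The hook order is chosen because the box following a
  singular one in its hook carries the very next entry, so the two factors to be fused are adjacent.
  That the limit is a joint eigenvector is not read off on the hook space: the earlier parameters
  are put at their contents and only the last one moves. The fused tail is continuous, so both
  approaches have the same limit. The scalar vanishes by a count of boxes: neighbours of the boxes
  of the given content supply enough zeros to outweigh the poles. Entries exchanged between standard
  tableaux occupy incomparable boxes. Their contents differ by at least 2, hence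
  \<open>1 - 1 / d^2\<close> is nonzero and the exchange loses no regularity.\<close>

section \<open>The group algebra\<close>

text \<open>Convolution in \<^theory>\<open>HOL-Library.Poly_Mapping\<close> requires an additive monoid of exponents, so
  composition of permutations is written \<open>+\<close>.\<close>

instantiation Perm.perm :: (type) group_add
begin

definition zero_perm :: "'a perm" where "zero_perm = 1"
definition plus_perm :: "'a perm \<Rightarrow> 'a perm \<Rightarrow> 'a perm" where "plus_perm g h = g * h"
definition uminus_perm :: "'a perm \<Rightarrow> 'a perm" where "uminus_perm g = inverse g"
definition minus_perm :: "'a perm \<Rightarrow> 'a perm \<Rightarrow> 'a perm" where "minus_perm g h = g * inverse h"

instance
proof
  fix a b c :: "'a perm"
  show "a + b + c = a + (b + c)" by (simp only: plus_perm_def mult.assoc)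
  show "0 + a = a" by (simp only: plus_perm_def zero_perm_def mult_1_left)
  show "a + 0 = a" by (simp only: plus_perm_def zero_perm_def mult_1_right)
  show "- a + a = 0" by (simp only: plus_perm_def zero_perm_def uminus_perm_def perm.left_inverse)
  show "a + - b = a - b" by (simp only: plus_perm_def minus_perm_def uminus_perm_def)
qed

end

lemma apply_zero [simp]: "apply (0 :: 'a perm) = id"
  by (simp add: zero_perm_def)

lemma apply_plus: "apply (g + h) = apply g \<circ> apply (h :: 'a perm)"
  by (simp add: plus_perm_def apply_times)

lemma apply_uminus: "apply (- g) = inv (apply (g :: 'a perm))"
  by (simp add: uminus_perm_def apply_inverse)

type_synonym galg = "nat perm \<Rightarrow>\<^sub>0 complex"

abbreviation "lookup \<equiv> Poly_Mapping.lookup"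
abbreviation "keys \<equiv> Poly_Mapping.keys"
abbreviation "single \<equiv> Poly_Mapping.single"

definition sc :: "complex \<Rightarrow> galg" where "sc c = single 0 c"

definition tp :: "nat \<Rightarrow> nat \<Rightarrow> galg" where "tp i j = single (Perm.swap i j) 1"

lemma galg_expand: "a = (\<Sum>g\<in>keys a. single g (lookup a g))" for a :: galg
proof (rule poly_mapping_eqI)
  fix k
  have "lookup (\<Sum>g\<in>keys a. single g (lookup a g)) k = (\<Sum>g\<in>keys a. if g = k then lookup a g else 0)"
    by (simp add: lookup_sum lookup_single when_def)
  also have "\<dots> = lookup a k"
    by (simp add: sum.delta in_keys_iff)
  finally show "lookup a k = lookup (\<Sum>g\<in>keys a. single g (lookup a g)) k" ..
qed

lemma galg_expand_on:
  fixes a :: galg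
  assumes "finite G" "keys a \<subseteq> G"
  shows "a = (\<Sum>g\<in>G. single g (lookup a g))"
  using assms by (subst galg_expand, intro sum.mono_neutral_left) (auto simp: in_keys_iff)

lemma galg_induct [case_names single add]:
  fixes a :: galg
  assumes s: "\<And>g c. P (single g c)" and ad: "\<And>a b. P a \<Longrightarrow> P b \<Longrightarrow> P (a + b)"
  shows "P a"
proof -
  have "P (\<Sum>g\<in>S. single g (lookup a g))" if "finite S" for S
    using that
  proof induction
    case empty
    show ?case using s[of 0 0] by simp
  next
    case (insert x F)
    then show ?case using s ad by simp
  qed
  then show ?thesis using galg_expand[of a] by (metis finite_keys)
qed

lemma lookup_single_times: "lookup (single g c * b) h = c * lookup b (- g + h)" for b :: galg
proof (induction b rule: galg_induct)
  case (single k d)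
  have "g + k = h \<longleftrightarrow> k = - g + h"
    by (metis add.assoc add.left_neutral left_minus minus_add_cancel)
  then show ?case by (simp add: mult_single lookup_single when_def)
next
  case (add a b)
  then show ?case by (simp add: distrib_left lookup_add)
qed

lemma lookup_times_single: "lookup (b * single g c) h = lookup b (h - g) * c" for b :: galg
proof (induction b rule: galg_induct)
  case (single k d)
  have "k + g = h \<longleftrightarrow> k = h - g"
    by (auto simp: eq_diff_eq)
  then show ?case by (simp add: mult_single lookup_single when_def)
next
  case (add a b)
  then show ?case by (simp add: distrib_right lookup_add)
qed

lemma sc_0 [simp]: "sc 0 = 0" by (simp add: sc_def)
lemma sc_1 [simp]: "sc 1 = 1" by (simp add: sc_def)
lemma sc_add: "sc (a + b) = sc a + sc b" by (simp add: sc_def single_add)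
lemma sc_uminus: "sc (- a) = - sc a" by (simp add: sc_def single_uminus)
lemma sc_diff: "sc (a - b) = sc a - sc b" by (simp add: sc_def single_diff)
lemma sc_mult: "sc (a * b) = sc a * sc b" by (simp add: sc_def mult_single)

lemma lookup_sc_times [simp]: "lookup (sc c * x) g = c * lookup x g"
  by (simp add: sc_def lookup_single_times)

lemma sc_commute: "x * sc c = sc c * x"
  by (rule poly_mapping_eqI) (simp add: sc_def lookup_single_times lookup_times_single)

lemma sc_left_commute: "x * (sc c * y) = sc c * (x * y)"
  by (metis mult.assoc sc_commute)

lemma sc_cancel: "a \<noteq> 0 \<Longrightarrow> sc a * x = sc a * y \<Longrightarrow> x = y"
proof -
  assume a: "a \<noteq> 0" and e: "sc a * x = sc a * y"
  have "sc (1 / a) * (sc a * z) = z" for z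
    using a by (simp flip: sc_mult mult.assoc)
  then show "x = y" using e by metis
qed

lemma single_conv_sc: "single g c = sc c * single g 1"
  by (simp add: sc_def mult_single)

lemma swap_apply: "apply (Perm.swap i j) = transpose i j"
  by (fact swap.rep_eq)

lemma perm_eq_applyI: "apply g = apply h \<Longrightarrow> g = h"
  by (simp add: perm_eq_iff)

lemma tp_sym: "tp i j = tp j i"
  unfolding tp_def by (metis perm_eq_applyI swap_apply transpose_commute)

lemma tp_sq [simp]: "tp i j * tp i j = 1"
proof -
  have "Perm.swap i j + Perm.swap i j = 0"
    by (rule perm_eq_applyI) (simp add: apply_plus swap_apply)
  then show ?thesis by (simp add: tp_def mult_single)
qed

lemma tp_sq_left [simp]: "tp i j * (tp i j * x) = x"
  by (metis mult.assoc mult_1_left tp_sq)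

lemma swap_conj: "g + Perm.swap i j = Perm.swap (apply g i) (apply g j) + g"
proof (rule perm_eq_applyI)
  have "inj (apply g)" by (simp add: bij_is_inj)
  then show "apply (g + Perm.swap i j) = apply (Perm.swap (apply g i) (apply g j) + g)"
    by (auto simp: apply_plus swap_apply fun_eq_iff transpose_def inj_eq)
qed

lemma single_tp: "single g c * tp i j = tp (apply g i) (apply g j) * single g c"
  by (simp add: tp_def mult_single swap_conj)

lemma tp_conj: "tp a b * tp i j = tp (transpose a b i) (transpose a b j) * tp a b"
  using single_tp[of "Perm.swap a b" 1 i j] by (simp add: tp_def swap_apply)

lemma tp_disj: "{a, b} \<inter> {i, j} = {} \<Longrightarrow> tp a b * tp i j = tp i j * tp a b"
  by (subst tp_conj) (auto simp: transpose_def)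

text \<open>Each of the two 3-cycles on \<open>i\<close>, \<open>j\<close>, \<open>k\<close> is a
  product of two transpositions in three ways; these identities pass between them.\<close>

lemma tp_three:
  assumes "i \<noteq> j" "j \<noteq> k" "i \<noteq> k"
  shows "tp i j * tp i k = tp j k * tp i j" "tp i j * tp j k = tp i k * tp i j"
    "tp j k * tp i j = tp i k * tp j k"  "tp j k * tp i k = tp i j * tp j k"
    "tp i k * tp i j = tp j k * tp i k" "tp i k * tp j k = tp i j * tp i k"
  using assms by (subst tp_conj, auto simp: transpose_def tp_sym)+

section \<open>Anti-involutions and the trace form\<close>

definition adj :: "(complex \<Rightarrow> complex) \<Rightarrow> galg \<Rightarrow> galg" where
  "adj \<sigma> a = (\<Sum>g\<in>keys a. single (- g) (\<sigma> (lookup a g)))"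

lemma lookup_adj:
  assumes "\<sigma> 0 = 0"
  shows "lookup (adj \<sigma> a) g = \<sigma> (lookup a (- g))"
proof -
  have "lookup (adj \<sigma> a) g = (\<Sum>h\<in>keys a. if h = - g then \<sigma> (lookup a h) else 0)"
    unfolding adj_def lookup_sum lookup_single when_def
    by (intro sum.cong refl) (metis minus_minus)
  then show ?thesis using assms by (simp add: sum.delta in_keys_iff)
qed

text \<open>The linear \<open>tr\<close> expresses the symmetry of the fused product; the
  conjugate-linear \<open>star\<close> is the adjoint for the positive form
  \<open>tau (star a * b)\<close>.\<close>

abbreviation "tr \<equiv> adj (\<lambda>x. x)"
abbreviation "star \<equiv> adj cnj"

context
  fixes \<sigma> :: "complex \<Rightarrow> complex"
  assumes hom: "\<sigma> = (\<lambda>x. x) \<or> \<sigma> = cnj"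
begin

lemma lookup_adj' [simp]: "lookup (adj \<sigma> a) g = \<sigma> (lookup a (- g))"
  using hom by (auto simp: lookup_adj)

lemma adj_add: "adj \<sigma> (a + b) = adj \<sigma> a + adj \<sigma> b"
  using hom by (intro poly_mapping_eqI) (auto simp: lookup_add)

lemma adj_diff: "adj \<sigma> (a - b) = adj \<sigma> a - adj \<sigma> b"
  using hom by (intro poly_mapping_eqI) (auto simp: lookup_minus)

lemma adj_single: "adj \<sigma> (single g c) = single (- g) (\<sigma> c)"
proof (rule poly_mapping_eqI)
  fix h
  have "(g = - h) = (- g = h)" by auto
  then show "lookup (adj \<sigma> (single g c)) h = lookup (single (- g) (\<sigma> c)) h"
    using hom by (auto simp: lookup_single when_def)
qed

lemma adj_mult: "adj \<sigma> (a * b) = adj \<sigma> b * adj \<sigma> a"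
proof (induction a rule: galg_induct)
  case (single g c)
  show ?case
  proof (induction b rule: galg_induct)
    case (single h d)
    then show ?case using hom by (auto simp: mult_single adj_single minus_add mult.commute)
  next
    case (add a b)
    then show ?case by (simp add: adj_add distrib_left distrib_right)
  qed
next
  case (add a b)
  then show ?case by (simp add: adj_add distrib_left distrib_right)
qed

lemma adj_adj [simp]: "adj \<sigma> (adj \<sigma> a) = a"
  using hom by (intro poly_mapping_eqI) auto

lemma adj_sc [simp]: "adj \<sigma> (sc c) = sc (\<sigma> c)"
  by (simp add: sc_def adj_single)

lemma adj_1 [simp]: "adj \<sigma> 1 = 1"
  using adj_sc[of 1] hom by auto

lemma adj_0 [simp]: "adj \<sigma> 0 = 0"
  using adj_sc[of 0] hom by auto

lemma adj_sum: "adj \<sigma> (\<Sum>i\<in>I. f i) = (\<Sum>i\<in>I. adj \<sigma> (f i))"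
  by (induction I rule: infinite_finite_induct) (simp_all add: adj_add)

lemma adj_tp [simp]: "adj \<sigma> (tp i j) = tp i j"
proof -
  have "- Perm.swap i j = Perm.swap i j"
    by (rule perm_eq_applyI) (simp add: apply_uminus swap_apply)
  then show ?thesis using hom by (auto simp: tp_def adj_single)
qed

end

lemmas star_simps [simp] = lookup_adj'[OF disjI2[OF refl]] adj_adj[OF disjI2[OF refl]]
  adj_sc[OF disjI2[OF refl]] adj_1[OF disjI2[OF refl]] adj_0[OF disjI2[OF refl]]
  adj_tp[OF disjI2[OF refl]]
lemmas tr_simps [simp] = lookup_adj'[OF disjI1[OF refl]] adj_adj[OF disjI1[OF refl]]
  adj_sc[OF disjI1[OF refl]] adj_1[OF disjI1[OF refl]] adj_0[OF disjI1[OF refl]]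
  adj_tp[OF disjI1[OF refl]]
lemmas star_mult = adj_mult[OF disjI2[OF refl]] and star_diff = adj_diff[OF disjI2[OF refl]] and star_sum = adj_sum[OF disjI2[OF refl]]
  and star_single = adj_single[OF disjI2[OF refl]]
lemmas tr_mult = adj_mult[OF disjI1[OF refl]] and tr_diff = adj_diff[OF disjI1[OF refl]] and tr_sum = adj_sum[OF disjI1[OF refl]]
  and tr_single = adj_single[OF disjI1[OF refl]]

text \<open>The canonical trace. Together with \<open>star\<close> it makes the group algebra a
  unitary representation, and \<open>tau (star w' * y * w)\<close> is the matrix element of
  \<open>y\<close> between \<open>w'\<close> and \<open>w\<close>.\<close>

definition tau :: "galg \<Rightarrow> complex" where "tau a = lookup a 0"

lemma tau_add: "tau (a + b) = tau a + tau b" by (simp add: tau_def lookup_add)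
lemma tau_diff: "tau (a - b) = tau a - tau b" by (simp add: tau_def lookup_minus)
lemma tau_sc [simp]: "tau (sc c * a) = c * tau a" by (simp add: tau_def)
lemma tau_0 [simp]: "tau 0 = 0" by (simp add: tau_def)
lemma tau_1 [simp]: "tau 1 = 1" by (simp add: tau_def)
lemma tau_sum: "tau (\<Sum>i\<in>I. f i) = (\<Sum>i\<in>I. tau (f i))" by (simp add: tau_def lookup_sum)
lemma tau_tr [simp]: "tau (tr a) = tau a" by (simp add: tau_def)
lemma tau_star: "tau (star a) = cnj (tau a)" by (simp add: tau_def)

lemma tau_commute: "tau (a * b) = tau (b * a)"
proof (induction a rule: galg_induct)
  case (single g c)
  show ?case
    by (simp add: tau_def lookup_single_times lookup_times_single)
next
  case (add a b)
  then show ?case by (simp add: distrib_left distrib_right tau_add)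
qed

lemma lookup_conv_tau: "lookup a g = tau (single (- g) 1 * a)"
  by (simp add: tau_def lookup_single_times)

lemma tau_star_self: "tau (star a * a) = of_real (\<Sum>g\<in>keys a. (cmod (lookup a g))\<^sup>2)"
proof -
  have "tau (star a * a) = tau (star a * (\<Sum>g\<in>keys a. single g (lookup a g)))"
    using galg_expand[of a] by simp
  also have "\<dots> = (\<Sum>g\<in>keys a. cnj (lookup a g) * lookup a g)"
    by (simp add: sum_distrib_left tau_sum) (simp add: tau_def lookup_times_single)
  also have "\<dots> = of_real (\<Sum>g\<in>keys a. (cmod (lookup a g))\<^sup>2)"
    by (simp add: complex_norm_square mult.commute flip: of_real_power)
  finally show ?thesis .
qed

text \<open>Later, elements are shown to vanish by computing this norm.\<close>

lemma tau_star_self_eq_0: "tau (star a * a) = 0 \<longleftrightarrow> a = 0"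
proof
  assume "tau (star a * a) = 0"
  then have "(\<Sum>g\<in>keys a. (cmod (lookup a g))\<^sup>2) = 0"
    by (simp only: tau_star_self of_real_eq_0_iff)
  then have "\<forall>g\<in>keys a. (cmod (lookup a g))\<^sup>2 = 0"
    by (subst (asm) sum_nonneg_eq_0_iff) auto
  then show "a = 0" by (intro poly_mapping_eqI) (auto simp: in_keys_iff)
qed simp

section \<open>The rational Yang-Baxter equation\<close>

lemma tp_sc: "tp i j * sc c = sc c * tp i j" "tp i j * (sc c * x) = sc c * (tp i j * x)"
  "sc a * (sc b * x) = sc (a * b) * x"
  by (fact sc_commute, fact sc_left_commute, simp add: sc_mult mult.assoc)

text \<open>With \<open>a\<close>, \<open>b\<close>, \<open>c\<close> the reciprocals of
  \<open>x - y\<close>, \<open>x - z\<close>, \<open>y - z\<close>, this is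
  \<open>1 / a + 1 / c = 1 / b\<close> cleared of denominators.\<close>

lemma yb_scalar:
  assumes "x \<noteq> y" "y \<noteq> z" "x \<noteq> (z :: complex)"
  shows "1 / (x - y) * (1 / (x - z)) + 1 / (x - z) * (1 / (y - z)) = 1 / (x - y) * (1 / (y - z))"
proof -
  have "x - y \<noteq> 0" "y - z \<noteq> 0" "x - z \<noteq> 0" using assms by auto
  then show ?thesis by (simp add: divide_simps)
qed

text \<open>The braid form of the equation: \<open>tp i j + sc a\<close> is
  \<open>tp i j * (1 + sc a * tp i j)\<close>, and its transposition exchanges the parameters
  \<open>b\<close> and \<open>c\<close> of the two other factors.\<close>

lemma yang_baxter':
  assumes d: "i \<noteq> j" "j \<noteq> k" "i \<noteq> k" and abc: "a * b + b * c = a * c"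
  shows "(1 - sc b * tp i k) * (1 - sc c * tp j k) * (tp i j + sc a) =
    (tp i j + sc a) * ((1 - sc c * tp i k) * (1 - sc b * tp j k))"
proof -
  define p q t where "p = tp i j" and "q = tp i k" and "t = tp j k"
  have r: "t * p = p * q" "q * t = p * q" "q * p = p * t" "t * q = p * t" 
    using tp_three[OF d] by (simp_all add: p_def q_def t_def)
  have r3: "p * (q * t) = q" "q * (t * p) = t"
    using tp_three(6)[OF d] apply (simp add: p_def q_def t_def)
    using tp_three(3)[OF d] by (simp add: p_def q_def t_def)
  note sl = sc_commute[of p] sc_commute[of q] sc_commute[of t]
    sc_left_commute[of p] sc_left_commute[of q] sc_left_commute[of t]
  have e1: "(1 - sc b * q) * (1 - sc c * t) * (p + sc a) =
     p - sc b * (q * p) - sc c * (t * p) + sc b * sc c * (q * (t * p))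
     + sc a - sc a * sc b * q - sc a * sc c * t + sc a * sc b * sc c * (q * t)"
    by (simp add: algebra_simps sl sc_commute[of "sc b" a] sc_commute[of "sc c" a]
      sc_left_commute[of "sc c" a] sc_left_commute[of "sc b" a])
  have e2: "(p + sc a) * ((1 - sc c * q) * (1 - sc b * t)) =
     p - sc b * (p * t) - sc c * (p * q) + sc b * sc c * (p * (q * t))
     + sc a - sc a * sc b * t - sc a * sc c * q + sc a * sc b * sc c * (q * t)"
    by (simp add: algebra_simps sl sc_commute[of "sc c" b] sc_left_commute[of "sc c" b])
  have s: "sc a * sc b + sc b * sc c = sc a * sc c"
    using abc by (simp flip: sc_mult sc_add)
  \<comment> \<open>This form of the hypothesis eliminates every product of \<open>a\<close> and
    \<open>c\<close>; after that the two expansions agree term by term.\<close>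
  have h: "sc a * (sc c * x) = sc a * (sc b * x) + sc b * (sc c * x)" for x
    by (simp flip: s mult.assoc distrib_right)
  then show ?thesis
    unfolding p_def[symmetric] q_def[symmetric] t_def[symmetric] e1 e2
    unfolding r3 unfolding r(1,3)
    by (simp add: algebra_simps h)
qed

lemma yang_baxter:
  assumes d: "i \<noteq> j" "j \<noteq> k" "i \<noteq> k" and abc: "a * b + b * c = a * c"
  shows "(1 - sc a * tp i j) * (1 - sc b * tp i k) * (1 - sc c * tp j k) =
    (1 - sc c * tp j k) * (1 - sc b * tp i k) * (1 - sc a * tp i j)"
proof -
  let ?p = "tp i j" and ?q = "tp i k" and ?t = "tp j k"
  \<comment> \<open>Exchanging the roles of \<open>i\<close> and \<open>j\<close> replaces
    \<open>a\<close> by \<open>- a\<close> and exchanges \<open>b\<close> with \<open>c\<close>, so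
    the braid form is applied to this triple.\<close>
  have "(- a) * c + c * b = (- a) * b" using abc by (simp add: algebra_simps)
  from yang_baxter'[OF _ _ _ this, of j i k] d
  have yb: "(1 - sc c * ?t) * (1 - sc b * ?q) * (?p - sc a) = (?p - sc a) * ((1 - sc b * ?t) * (1 - sc c * ?q))"
    by (simp add: sc_uminus tp_sym[of j i])
  have pa: "?p - sc a = (1 - sc a * ?p) * ?p" by (simp add: left_diff_distrib mult.assoc)
  have pr: "?p * ?t = ?q * ?p" "?p * ?q = ?t * ?p" using tp_three[OF d] by simp_all
  have m: "?p * (1 - sc b * ?t) = (1 - sc b * ?q) * ?p" "?p * (1 - sc c * ?q) = (1 - sc c * ?t) * ?p"
    by (simp_all add: left_diff_distrib right_diff_distrib sc_left_commute[of ?p] mult.assoc pr)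
  have pm: "?p * ((1 - sc b * ?t) * (1 - sc c * ?q)) = (1 - sc b * ?q) * (1 - sc c * ?t) * ?p"
    unfolding mult.assoc[symmetric] m(1) unfolding mult.assoc m(2) ..
  have "(1 - sc c * ?t) * (1 - sc b * ?q) * (1 - sc a * ?p) * ?p =
      (1 - sc a * ?p) * (1 - sc b * ?q) * (1 - sc c * ?t) * ?p"
    using yb unfolding pa by (simp only: mult.assoc pm)
  from arg_cong[OF this, of "\<lambda>y. y * ?p"] show ?thesis by (simp add: mult.assoc)
qed

section \<open>The Yang-Baxter equation and intertwiners\<close>

definition swp :: "nat \<Rightarrow> (nat \<Rightarrow> 'a) \<Rightarrow> nat \<Rightarrow> 'a" where
  "swp i u = u \<circ> transpose i (Suc i)"

lemma swp_simps [simp]: "swp i u i = u (Suc i)" "swp i u (Suc i) = u i"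
  "j \<noteq> i \<Longrightarrow> j \<noteq> Suc i \<Longrightarrow> swp i u j = u j"
  by (auto simp: swp_def)

locale blocks =
  fixes r :: nat
begin

text \<open>\<open>J i j\<close> says that \<open>i\<close> and \<open>j\<close> lie on the same side of \<open>r\<close>. Setting \<open>R u i j = 1\<close> otherwise
  treats both factors of the group at once. \<open>Ph\<close> multiplies the factors ordered by the larger index;
  this agrees with the lexicographic order because only factors with disjoint indices are exchanged.\<close>

definition J :: "nat \<Rightarrow> nat \<Rightarrow> bool" where "J i j \<longleftrightarrow> (i \<le> r \<longleftrightarrow> j \<le> r)"

definition R :: "(nat \<Rightarrow> complex) \<Rightarrow> nat \<Rightarrow> nat \<Rightarrow> galg" where
  "R u i j = (if J i j then 1 - sc (1 / (u i - u j)) * tp i j else 1)"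

primrec Tl :: "(nat \<Rightarrow> complex) \<Rightarrow> nat \<Rightarrow> nat \<Rightarrow> galg" where
  "Tl u m 0 = 1"
| "Tl u m (Suc j) = Tl u m j * R u (Suc j) m"

primrec Ph :: "(nat \<Rightarrow> complex) \<Rightarrow> nat \<Rightarrow> galg" where
  "Ph u 0 = 1"
| "Ph u (Suc m) = Ph u m * Tl u (Suc m) m"

definition gen :: "(nat \<Rightarrow> complex) \<Rightarrow> nat \<Rightarrow> bool" where
  "gen u m \<longleftrightarrow> (\<forall>i j. 1 \<le> i \<and> i < j \<and> j \<le> m \<and> J i j \<longrightarrow> u i \<noteq> u j)"

lemma J_refl [simp]: "J i i" and J_sym: "J i j \<Longrightarrow> J j i" and J_trans: "J i j \<Longrightarrow> J j k \<Longrightarrow> J i k"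
  by (auto simp: J_def)

lemma genD: "gen u m \<Longrightarrow> 1 \<le> i \<Longrightarrow> i < j \<Longrightarrow> j \<le> m \<Longrightarrow> J i j \<Longrightarrow> u i \<noteq> u j"
  by (auto simp: gen_def)

lemma gen_mono: "gen u m \<Longrightarrow> k \<le> m \<Longrightarrow> gen u k"
  by (auto simp: gen_def)

lemma R_yb:
  assumes "gen u m" "1 \<le> i" "i < j" "j < k" "k \<le> m"
  shows "R u i j * R u i k * R u j k = R u j k * R u i k * R u i j"
proof (cases "J i j \<and> J j k")
  case True
  then have "J i k" using J_trans by blast
  moreover have "u i \<noteq> u j" "u j \<noteq> u k" "u i \<noteq> u k"
    by (rule genD[OF assms(1)]; use assms True \<open>J i k\<close> in simp)+
  ultimately show ?thesis
    using True assms unfolding R_def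
    by (simp only: if_True, intro yang_baxter yb_scalar) auto
next
  case False
  \<comment> \<open>There are only two blocks: if the three indices do not share one, exactly one
    pair does, and the other two factors are 1.\<close>
  then have "R u i j = 1 \<or> R u j k = 1" "R u i k = 1 \<or> (R u i j = 1 \<and> R u j k = 1)"
    by (auto simp: R_def J_def)
  then show ?thesis by auto
qed

lemma R_commute: "{a, b} \<inter> {c, d} = {} \<Longrightarrow> R u a b * R u' c d = R u' c d * R u a b"
  using tp_disj[of a b c d]
  by (auto simp: R_def algebra_simps tp_sc mult.commute)

lemma R_tp_commute: "{a, b} \<inter> {c, d} = {} \<Longrightarrow> R u a b * tp c d = tp c d * R u a b"
  using tp_disj[of a b c d]
  by (auto simp: R_def algebra_simps tp_sc)

lemma Tl_commute:
  assumes "\<And>i. 1 \<le> i \<Longrightarrow> i \<le> j \<Longrightarrow> R u i m * x = x * R u i m"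
  shows "Tl u m j * x = x * Tl u m j"
  using assms
proof (induction j)
  case (Suc j)
  have "Tl u m (Suc j) * x = Tl u m j * (x * R u (Suc j) m)"
    using Suc.prems[of "Suc j"] by (simp add: mult.assoc)
  also have "\<dots> = x * Tl u m (Suc j)"
    using Suc by (simp flip: mult.assoc)
  finally show ?case .
qed simp

lemma Ph_commute:
  assumes "\<And>i j. 1 \<le> i \<Longrightarrow> i < j \<Longrightarrow> j \<le> m \<Longrightarrow> R u i j * x = x * R u i j"
  shows "Ph u m * x = x * Ph u m"
  using assms
proof (induction m)
  case (Suc m)
  have "Tl u (Suc m) m * x = x * Tl u (Suc m) m"
    by (rule Tl_commute) (use Suc.prems in auto)
  then have "Ph u (Suc m) * x = Ph u m * x * Tl u (Suc m) m"
    by (simp add: mult.assoc)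
  also have "\<dots> = x * Ph u (Suc m)"
    using Suc by (simp add: mult.assoc)
  finally show ?case .
qed simp

lemma Tl_cong: "(\<And>i. 1 \<le> i \<Longrightarrow> i \<le> j \<Longrightarrow> u i = v i) \<Longrightarrow> u m = v m \<Longrightarrow> Tl u m j = Tl v m j"
  by (induction j) (auto simp: R_def)

lemma Ph_cong: "(\<And>i. 1 \<le> i \<Longrightarrow> i \<le> m \<Longrightarrow> u i = v i) \<Longrightarrow> Ph u m = Ph v m"
proof (induction m)
  case (Suc m)
  then have "Tl u (Suc m) m = Tl v (Suc m) m" by (intro Tl_cong) auto
  with Suc show ?case by simp
qed simp

text \<open>One factor is carried through two tails: each index of the tails costs one Yang-Baxter
  equation, and factors with disjoint indices commute.\<close>

lemma Tl_Tl_R: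
  assumes "gen u M" "k < m" "m \<le> M" "j < k"
  shows "Tl u k j * Tl u m j * R u k m = R u k m * Tl u m j * Tl u k j"
  using assms(4)
proof (induction j)
  case (Suc j)
  let ?i = "Suc j"
  have c1: "Tl u m j * R u ?i k = R u ?i k * Tl u m j"
    by (rule Tl_commute, rule R_commute) (use Suc.prems assms in auto)
  have c2: "Tl u k j * R u ?i m = R u ?i m * Tl u k j"
    by (rule Tl_commute, rule R_commute) (use Suc.prems assms in auto)
  have yb: "R u ?i k * R u ?i m * R u k m = R u k m * R u ?i m * R u ?i k"
    by (rule R_yb[OF assms(1)]) (use Suc.prems assms in auto)
  have "Tl u k ?i * Tl u m ?i * R u k m = Tl u k j * (R u ?i k * Tl u m j) * R u ?i m * R u k m"
    by (simp add: mult.assoc)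
  also have "\<dots> = Tl u k j * Tl u m j * (R u ?i k * R u ?i m * R u k m)"
    by (simp add: mult.assoc flip: c1)
  also have "\<dots> = (Tl u k j * Tl u m j * R u k m) * R u ?i m * R u ?i k"
    unfolding yb by (simp add: mult.assoc)
  also have "\<dots> = R u k m * Tl u m j * (Tl u k j * R u ?i m) * R u ?i k"
    using Suc by (simp add: mult.assoc)
  also have "\<dots> = R u k m * Tl u m ?i * Tl u k ?i"
    unfolding c2 by (simp add: mult.assoc)
  finally show ?case .
qed simp

lemma tr_R [simp]: "tr (R u i j) = R u i j"
  by (simp add: R_def tr_diff tr_mult sc_commute)

text \<open>Carrying a tail across \<open>Ph\<close> reverses it. For the last tail this is the
  induction step of \<open>tr_Ph\<close>.\<close>

lemma Ph_Tl:
  assumes "gen u M" "m \<le> M" "k < m"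
  shows "Ph u k * Tl u m k = tr (Tl u m k) * Ph u k"
  using assms(3)
proof (induction k)
  case (Suc k)
  have c: "Ph u k * R u (Suc k) m = R u (Suc k) m * Ph u k"
    by (rule Ph_commute, rule R_commute) (use Suc.prems in auto)
  have "Ph u (Suc k) * Tl u m (Suc k) = Ph u k * (Tl u (Suc k) k * Tl u m k * R u (Suc k) m)"
    by (simp add: mult.assoc)
  also have "\<dots> = (Ph u k * R u (Suc k) m) * Tl u m k * Tl u (Suc k) k"
    using Tl_Tl_R[OF assms(1), of "Suc k" m k] Suc.prems assms by (simp add: mult.assoc)
  also have "\<dots> = R u (Suc k) m * (Ph u k * Tl u m k) * Tl u (Suc k) k"
    unfolding c by (simp add: mult.assoc)
  also have "\<dots> = tr (Tl u m (Suc k)) * Ph u (Suc k)"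
    using Suc by (simp add: mult.assoc tr_mult)
  finally show ?case .
qed simp

lemma tr_Ph: "gen u m \<Longrightarrow> tr (Ph u m) = Ph u m"
proof (induction m)
  case (Suc m)
  then show ?case
    using Ph_Tl[OF Suc.prems order_refl, of m] gen_mono[OF Suc.prems, of m]
    by (simp add: tr_mult)
qed simp

lemma tp_Tl_conj:
  assumes "i \<ge> 1" "J i (Suc i)" "j < i"
  shows "tp i (Suc i) * Tl u (Suc i) j = Tl (swp i u) i j * tp i (Suc i)"
    and "tp i (Suc i) * Tl u i j = Tl (swp i u) (Suc i) j * tp i (Suc i)"
proof -
  let ?s = "tp i (Suc i)" and ?v = "swp i u"
  have a: "?s * R u (Suc j) (Suc i) = R ?v (Suc j) i * ?s" "?s * R u (Suc j) i = R ?v (Suc j) (Suc i) * ?s"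
    if "Suc j < i" for j
  proof -
    have "?s * tp (Suc j) (Suc i) = tp (Suc j) i * ?s" "?s * tp (Suc j) i = tp (Suc j) (Suc i) * ?s"
      using that by (subst tp_conj, auto simp: transpose_def)+
    then show "?s * R u (Suc j) (Suc i) = R ?v (Suc j) i * ?s" "?s * R u (Suc j) i = R ?v (Suc j) (Suc i) * ?s"
      using that assms(2) by (auto simp: R_def right_diff_distrib left_diff_distrib tp_sc mult.assoc J_def transpose_def)
  qed
  show "?s * Tl u (Suc i) j = Tl ?v i j * ?s"
    using assms(3)
  proof (induction j)
    case (Suc j)
    then have "?s * Tl u (Suc i) (Suc j) = Tl ?v i j * (?s * R u (Suc j) (Suc i))"
      by (simp flip: mult.assoc)
    then show ?case using a[of j] Suc.prems by (simp add: mult.assoc)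
  qed simp
  show "?s * Tl u i j = Tl ?v (Suc i) j * ?s"
    using assms(3)
  proof (induction j)
    case (Suc j)
    then have "?s * Tl u i (Suc j) = Tl ?v (Suc i) j * (?s * R u (Suc j) i)"
      by (simp flip: mult.assoc)
    then show ?case using a[of j] Suc.prems by (simp add: mult.assoc)
  qed simp
qed

text \<open>Only the factors at \<open>i\<close> and \<open>Suc i\<close> meet the transposition
  nontrivially, and for them the claim is \<open>yang_baxter'\<close>; all others commute with
  it.\<close>

lemma Tl_intertwine:
  assumes g: "gen u M" "m \<le> M" and i: "i \<ge> 1" "J i (Suc i)" "Suc i \<le> j" "j < m"
  defines "a \<equiv> 1 / (u i - u (Suc i))"
  shows "Tl u m j * (tp i (Suc i) + sc a) = (tp i (Suc i) + sc a) * Tl (swp i u) m j"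
  using i(3,4)
proof (induction j rule: dec_induct)
  case base
  let ?s = "tp i (Suc i)" and ?v = "swp i u"
  obtain k where k: "i = Suc k" using i(1) by (cases i) auto
  have e: "Tl ?v m k = Tl u m k"
    by (rule Tl_cong) (use k base in \<open>auto simp: transpose_def\<close>)
  have c: "Tl u m k * (?s + sc a) = (?s + sc a) * Tl u m k"
  proof (rule Tl_commute)
    fix l assume "1 \<le> l" "l \<le> k"
    then have "R u l m * ?s = ?s * R u l m"
      by (intro R_tp_commute) (use k base in auto)
    then show "R u l m * (?s + sc a) = (?s + sc a) * R u l m"
      by (simp add: distrib_left distrib_right sc_commute)
  qed
  have "R u i m * R u (Suc i) m * (?s + sc a) = (?s + sc a) * (R ?v i m * R ?v (Suc i) m)"
  proof (cases "J i m")
    case True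
    then have J: "J (Suc i) m" using i(2) J_sym J_trans by blast
    have "u i \<noteq> u (Suc i)" "u (Suc i) \<noteq> u m" "u i \<noteq> u m"
      by (rule genD[OF g(1)]; use g i base J True in simp)+
    then have "a * (1 / (u i - u m)) + 1 / (u i - u m) * (1 / (u (Suc i) - u m)) = a * (1 / (u (Suc i) - u m))"
      unfolding a_def by (rule yb_scalar)
    from yang_baxter'[OF _ _ _ this, of i "Suc i" m] base J True show ?thesis
      unfolding R_def by auto
  next
    case False
    then have "\<not> J (Suc i) m" using i(2) J_trans by blast
    with False show ?thesis by (simp add: R_def)
  qed
  then have "Tl u m (Suc i) * (?s + sc a) = Tl u m k * (?s + sc a) * (R ?v i m * R ?v (Suc i) m)"
    by (simp add: k mult.assoc)
  also have "\<dots> = (?s + sc a) * Tl ?v m (Suc i)"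
    unfolding c using arg_cong[OF k, of "Tl ?v m"] e by (simp add: mult.assoc k)
  finally show ?case .
next
  case (step j)
  let ?s = "tp i (Suc i)" and ?v = "swp i u"
  have e: "R u (Suc j) m = R ?v (Suc j) m" using step by (auto simp: R_def transpose_def)
  have "R u (Suc j) m * ?s = ?s * R u (Suc j) m"
    by (intro R_tp_commute) (use step in auto)
  then have c: "R u (Suc j) m * (?s + sc a) = (?s + sc a) * R u (Suc j) m"
    by (simp add: distrib_left distrib_right sc_commute)
  have "Tl u m (Suc j) * (?s + sc a) = (Tl u m j * (?s + sc a)) * R u (Suc j) m"
    unfolding Tl.simps mult.assoc c ..
  also have "Tl u m j * (?s + sc a) = (?s + sc a) * Tl ?v m j"
    using step by simp
  finally show ?case unfolding e Tl.simps mult.assoc .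
qed

text \<open>Later tails let \<open>tp i (Suc i) + sc a\<close> pass unchanged. The sign of
  \<open>a\<close> changes where both indices meet, because there the factor
  \<open>1 - sc a * s\<close> is traded for \<open>1 + sc a * s\<close>, with \<open>s\<close> the
  transposition.\<close>

lemma Ph_intertwine:
  assumes g: "gen u m" and i: "i \<ge> 1" "J i (Suc i)" "Suc i \<le> m"
  defines "a \<equiv> 1 / (u i - u (Suc i))"
  shows "Ph u m * (tp i (Suc i) + sc a) = (tp i (Suc i) - sc a) * Ph (swp i u) m"
  using i(3) g
proof (induction m rule: dec_induct)
  case base
  let ?s = "tp i (Suc i)" and ?v = "swp i u"
  obtain k where k: "i = Suc k" using i(1) by (cases i) auto
  let ?P = "Ph u k" and ?A = "Tl u i k" and ?B = "Tl u (Suc i) k" and ?R = "R u i (Suc i)"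
  let ?A' = "Tl ?v i k" and ?B' = "Tl ?v (Suc i) k" and ?R' = "R ?v i (Suc i)"
  have Pe: "Ph ?v k = ?P" by (rule Ph_cong) (use k in \<open>auto simp: transpose_def\<close>)
  have R: "?R = 1 - sc a * ?s" using i by (simp add: R_def a_def)
  have "1 / (u (Suc i) - u i) = - a" unfolding a_def
    by (metis minus_diff_eq minus_divide_right)
  then have R': "?R' = 1 + sc a * ?s" using i by (simp add: R_def sc_uminus)
  \<comment> \<open>The factor needed for the exchanged parameters is split off on the right; what
    finally stands on the left is \<open>?R * ?s\<close>, which is \<open>?s - sc a\<close>.\<close>
  have 1: "?s + sc a = ?s * ?R'" by (simp add: R' distrib_left tp_sc)
  have 2: "?A * ?B * ?R = ?R * ?B * ?A"
    by (rule Tl_Tl_R[OF base.prems]) (use k in auto)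
  have x: "?s * ?B = ?A' * ?s" and y: "?s * ?A = ?B' * ?s"
    by (rule tp_Tl_conj; use i k in simp)+
  have "?s * ?A' = ?s * (?A' * ?s) * ?s" by (simp add: mult.assoc)
  then have x': "?s * ?A' = ?B * ?s" by (simp flip: x add: mult.assoc)
  have "?s * ?B' = ?s * (?B' * ?s) * ?s" by (simp add: mult.assoc)
  then have y': "?s * ?B' = ?A * ?s" by (simp flip: y add: mult.assoc)
  have 3: "?B * ?A * ?s = ?s * ?A' * ?B'"
    unfolding x' by (simp add: mult.assoc y')
  have 4: "?P * ?s = ?s * ?P"
    by (rule Ph_commute, rule R_tp_commute) (use k in auto)
  have 5: "?R * ?s = ?s - sc a" by (simp add: R left_diff_distrib mult.assoc)
  have "Ph u i = ?P * ?A" "Tl u (Suc i) i = ?B * ?R"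
    by (simp_all add: k)
  then have "Ph u (Suc i) * (?s + sc a) = ?P * (?A * ?B * ?R) * ?s * ?R'"
    unfolding 1 by (simp add: mult.assoc)
  also have "\<dots> = ?P * ?R * (?B * ?A * ?s) * ?R'" unfolding 2 by (simp add: mult.assoc)
  also have "\<dots> = ?P * (?R * ?s) * ?A' * ?B' * ?R'" unfolding 3 by (simp add: mult.assoc)
  also have "?P * (?R * ?s) = (?R * ?s) * ?P"
    unfolding 5 by (simp add: left_diff_distrib right_diff_distrib 4 sc_commute)
  also have "?R * ?s * ?P * ?A' * ?B' * ?R' = (?s - sc a) * Ph ?v (Suc i)"
  proof -
    have "Ph ?v i = ?P * ?A'" "Tl ?v (Suc i) i = ?B' * ?R'"
      using Pe by (simp_all add: k)
    then show ?thesis unfolding 5 by (simp add: mult.assoc)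
  qed
  finally show ?case .
next
  case (step m)
  let ?s = "tp i (Suc i)" and ?v = "swp i u"
  have "Tl u (Suc m) m * (?s + sc a) = (?s + sc a) * Tl ?v (Suc m) m"
    unfolding a_def by (rule Tl_intertwine[OF step.prems]) (use step i in auto)
  moreover have "Ph u m * (?s + sc a) = (?s - sc a) * Ph ?v m"
    using step gen_mono by (meson le_SucI order_refl)
  ultimately show ?case by (simp add: mult.assoc) (simp flip: mult.assoc)
qed

text \<open>As \<open>(s + a) (s - a) = 1 - a^2\<close>, the intertwining relation becomes a formula
  for \<open>Ph u m\<close> in which one divides by \<open>1 - a^2\<close> only. It transports
  regularity between tableaux.\<close>

lemma Ph_sandwich:
  assumes g: "gen u m" and i: "i \<ge> 1" "J i (Suc i)" "Suc i \<le> m"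
  defines "a \<equiv> 1 / (u i - u (Suc i))"
  shows "sc (1 - a\<^sup>2) * Ph u m =
    (tp i (Suc i) - sc a) * Ph (swp i u) m * (tp i (Suc i) - sc a)"
proof -
  let ?s = "tp i (Suc i)"
  have "(?s + sc a) * (?s - sc a) = sc (1 - a\<^sup>2)"
    by (simp add: distrib_right right_diff_distrib sc_commute[of ?s] sc_diff power2_eq_square sc_mult)
  then have "Ph u m * sc (1 - a\<^sup>2) = (Ph u m * (?s + sc a)) * (?s - sc a)"
    by (simp add: mult.assoc)
  then show ?thesis
    using Ph_intertwine[OF g i] by (simp add: a_def sc_commute)
qed

text \<open>At distance \<open>e\<close> the factor \<open>R u i (Suc i)\<close> is
  \<open>1 + sc e * s\<close>, twice a projection, and annihilates \<open>s - sc e\<close>; the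
  later tails let that element pass by intertwining.\<close>

lemma Ph_tp_eigen:
  assumes g: "gen u m" and i: "i \<ge> 1" "J i (Suc i)" "Suc i \<le> m"
    and e: "u (Suc i) = u i + e" "e = 1 \<or> e = -1"
  shows "Ph u m * tp i (Suc i) = sc e * Ph u m"
proof -
  let ?s = "tp i (Suc i)"
  have a: "1 / (u i - u (Suc i)) = - e" using e by auto
  have "Ph u m * (?s + sc (- e)) = 0"
    using i(3) g
  proof (induction m rule: dec_induct)
    case base
    have ee: "e * e = 1" using e by auto
    have "R u i (Suc i) * (?s + sc (- e)) = 0"
      using i a by (simp add: ee tp_sc(3) R_def sc_uminus distrib_right right_diff_distrib
        sc_commute[of "tp i (Suc i)"] mult.assoc)
    moreover obtain k where k: "i = Suc k" using i(1) by (cases i) auto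
    ultimately show ?case by (simp add: mult.assoc)
  next
    case (step m)
    have "Tl u (Suc m) m * (?s + sc (- e)) = (?s + sc (- e)) * Tl (swp i u) (Suc m) m"
      using Tl_intertwine[OF step.prems order_refl i(1,2), of m] step(1,2) by (simp only: a)
    moreover have "Ph u m * (?s + sc (- e)) = 0"
      using step gen_mono by (meson le_SucI order_refl)
    ultimately show ?case by (simp add: mult.assoc) (simp flip: mult.assoc)
  qed
  then show ?thesis by (simp add: right_diff_distrib sc_uminus sc_commute[of "Ph u m"])
qed

end

context blocks
begin

section \<open>Jucys-Murphy elements\<close>

text \<open>For \<open>m \<le> r\<close> this is the symmetric group on \<open>1..m\<close>, beyond
  that the full first factor times the symmetric group on \<open>r+1..m\<close>: one chain of
  subgroups through both blocks, along which the inductions run.\<close>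

definition grp :: "nat \<Rightarrow> nat perm set" where
  "grp m = {g. (\<forall>k. k \<notin> {1..m} \<longrightarrow> apply g k = k) \<and> (\<forall>k. J k (apply g k))}"

definition alg :: "nat \<Rightarrow> galg set" where "alg m = {a. keys a \<subseteq> grp m}"

definition X :: "nat \<Rightarrow> galg" where "X k = (\<Sum>j\<in>{j\<in>{1..<k}. J j k}. tp j k)"

lemma grp_zero [simp]: "0 \<in> grp m"
  by (simp add: grp_def)

lemma grp_plus: "g \<in> grp m \<Longrightarrow> h \<in> grp m \<Longrightarrow> g + h \<in> grp m"
  using J_trans unfolding grp_def apply_plus comp_apply mem_Collect_eq by metis

lemma grp_uminus: "g \<in> grp m \<Longrightarrow> - g \<in> grp m"
proof -
  assume g: "g \<in> grp m"
  have b: "apply g (inv (apply g) k) = k" for k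
    by (meson bij_apply bij_is_surj surj_f_inv_f)
  have "J k (inv (apply g) k)" for k
    using g b[of k] J_sym unfolding grp_def mem_Collect_eq by metis
  moreover have "inv (apply g) k = k" if "k \<notin> {1..m}" for k
  proof -
    have "apply g k = k" using g that by (auto simp: grp_def)
    then show ?thesis using b[of k] apply_inj by metis
  qed
  ultimately show ?thesis by (auto simp: grp_def apply_uminus)
qed

lemma grp_mono: "k \<le> m \<Longrightarrow> grp k \<subseteq> grp m"
  by (auto simp: grp_def)

lemma grp_swap: "1 \<le> i \<Longrightarrow> 1 \<le> j \<Longrightarrow> i \<le> m \<Longrightarrow> j \<le> m \<Longrightarrow> J i j \<Longrightarrow> Perm.swap i j \<in> grp m"
  by (auto simp: grp_def swap_apply transpose_def J_def)

lemma alg_mono: "k \<le> m \<Longrightarrow> a \<in> alg k \<Longrightarrow> a \<in> alg m"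
  using grp_mono by (auto simp: alg_def)

lemma alg_single: "g \<in> grp m \<Longrightarrow> single g c \<in> alg m"
  by (auto simp: alg_def)

lemma alg_sc [simp]: "sc c \<in> alg m"
  unfolding sc_def by (rule alg_single) simp

lemma alg_0 [simp]: "0 \<in> alg m" and alg_1 [simp]: "1 \<in> alg m"
  using alg_sc[of 0 m] alg_sc[of 1 m] by simp_all

lemma alg_add: "a \<in> alg m \<Longrightarrow> b \<in> alg m \<Longrightarrow> a + b \<in> alg m"
  using keys_add[of a b] by (auto simp: alg_def)

lemma alg_uminus: "a \<in> alg m \<Longrightarrow> - a \<in> alg m"
  by (auto simp: alg_def in_keys_iff)

lemma alg_diff: "a \<in> alg m \<Longrightarrow> b \<in> alg m \<Longrightarrow> a - b \<in> alg m"
  using alg_add[of a m "- b"] alg_uminus by simp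

lemma alg_mult: "a \<in> alg m \<Longrightarrow> b \<in> alg m \<Longrightarrow> a * b \<in> alg m"
  using keys_mult[of a b] grp_plus by (fastforce simp: alg_def)

lemma alg_sum: "(\<And>i. i \<in> I \<Longrightarrow> f i \<in> alg m) \<Longrightarrow> sum f I \<in> alg m"
  by (induction I rule: infinite_finite_induct) (auto intro: alg_add)

lemma alg_tp: "1 \<le> i \<Longrightarrow> 1 \<le> j \<Longrightarrow> i \<le> m \<Longrightarrow> j \<le> m \<Longrightarrow> J i j \<Longrightarrow> tp i j \<in> alg m"
  unfolding tp_def by (intro alg_single grp_swap)

lemma alg_R: "1 \<le> i \<Longrightarrow> 1 \<le> j \<Longrightarrow> i \<le> m \<Longrightarrow> j \<le> m \<Longrightarrow> R u i j \<in> alg m"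
  by (auto simp: R_def intro!: alg_diff alg_mult alg_tp)

lemma alg_Tl: "1 \<le> k \<Longrightarrow> k \<le> m \<Longrightarrow> j \<le> m \<Longrightarrow> Tl u k j \<in> alg m"
  by (induction j) (auto intro!: alg_mult alg_R)

lemma alg_Ph: "Ph u m \<in> alg m"
  by (induction m) (auto intro!: alg_mult alg_Tl intro: alg_mono[OF le_SucI[OF order_refl]])

lemma alg_star: "a \<in> alg m \<Longrightarrow> star a \<in> alg m" and alg_tr: "a \<in> alg m \<Longrightarrow> tr a \<in> alg m"
proof -
  have *: "g \<in> grp m" if "a \<in> alg m" "lookup a (- g) \<noteq> 0" for g
    using that grp_uminus[of "- g" m] by (auto simp: alg_def in_keys_iff)
  show "a \<in> alg m \<Longrightarrow> star a \<in> alg m" "a \<in> alg m \<Longrightarrow> tr a \<in> alg m"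
    using * by (auto simp: alg_def in_keys_iff)
qed

lemma alg_X: "k \<le> m \<Longrightarrow> X k \<in> alg m"
  unfolding X_def by (intro alg_sum alg_tp) auto

lemma adj_X: "\<sigma> = (\<lambda>x. x) \<or> \<sigma> = cnj \<Longrightarrow> adj \<sigma> (X k) = X k"
  by (auto simp: X_def star_sum tr_sum)

lemmas star_X [simp] = adj_X[OF disjI2[OF refl]] and tr_X [simp] = adj_X[OF disjI1[OF refl]]

text \<open>Conjugation by an element of \<open>grp m\<close> fixes \<open>k\<close> and permutes
  the summands of \<open>X k\<close>.\<close>

lemma X_commute:
  assumes "a \<in> alg m" "m < k"
  shows "X k * a = a * X k"
proof -
  have 1: "X k * single g c = single g c * X k" if g: "g \<in> grp m" for g c
  proof -
    let ?S = "{j \<in> {1..<k}. J j k}"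
    have i: "inj_on (apply g) ?S" by (meson bij_apply bij_is_inj inj_on_subset subset_UNIV)
    have "apply g ` ?S \<subseteq> ?S"
    proof safe
      fix j assume j: "j \<in> {1..<k}" "J j k"
      have jj: "apply g j \<in> {1..m}" if "j \<in> {1..m}"
      proof (rule ccontr)
        assume n: "apply g j \<notin> {1..m}"
        then have "apply g (apply g j) = apply g j" using g by (auto simp: grp_def)
        then have "apply g j = j" by (simp add: apply_inj)
        with that n show False by simp
      qed
      show "J (apply g j) k" using g j by (auto simp: grp_def J_def)
      show "apply g j \<in> {1..<k}"
        using jj assms(2) j g by (cases "j \<in> {1..m}") (auto simp: grp_def)
    qed
    then have b: "bij_betw (apply g) ?S ?S"
      using i by (simp add: bij_betw_def endo_inj_surj)
    have gk: "apply g k = k" using g assms(2) by (auto simp: grp_def)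
    have "single g c * X k = (\<Sum>j\<in>?S. tp (apply g j) k * single g c)"
      unfolding X_def sum_distrib_left by (simp add: single_tp gk)
    also have "\<dots> = (\<Sum>j\<in>?S. tp j k * single g c)"
      by (rule sum.reindex_bij_betw[OF b, of "\<lambda>j. tp j k * single g c"])
    finally show ?thesis by (simp add: X_def sum_distrib_right)
  qed
  have "X k * (\<Sum>g\<in>keys a. single g (lookup a g)) = (\<Sum>g\<in>keys a. single g (lookup a g)) * X k"
    unfolding sum_distrib_left sum_distrib_right
    by (rule sum.cong[OF refl], rule 1) (use assms in \<open>auto simp: alg_def\<close>)
  then show ?thesis using galg_expand[of a] by simp
qed

lemma X_Suc:
  assumes "1 \<le> k" "J k (Suc k)"
  shows "X (Suc k) = tp k (Suc k) * X k * tp k (Suc k) + tp k (Suc k)"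
proof -
  have "{j \<in> {1..<Suc k}. J j (Suc k)} = insert k {j \<in> {1..<k}. J j k}"
    using assms by (auto simp: less_Suc_eq J_def)
  then have 1: "X (Suc k) = (\<Sum>j\<in>{j \<in> {1..<k}. J j k}. tp j (Suc k)) + tp k (Suc k)"
    unfolding X_def by (simp only: sum.insert) (subst sum.insert, auto)
  have "tp k (Suc k) * tp j k * tp k (Suc k) = tp j (Suc k)" if "j < k" for j
  proof -
    have "tp k (Suc k) * tp j k = tp j (Suc k) * tp k (Suc k)"
      using that by (subst tp_conj) (auto simp: transpose_def)
    then show ?thesis by (simp add: mult.assoc)
  qed
  then have "tp k (Suc k) * X k * tp k (Suc k) = (\<Sum>j\<in>{j \<in> {1..<k}. J j k}. tp j (Suc k))"
    unfolding X_def sum_distrib_left sum_distrib_right by (intro sum.cong) auto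
  then show ?thesis using 1 by simp
qed

lemma X_start: "\<not> J k (Suc k) \<Longrightarrow> X (Suc k) = 0"
  unfolding X_def by (rule sum.neutral) (auto simp: J_def)

lemma X_1 [simp]: "X (Suc 0) = 0" "X 0 = 0"
  by (simp_all add: X_def)

text \<open>The relations of the degenerate affine Hecke algebra.\<close>

lemma tp_X:
  assumes "1 \<le> k" "J k (Suc k)"
  shows "X (Suc k) * tp k (Suc k) = tp k (Suc k) * X k + 1"
    and "tp k (Suc k) * X (Suc k) = X k * tp k (Suc k) + 1"
    and "X k * tp k (Suc k) = tp k (Suc k) * X (Suc k) - 1"
  by (simp_all add: X_Suc[OF assms] distrib_left distrib_right mult.assoc)

lemma tp_X_other:
  assumes "1 \<le> k" "J k (Suc k)" "j \<noteq> k" "j \<noteq> Suc k"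
  shows "X j * tp k (Suc k) = tp k (Suc k) * X j"
proof (cases "j < k")
  case True
  have "tp i j * tp k (Suc k) = tp k (Suc k) * tp i j" if "i < j" for i
    by (rule tp_disj) (use True that in auto)
  then show ?thesis by (simp add: X_def sum_distrib_left sum_distrib_right)
next
  case False
  show ?thesis by (rule X_commute[of _ "Suc k"], rule alg_tp) (use assms False in auto)
qed

text \<open>In the expanded tail every term that contains a transposition moves
  \<open>Suc m\<close>, so it does not contribute to the coefficient of the identity.\<close>

lemma tau_Tl:
  assumes "x \<in> alg m" "j \<le> m"
  shows "tau (x * Tl u (Suc m) j) = tau x"
proof -
  let ?M = "Suc m"
  \<comment> \<open>Invariant of the expansion: the preimage of \<open>?M\<close> is
    \<open>?M\<close> itself or lies outside \<open>j+1..m\<close>. A further transposition of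
    \<open>j+1\<close> and \<open>?M\<close> on the right then sends \<open>?M\<close>
    elsewhere.\<close>
  define N where "N j = {g. \<forall>k. j < k \<and> k < ?M \<longrightarrow> apply g k \<noteq> ?M}" for j
  have st: "g + Perm.swap (Suc j) ?M \<in> N (Suc j) \<and> g + Perm.swap (Suc j) ?M \<noteq> 0"
    if "g \<in> N j" "j < m" for g j
  proof -
    have "apply (g + Perm.swap (Suc j) ?M) ?M = apply g (Suc j)"
      by (simp add: apply_plus swap_apply)
    moreover have "apply g (Suc j) \<noteq> ?M" using that by (auto simp: N_def)
    ultimately have "g + Perm.swap (Suc j) ?M \<noteq> 0" by auto
    moreover have "g + Perm.swap (Suc j) ?M \<in> N (Suc j)"
      using that by (auto simp: N_def apply_plus swap_apply transpose_def)
    ultimately show ?thesis by simp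
  qed
  have km: "keys (y * tp (Suc j) ?M) \<subseteq> (\<lambda>g. g + Perm.swap (Suc j) ?M) ` keys y" for y j
    using keys_mult[of y "tp (Suc j) ?M"] by (auto simp: tp_def)
  have "keys (x * Tl u ?M j) \<subseteq> N j \<and> tau (x * Tl u ?M j) = tau x"
    using assms(2)
  proof (induction j)
    case 0
    have "apply g k \<noteq> ?M" if g: "g \<in> grp m" and k: "k < ?M" for g k
    proof
      assume e: "apply g k = ?M"
      have "apply g ?M = ?M" using g by (auto simp: grp_def)
      with e have "k = ?M" by (metis apply_inj)
      with k show False by simp
    qed
    then show ?case using assms(1) by (auto simp: N_def alg_def)
  next
    case (Suc j)
    let ?y = "x * Tl u ?M j"
    have y: "keys ?y \<subseteq> N j" "tau ?y = tau x" using Suc by auto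
    have k: "keys (?y * tp (Suc j) ?M) \<subseteq> N (Suc j)" "0 \<notin> keys (?y * tp (Suc j) ?M)"
      using km[of ?y j] st y(1) Suc.prems by (auto dest!: subsetD)
    have N: "N j \<subseteq> N (Suc j)" by (auto simp: N_def)
    show ?case
    proof (cases "J (Suc j) ?M")
      case True
      have e: "x * Tl u ?M (Suc j) = ?y - sc (1 / (u (Suc j) - u ?M)) * (?y * tp (Suc j) ?M)"
        using True by (simp add: R_def right_diff_distrib mult.assoc sc_left_commute)
      have "keys (x * Tl u ?M (Suc j)) \<subseteq> N (Suc j)"
      proof
        fix g assume "g \<in> keys (x * Tl u ?M (Suc j))"
        then have "g \<in> keys ?y \<or> g \<in> keys (?y * tp (Suc j) ?M)"
          unfolding e in_keys_iff lookup_minus lookup_sc_times by auto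
        then show "g \<in> N (Suc j)" using k(1) y(1) N by blast
      qed
      moreover have "tau (x * Tl u ?M (Suc j)) = tau x"
        unfolding e tau_diff tau_sc using k(2) y(2) by (simp add: tau_def in_keys_iff)
      ultimately show ?thesis by blast
    next
      case False
      then show ?thesis using y N by (auto simp: R_def)
    qed
  qed
  then show ?thesis by blast
qed

lemma tau_Ph: "tau (Ph u m) = 1"
  by (induction m) (simp_all add: tau_Tl[OF alg_Ph])

text \<open>\<open>Qd u m k\<close> is the inverse of \<open>Tl u m k\<close> up to the scalar \<open>beta\<close>. On a right eigenvector of the
  Jucys-Murphy elements it telescopes to \<open>1 - X m / u m\<close>.\<close>

primrec Qd :: "(nat \<Rightarrow> complex) \<Rightarrow> nat \<Rightarrow> nat \<Rightarrow> galg" where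
  "Qd u m 0 = 1"
| "Qd u m (Suc k) = (if J (Suc k) m then 1 + sc (1 / (u (Suc k) - u m)) * tp (Suc k) m else 1) * Qd u m k"

definition beta :: "(nat \<Rightarrow> complex) \<Rightarrow> nat \<Rightarrow> nat \<Rightarrow> complex" where
  "beta u m k = (\<Prod>j\<in>{j\<in>{1..k}. J j m}. 1 - (1 / (u j - u m))\<^sup>2)"

lemma Qd_Tl: "Qd u m k * Tl u m k = sc (beta u m k)"
proof (induction k)
  case (Suc k)
  let ?a = "1 / (u (Suc k) - u m)" and ?t = "tp (Suc k) m"
  have S: "{j \<in> {1..Suc k}. J j m} = (if J (Suc k) m then {Suc k} else {}) \<union> {j \<in> {1..k}. J j m}"
    by (auto simp: le_Suc_eq)
  have b: "beta u m (Suc k) = (if J (Suc k) m then 1 - ?a\<^sup>2 else 1) * beta u m k"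
    unfolding beta_def S by (subst prod.union_disjoint) auto
  show ?case
  proof (cases "J (Suc k) m")
    case True
    have "Qd u m (Suc k) * Tl u m (Suc k) = (1 + sc ?a * ?t) * (Qd u m k * Tl u m k) * (1 - sc ?a * ?t)"
      using True by (simp add: R_def mult.assoc)
    also have "\<dots> = sc (beta u m k) * ((1 + sc ?a * ?t) * (1 - sc ?a * ?t))"
      unfolding Suc by (simp only: mult.assoc sc_left_commute[of "1 + sc ?a * ?t"])
    also have "(1 + sc ?a * ?t) * (1 - sc ?a * ?t) = sc (1 - ?a\<^sup>2)"
      by (simp only: distrib_right right_diff_distrib mult_1_left mult_1_right mult.assoc tp_sc(2,3) tp_sq
        power2_eq_square sc_diff sc_1) (simp flip: sc_mult)
    finally show ?thesis using True unfolding b by (simp add: mult.commute flip: sc_mult)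
  next
    case False
    then show ?thesis using Suc unfolding b by (simp add: R_def)
  qed
qed (simp add: beta_def)

lemma Qd_eigen:
  assumes "\<And>j. 1 \<le> j \<Longrightarrow> j \<le> k \<Longrightarrow> Y * X j = sc (u j) * Y" "k < m" "u m \<noteq> 0"
    and "\<And>j. 1 \<le> j \<Longrightarrow> j \<le> k \<Longrightarrow> J j m \<Longrightarrow> u j \<noteq> u m"
  shows "Y * Qd u m k = Y - sc (1 / u m) * (Y * (\<Sum>j\<in>{j\<in>{1..k}. J j m}. tp j m))"
  using assms(1,2,4)
proof (induction k arbitrary: Y)
  case (Suc k)
  let ?w = "u m" and ?c = "u (Suc k)" and ?t = "tp (Suc k) m"
  let ?S = "\<lambda>k. \<Sum>j\<in>{j\<in>{1..k}. J j m}. tp j m"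
  have S: "{j \<in> {1..Suc k}. J j m} = (if J (Suc k) m then {Suc k} else {}) \<union> {j \<in> {1..k}. J j m}"
    by (auto simp: le_Suc_eq)
  have SS: "?S (Suc k) = (if J (Suc k) m then ?t else 0) + ?S k"
    unfolding S by (subst sum.union_disjoint) auto
  have IH: "Y * Qd u m k = Y - sc (1 / ?w) * (Y * ?S k)"
    by (rule Suc.IH) (use Suc.prems in auto)
  show ?case
  proof (cases "J (Suc k) m")
    case True
    have cw: "?c - ?w \<noteq> 0" using Suc.prems(3)[of "Suc k"] True by auto
    have com: "?t * X j = X j * ?t" if "1 \<le> j" "j \<le> k" for j
    proof -
      have "?t * tp i j = tp i j * ?t" if "i < j" for i
        by (rule tp_disj) (use that \<open>j \<le> k\<close> Suc.prems(2) in auto)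
      then show ?thesis by (simp add: X_def sum_distrib_left sum_distrib_right)
    qed
    \<comment> \<open>\<open>Y * ?t\<close> is again a right eigenvector of \<open>X 1\<close>, ...,
      \<open>X k\<close>, since \<open>?t\<close> commutes with them; this is why the induction
      leaves \<open>Y\<close> arbitrary.\<close>
    have IH2: "Y * ?t * Qd u m k = Y * ?t - sc (1 / ?w) * (Y * ?t * ?S k)"
    proof (rule Suc.IH)
      fix j assume "1 \<le> j" "j \<le> k"
      then show "Y * ?t * X j = sc (u j) * (Y * ?t)"
        using Suc.prems(1)[of j] com[of j] by (simp add: mult.assoc) (simp flip: mult.assoc)
    qed (use Suc.prems in auto)
    \<comment> \<open>Moving \<open>?t\<close> to the right relabels \<open>m\<close> as
      \<open>Suc k\<close>, so the partial sum becomes a Jucys-Murphy element whose eigenvalue on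
      \<open>Y\<close> is known.\<close>
    have "?t * ?S k = X (Suc k) * ?t"
      unfolding X_def sum_distrib_left sum_distrib_right
    proof (rule sum.cong)
      show "{j \<in> {1..k}. J j m} = {j \<in> {1..<Suc k}. J j (Suc k)}"
        using True by (auto simp: less_Suc_eq_le J_def)
      fix j assume "j \<in> {j \<in> {1..<Suc k}. J j (Suc k)}"
      then show "?t * tp j m = tp j (Suc k) * ?t"
        using Suc.prems(2) by (subst tp_conj) (auto simp: transpose_def)
    qed
    then have "Y * ?t * ?S k = sc ?c * (Y * ?t)"
      using Suc.prems(1)[of "Suc k"] by (simp add: mult.assoc) (simp flip: mult.assoc)
    then have IH3: "Y * ?t * Qd u m k = sc (1 - ?c / ?w) * (Y * ?t)"
      unfolding IH2 by (simp add: left_diff_distrib sc_diff tp_sc(3))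
    have sc: "1 / (?c - ?w) * (1 - ?c / ?w) = - (1 / ?w)"
      using cw assms(3) by (simp add: divide_simps)
    have "Y * Qd u m (Suc k) = Y * Qd u m k + sc (1 / (?c - ?w)) * (Y * ?t * Qd u m k)"
      using True by (simp add: distrib_left distrib_right mult.assoc sc_left_commute)
    also have "\<dots> = Y - sc (1 / ?w) * (Y * ?S k) - sc (1 / ?w) * (Y * ?t)"
      unfolding IH IH3 tp_sc(3) sc by (simp add: sc_uminus)
    finally show ?thesis using True unfolding SS by (simp add: distrib_left)
  next
    case False
    then show ?thesis using IH SS by simp
  qed
qed simp

text \<open>\<open>X (Suc m)\<close> commutes with \<open>Y\<close> and so may act from the left.
  When the last parameter tends to its content, the right side will vanish, and the limit of
  \<open>Y * Tl\<close> becomes an eigenvector of \<open>X (Suc m)\<close>.\<close>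

lemma X_Tl:
  assumes Y: "Y \<in> alg m" and e: "\<And>j. 1 \<le> j \<Longrightarrow> j \<le> m \<Longrightarrow> Y * X j = sc (u j) * Y"
    and w: "u (Suc m) \<noteq> 0" "\<And>j. 1 \<le> j \<Longrightarrow> j \<le> m \<Longrightarrow> J j (Suc m) \<Longrightarrow> u j \<noteq> u (Suc m)"
  shows "sc (u (Suc m)) * (Y * Tl u (Suc m) m) - X (Suc m) * (Y * Tl u (Suc m) m)
    = sc (u (Suc m) * beta u (Suc m) m) * Y"
proof -
  let ?w = "u (Suc m)" and ?T = "Tl u (Suc m) m"
  have "X (Suc m) = (\<Sum>j\<in>{j\<in>{1..m}. J j (Suc m)}. tp j (Suc m))"
    unfolding X_def by (rule sum.cong) (auto simp: less_Suc_eq_le)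
  then have "Y * Qd u (Suc m) m = Y - sc (1 / ?w) * (Y * X (Suc m))"
    using Qd_eigen[of m Y u "Suc m"] e w by auto
  then have "Y * Qd u (Suc m) m * ?T = Y * ?T - sc (1 / ?w) * (X (Suc m) * (Y * ?T))"
    using X_commute[OF Y, of "Suc m"] by (simp add: left_diff_distrib mult.assoc) (simp flip: mult.assoc)
  moreover have "Y * Qd u (Suc m) m * ?T = sc (beta u (Suc m) m) * Y"
    by (simp add: mult.assoc Qd_Tl sc_commute)
  ultimately have "sc ?w * (sc (beta u (Suc m) m) * Y) = sc ?w * (Y * ?T - sc (1 / ?w) * (X (Suc m) * (Y * ?T)))"
    by simp
  then show ?thesis using w(1) by (simp add: right_diff_distrib tp_sc(3))
qed

section \<open>Regular factors\<close>

definition sing :: "(nat \<Rightarrow> int) \<Rightarrow> nat \<Rightarrow> nat \<Rightarrow> bool" where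
  "sing c m j \<longleftrightarrow> 1 \<le> j \<and> j < m \<and> J j m \<and> c j = c m"

text \<open>\<open>R u j m * R u (Suc j) m\<close> has a pole at \<open>u j = u m\<close>, but after a factor \<open>Y\<close> with
  \<open>Y * tp j (Suc j) = sc e * Y\<close> and \<open>u (Suc j) = u j + e\<close> it may be replaced by \<open>kf c u m j\<close>,
  which has none. The factor for \<open>Suc j\<close> is then \<open>1\<close>.\<close>

definition kf :: "(nat \<Rightarrow> int) \<Rightarrow> (nat \<Rightarrow> complex) \<Rightarrow> nat \<Rightarrow> nat \<Rightarrow> galg" where
  "kf c u m j =
    (if sing c m j then 1 - sc (1 / (u (Suc j) - u m)) * (tp j m + tp (Suc j) m)
     else if sing c m (j - 1) then 1 else R u j m)"

primrec Kl :: "(nat \<Rightarrow> int) \<Rightarrow> (nat \<Rightarrow> complex) \<Rightarrow> nat \<Rightarrow> nat \<Rightarrow> galg" where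
  "Kl c u m 0 = 1"
| "Kl c u m (Suc j) = Kl c u m j * kf c u m (Suc j)"

text \<open>The quadratic term is \<open>q * t = tp i (Suc i) * q\<close>, which \<open>Y\<close>
  turns into a multiple of \<open>Y * q\<close>. The total coefficient \<open>a - a * b * e\<close>
  of \<open>Y * q\<close> equals \<open>b\<close>, so the pole of \<open>a\<close> at
  \<open>u i = u m\<close> cancels.\<close>

lemma R_R_fuse:
  assumes Y: "Y * tp i (Suc i) = sc e * Y" and u: "u (Suc i) = u i + e" "u i \<noteq> u m" "u (Suc i) \<noteq> u m"
    and J: "J i m" "J (Suc i) m" and "m \<noteq> i" "m \<noteq> Suc i"
  shows "Y * R u i m * R u (Suc i) m = Y * (1 - sc (1 / (u (Suc i) - u m)) * (tp i m + tp (Suc i) m))"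
proof -
  define a b q t where "a = 1 / (u i - u m)" and "b = 1 / (u (Suc i) - u m)"
    and "q = tp i m" and "t = tp (Suc i) m"
  have "q * t = tp i (Suc i) * q" using tp_three(6)[of i "Suc i" m] assms by (simp add: q_def t_def)
  then have Yq: "Y * (q * t) = sc e * (Y * q)" by (metis Y mult.assoc)
  have ab: "a - a * b * e = b"
  proof -
    have "u (Suc i) - u m - e \<noteq> 0" "u (Suc i) - u m \<noteq> 0" using u by auto
    moreover have "a = 1 / (u (Suc i) - u m - e)" using u by (simp add: a_def)
    ultimately show ?thesis unfolding b_def by (simp add: divide_simps) (simp add: algebra_simps)
  qed
  have "Y * R u i m * R u (Suc i) m = Y * (1 - sc a * q) * (1 - sc b * t)"
    using J by (simp add: R_def a_def b_def q_def t_def)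
  also have "\<dots> = Y - sc a * (Y * q) - sc b * (Y * t) + sc (a * b) * (Y * (q * t))"
    by (simp add: right_diff_distrib left_diff_distrib mult.assoc sc_left_commute[of Y] sc_left_commute[of q] sc_mult)
  also have "\<dots> = Y - sc (a - a * b * e) * (Y * q) - sc b * (Y * t)"
    unfolding Yq by (simp add: sc_diff sc_mult left_diff_distrib mult.assoc)
  also have "\<dots> = Y * (1 - sc b * (q + t))"
    unfolding ab by (simp add: right_diff_distrib distrib_left sc_left_commute[of Y])
  finally show ?thesis by (simp add: b_def q_def t_def)
qed

text \<open>Fusion advances by two indices, hence the strong induction; stopping at a singular
  \<open>j\<close> would cut a pair in two. Since \<open>c (Suc i) \<noteq> c m\<close>, singular
  indices are never adjacent.\<close>

lemma Tl_eq_Kl: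
  assumes s: "\<And>i. sing c m i \<Longrightarrow> Suc i < m \<and> J i (Suc i) \<and> c (Suc i) \<noteq> c m \<and> u (Suc i) = u i + e \<and>
      y * tp i (Suc i) = sc e * y"
    and g: "\<And>i. 1 \<le> i \<Longrightarrow> i < m \<Longrightarrow> J i m \<Longrightarrow> u i \<noteq> u m"
  shows "j < m \<Longrightarrow> \<not> sing c m j \<Longrightarrow> y * Tl u m j = y * Kl c u m j"
proof (induction j rule: less_induct)
  case (less j)
  show ?case
  proof (cases j)
    case (Suc i)
    show ?thesis
    proof (cases "sing c m i")
      case True
      then obtain l where l: "i = Suc l" by (cases i) (auto simp: sing_def)
      have "\<not> sing c m l" using s[of l] True l by (auto simp: sing_def)
      then have IH: "y * Tl u m l = y * Kl c u m l" using less l Suc by auto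
      have com: "Tl u m l * tp i (Suc i) = tp i (Suc i) * Tl u m l"
        by (rule Tl_commute, rule R_tp_commute) (use l Suc less.prems in auto)
      have Ji: "J i m" "J (Suc i) m" using s[OF True] True by (auto simp: sing_def J_def)
      have "(y * Tl u m l) * R u i m * R u (Suc i) m =
        (y * Tl u m l) * (1 - sc (1 / (u (Suc i) - u m)) * (tp i m + tp (Suc i) m))"
      proof (rule R_R_fuse[where e = e])
        show "y * Tl u m l * tp i (Suc i) = sc e * (y * Tl u m l)"
          using s[OF True] com by (simp add: mult.assoc) (simp flip: mult.assoc)
      qed (use s[OF True] g[of i] g[of "Suc i"] Ji True in \<open>auto simp: sing_def\<close>)
      moreover have "Kl c u m j = Kl c u m l * (1 - sc (1 / (u (Suc i) - u m)) * (tp i m + tp (Suc i) m))"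
        using True less.prems(2) unfolding Suc l by (simp add: kf_def)
      moreover have "y * Tl u m j = y * Tl u m l * R u i m * R u (Suc i) m"
        unfolding Suc l by (simp add: mult.assoc)
      ultimately show ?thesis using IH by (simp add: mult.assoc)
    next
      case False
      then have "y * Tl u m i = y * Kl c u m i" using less Suc by auto
      then have "y * Tl u m i * R u (Suc i) m = y * Kl c u m i * R u (Suc i) m" by simp
      moreover have "Kl c u m j = Kl c u m i * R u (Suc i) m"
        using False less.prems Suc by (simp add: kf_def)
      ultimately show ?thesis unfolding Suc by (simp add: mult.assoc)
    qed
  qed simp
qed

lemma alg_Kl:
  assumes "\<And>i. sing c m i \<Longrightarrow> Suc i < m \<and> J i (Suc i)" "1 \<le> m" "m \<le> n" "j < m"
  shows "Kl c u m j \<in> alg n"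
  using assms(4)
proof (induction j)
  case (Suc j)
  have "J (Suc (Suc j)) m" if "sing c m (Suc j)"
    using assms(1)[OF that] that by (auto simp: sing_def J_def)
  then have "kf c u m (Suc j) \<in> alg n"
    using Suc.prems assms by (auto simp: kf_def sing_def intro!: alg_diff alg_mult alg_add alg_tp alg_R)
  with Suc show ?case by (auto intro: alg_mult)
qed simp

end

section \<open>Jucys-Murphy eigenvalues determine matrix elements\<close>

definition lin_ext :: "(nat perm \<Rightarrow> complex) \<Rightarrow> galg \<Rightarrow> complex" where
  "lin_ext f a = (\<Sum>g\<in>keys a. lookup a g * f g)"

lemma lin_ext_on: "finite S \<Longrightarrow> keys a \<subseteq> S \<Longrightarrow> lin_ext f a = (\<Sum>g\<in>S. lookup a g * f g)"
  unfolding lin_ext_def by (rule sum.mono_neutral_left) (auto simp: in_keys_iff)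

lemma lin_ext_add: "lin_ext f (a + b) = lin_ext f a + lin_ext f b"
proof -
  let ?S = "keys a \<union> keys b"
  have "lin_ext f (a + b) = (\<Sum>g\<in>?S. lookup (a + b) g * f g)"
    by (rule lin_ext_on) (use keys_add[of a b] in auto)
  also have "\<dots> = (\<Sum>g\<in>?S. lookup a g * f g) + (\<Sum>g\<in>?S. lookup b g * f g)"
    by (simp add: lookup_add distrib_right sum.distrib)
  finally show ?thesis using lin_ext_on[of ?S a f] lin_ext_on[of ?S b f] by simp
qed

lemma lin_ext_single [simp]: "lin_ext f (single g c) = c * f g"
  using lin_ext_on[of "{g}" "single g c" f] by simp

lemma lin_ext_sc [simp]: "lin_ext f (sc c * a) = c * lin_ext f a"
proof (induction a rule: galg_induct)
  case (single g d)
  then show ?case by (simp add: sc_def mult_single)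
qed (simp add: distrib_left lin_ext_add)

lemma lin_ext_0 [simp]: "lin_ext f 0 = 0"
  by (simp add: lin_ext_def)

lemma lin_ext_diff: "lin_ext f (a - b) = lin_ext f a - lin_ext f b"
  using lin_ext_add[of f "a - b" b] by simp

lemma lin_ext_sum: "lin_ext f (\<Sum>i\<in>I. h i) = (\<Sum>i\<in>I. lin_ext f (h i))"
  by (induction I rule: infinite_finite_induct) (simp_all add: lin_ext_add)

definition shifts :: "complex list \<Rightarrow> galg \<Rightarrow> galg" where
  "shifts D x = prod_list (map (\<lambda>t. x - sc t) D)"

lemma shifts_simps [simp]: "shifts [] x = 1" "shifts (t # D) x = (x - sc t) * shifts D x"
  by (simp_all add: shifts_def)

context blocks
begin

text \<open>\<open>Suc m\<close> opens a block here and has no earlier partner to move to.\<close>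

lemma grp_Suc_eq: "m = 0 \<or> \<not> J m (Suc m) \<Longrightarrow> grp (Suc m) = grp m"
proof (intro equalityI subsetI)
  fix g assume m: "m = 0 \<or> \<not> J m (Suc m)" and g: "g \<in> grp (Suc m)"
  have 1: "apply g k = k" if "k < 1 \<or> k > Suc m" for k using g that by (auto simp: grp_def)
  have "apply g (Suc m) = Suc m"
  proof (rule ccontr)
    assume n: "apply g (Suc m) \<noteq> Suc m"
    let ?j = "apply g (Suc m)"
    have "apply g ?j \<noteq> ?j" using n by (simp add: apply_inj)
    then have "1 \<le> ?j" "?j \<le> m" using 1[of ?j] n by linarith+
    moreover have "J (Suc m) ?j" using g by (auto simp: grp_def)
    ultimately show False using m by (auto simp: J_def)
  qed
  with g show "g \<in> grp m" unfolding grp_def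
    by (auto simp: le_Suc_eq)
qed (use grp_mono[of m "Suc m"] in auto)

lemma grp_0: "grp 0 = {0}"
proof -
  have "g = 0" if "g \<in> grp 0" for g
    using that by (intro perm_eq_applyI) (auto simp: grp_def)
  then show ?thesis by auto
qed

text \<open>The two double cosets of \<open>grp m\<close> in \<open>grp (Suc m)\<close>. If
  \<open>Suc m\<close> goes to \<open>j\<close>, then \<open>h\<close> is the transposition of
  \<open>j\<close> and \<open>m\<close>, and what remains of \<open>g\<close> fixes
  \<open>Suc m\<close>.\<close>

lemma grp_Suc_cases:
  assumes g: "g \<in> grp (Suc m)" and m: "1 \<le> m" "J m (Suc m)"
  obtains "g \<in> grp m"
  | h k where "h \<in> grp m" "k \<in> grp m" "g = h + Perm.swap m (Suc m) + k"
proof (cases "apply g (Suc m) = Suc m")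
  case True
  then have "g \<in> grp m" using g unfolding grp_def by (auto simp: le_Suc_eq)
  then show ?thesis by (rule that(1))
next
  case False
  let ?j = "apply g (Suc m)" and ?s = "Perm.swap m (Suc m)"
  have fx: "apply g k = k" if "k < 1 \<or> k > Suc m" for k using g that by (auto simp: grp_def)
  have "apply g ?j \<noteq> ?j" using False by (simp add: apply_inj)
  then have "\<not> (?j < 1 \<or> ?j > Suc m)" using fx by blast
  then have j: "1 \<le> ?j" "?j \<le> m" using False by linarith+
  have Jj: "J (Suc m) ?j" using g by (auto simp: grp_def)
  let ?h = "Perm.swap ?j m"
  have h: "?h \<in> grp m" by (rule grp_swap) (use j m Jj in \<open>auto simp: J_def\<close>)
  let ?k = "?s + ?h + g"
  have ss: "?s + ?s = 0" "?h + ?h = 0"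
    by (rule perm_eq_applyI; simp add: apply_plus swap_apply)+
  have "?s \<in> grp (Suc m)" by (rule grp_swap) (use m in auto)
  moreover have "?h \<in> grp (Suc m)" using h grp_mono[of m "Suc m"] by auto
  ultimately have "?k \<in> grp (Suc m)" using g by (intro grp_plus)
  moreover have "apply ?k (Suc m) = Suc m"
    by (simp add: apply_plus swap_apply)
  ultimately have "?k \<in> grp m" unfolding grp_def by (auto simp: le_Suc_eq)
  moreover have "?h + ?s + ?k = ?h + (?s + ?s) + ?h + g" by (simp only: add.assoc)
  then have "g = ?h + ?s + ?k" unfolding ss by (simp add: ss)
  ultimately show ?thesis using h that(2) by blast
qed

lemma finite_grp [simp]: "finite (grp m)"
proof (induction m)
  case (Suc m)
  show ?case
  proof (cases "m = 0 \<or> \<not> J m (Suc m)")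
    case False
    have "grp (Suc m) \<subseteq> grp m \<union> (\<lambda>(h, k). h + Perm.swap m (Suc m) + k) ` (grp m \<times> grp m)"
    proof
      fix g assume "g \<in> grp (Suc m)"
      then show "g \<in> grp m \<union> (\<lambda>(h, k). h + Perm.swap m (Suc m) + k) ` (grp m \<times> grp m)"
        by (rule grp_Suc_cases) (use False in auto)
    qed
    then show ?thesis by (rule finite_subset) (use Suc in auto)
  qed (use Suc grp_Suc_eq in auto)
qed (simp add: grp_0)

text \<open>The sum runs over a fixed finite set instead of the support of \<open>a\<close>, so that
  coefficientwise limits pass through products.\<close>

lemma lookup_mult_alg:
  assumes "a \<in> alg n"
  shows "lookup (a * b) g = (\<Sum>h\<in>grp n. lookup a h * lookup b (- h + g))"
proof -
  have "lookup ((\<Sum>h\<in>grp n. single h (lookup a h)) * b) g = (\<Sum>h\<in>grp n. lookup a h * lookup b (- h + g))"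
    by (simp add: sum_distrib_right lookup_sum lookup_single_times)
  then show ?thesis using galg_expand_on[of "grp n" a] assms by (simp add: alg_def)
qed

lemma alg_shifts: "x \<in> alg m \<Longrightarrow> shifts D x \<in> alg m"
  by (induction D) (auto intro!: alg_mult alg_diff)

end

text \<open>An abstraction of \<open>f g = \<langle>v, g v\<rangle>\<close> for a unit joint
  eigenvector \<open>v\<close> of the \<open>X k\<close>. On the vectors \<open>z v\<close> with
  \<open>z\<close> in \<open>alg m\<close>, \<open>X (Suc m)\<close> acts by
  \<open>c (Suc m)\<close>; \<open>gap\<close> says that there \<open>X m\<close> is annihilated by
  a polynomial, with root list \<open>D\<close>, that does not vanish at this value.\<close>

locale state = blocks r for r +
  fixes n :: nat and c :: "nat \<Rightarrow> int" and f :: "nat perm \<Rightarrow> complex"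
  assumes X_right: "\<And>y k. y \<in> alg n \<Longrightarrow> 1 \<le> k \<Longrightarrow> k \<le> n \<Longrightarrow> lin_ext f (y * X k) = of_int (c k) * lin_ext f y"
    and f_uminus: "\<And>g. g \<in> grp n \<Longrightarrow> f (- g) = cnj (f g)"
    and f_0: "f 0 = 1"
    and gap: "\<And>m. 1 \<le> m \<Longrightarrow> m < n \<Longrightarrow> J m (Suc m) \<Longrightarrow> \<exists>D. of_int (c (Suc m)) \<notin> set D \<and>
      (\<forall>y\<in>alg n. \<forall>z\<in>alg m. lin_ext f (y * shifts D (X m) * z) = 0)"
begin

lemma lin_ext_star: "y \<in> alg n \<Longrightarrow> lin_ext f (star y) = cnj (lin_ext f y)"
proof -
  assume y: "y \<in> alg n"
  have "lin_ext f (star (\<Sum>g\<in>keys y. single g (lookup y g))) = cnj (lin_ext f (\<Sum>g\<in>keys y. single g (lookup y g)))"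
    unfolding star_sum lin_ext_sum star_single cnj_sum
    by (rule sum.cong[OF refl]) (use y f_uminus in \<open>auto simp: alg_def\<close>)
  then show ?thesis using galg_expand[of y] by simp
qed

lemma X_left:
  assumes "y \<in> alg n" "1 \<le> k" "k \<le> n"
  shows "lin_ext f (X k * y) = of_int (c k) * lin_ext f y"
proof -
  have "lin_ext f (X k * y) = cnj (lin_ext f (star (X k * y)))"
    using lin_ext_star[of "X k * y"] alg_mult[OF alg_X[of k n] assms(1)] assms by simp
  also have "\<dots> = cnj (of_int (c k) * lin_ext f (star y))"
    using X_right[OF alg_star[OF assms(1)] assms(2,3)] by (simp add: star_mult)
  finally show ?thesis using lin_ext_star[OF assms(1)] by simp
qed

definition eig :: "nat \<Rightarrow> galg \<Rightarrow> bool" where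
  "eig m w \<longleftrightarrow> (\<forall>k. 1 \<le> k \<and> k \<le> m \<longrightarrow> X k * w = sc (of_int (c k)) * w)"

lemma eig_mono: "eig m w \<Longrightarrow> k \<le> m \<Longrightarrow> eig k w"
  by (auto simp: eig_def)

lemma star_eig: "eig m w \<Longrightarrow> 1 \<le> k \<Longrightarrow> k \<le> m \<Longrightarrow> star w * X k = sc (of_int (c k)) * star w"
proof -
  assume "eig m w" "1 \<le> k" "k \<le> m"
  then have "star (X k * w) = star (sc (of_int (c k)) * w)" by (simp add: eig_def)
  then show ?thesis by (simp add: star_mult sc_commute)
qed

text \<open>The functional \<open>y \<mapsto> \<langle>w', y w\<rangle>\<close> is determined up to a scalar by the eigenvalues: the defect
  \<open>B\<close> in the induction step is an eigenvector of \<open>X m\<close> in its second argument, with the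
  eigenvalue \<open>c (Suc m)\<close>, which the assumption \<open>gap\<close> excludes.\<close>

lemma state_unique:
  assumes "m \<le> n" "eig m w" "eig m w'" "y \<in> alg m"
  shows "tau (star w' * y * w) = tau (star w' * w) * lin_ext f y"
  using assms
proof (induction m arbitrary: w w' y)
  case 0
  then have "keys y \<subseteq> {0}" by (auto simp: alg_def grp_0)
  then have "y = single 0 (lookup y 0)" using galg_expand_on[of "{0}" y] by simp
  then obtain a where a: "y = sc a" by (auto simp: sc_def)
  show ?case using f_0 by (simp add: a sc_commute mult.assoc) (simp add: sc_def)
next
  case (Suc m)
  have IH: "tau (star w' * y * w) = tau (star w' * w) * lin_ext f y"
    if "eig (Suc m) w" "eig (Suc m) w'" "y \<in> alg m" for w w' y
    by (rule Suc.IH) (use Suc.prems(1) that eig_mono in auto)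
  show ?case
  proof (cases "m = 0 \<or> \<not> J m (Suc m)")
    case True
    then have "alg (Suc m) = alg m" using grp_Suc_eq by (simp add: alg_def)
    then show ?thesis using IH Suc.prems by simp
  next
    case False
    then have m: "1 \<le> m" "J m (Suc m)" "m < n" using Suc.prems by auto
    let ?s = "tp m (Suc m)" and ?c = "of_int (c (Suc m)) :: complex" and ?N = "tau (star w' * w)"
    have mn: "a \<in> alg m \<Longrightarrow> a \<in> alg n" for a using alg_mono m by (meson less_imp_le)
    have s: "?s \<in> alg n" by (rule alg_tp) (use m in auto)
    define B where "B y z = tau (star w' * y * ?s * z * w) - ?N * lin_ext f (y * ?s * z)" for y z
    \<comment> \<open>Across \<open>?s\<close>, \<open>X m\<close> becomes \<open>X (Suc m)\<close>,
      which acts on \<open>star w'\<close> by \<open>?c\<close>. The correction leaves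
      \<open>y * z\<close>, an element of \<open>alg m\<close>, which drops out of \<open>B\<close>
      by induction.\<close>
    have BX: "B y (X m * z) = ?c * B y z" if yz: "y \<in> alg m" "z \<in> alg m" for y z
    proof -
      have sX: "y * ?s * X m = X (Suc m) * (y * ?s) - y"
        using tp_X(1)[OF m(1,2)] X_commute[OF yz(1), of "Suc m"]
        by (simp add: mult.assoc distrib_left eq_diff_eq flip: mult.assoc[of "X (Suc m)"])
      have "star w' * y * ?s * (X m * z) * w = star w' * (y * ?s * X m) * z * w"
        by (simp add: mult.assoc)
      also have "\<dots> = (star w' * X (Suc m)) * (y * ?s * z * w) - star w' * (y * z) * w"
        unfolding sX by (simp add: left_diff_distrib right_diff_distrib mult.assoc)
      finally have 1: "tau (star w' * y * ?s * (X m * z) * w) = ?c * tau (star w' * y * ?s * z * w) - tau (star w' * (y * z) * w)"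
        using star_eig[OF Suc.prems(3), of "Suc m"] by (simp add: tau_diff mult.assoc)
      have "y * ?s * (X m * z) = X (Suc m) * (y * ?s * z) - y * z"
        using arg_cong[OF sX, of "\<lambda>a. a * z"] by (simp add: mult.assoc left_diff_distrib)
      then have 2: "lin_ext f (y * ?s * (X m * z)) = ?c * lin_ext f (y * ?s * z) - lin_ext f (y * z)"
        using X_left[of "y * ?s * z" "Suc m"] mn yz s m by (simp add: lin_ext_diff alg_mult)
      show ?thesis
        unfolding B_def 1 2 using IH[OF Suc.prems(2,3), of "y * z"] alg_mult yz
        by (simp add: algebra_simps)
    qed
    have Xm: "X m \<in> alg m" by (rule alg_X) simp
    obtain D where D: "?c \<notin> set D" and D0: "\<And>y z. y \<in> alg n \<Longrightarrow> z \<in> alg m \<Longrightarrow> lin_ext f (y * shifts D (X m) * z) = 0"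
      using gap[OF m(1,3,2)] by blast
    have BD: "B y (shifts D' (X m) * z) = (\<Prod>t\<leftarrow>D'. ?c - t) * B y z" if yz: "y \<in> alg m" "z \<in> alg m" for y z D'
    proof (induction D')
      case (Cons t D')
      let ?z = "shifts D' (X m) * z"
      have z: "?z \<in> alg m" using alg_shifts[OF Xm] yz by (intro alg_mult)
      have "shifts (t # D') (X m) * z = X m * ?z - sc t * ?z"
        by (simp add: left_diff_distrib mult.assoc)
      then have "B y (shifts (t # D') (X m) * z) = B y (X m * ?z) - t * B y ?z"
        unfolding B_def by (simp add: right_diff_distrib left_diff_distrib mult.assoc sc_left_commute tau_diff lin_ext_diff algebra_simps)
      then show ?case using BX[OF yz(1) z] Cons by (simp add: left_diff_distrib)
    qed simp
    have B0: "B y z = 0" if yz: "y \<in> alg m" "z \<in> alg m" for y z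
    proof -
      let ?p = "shifts D (X m)"
      have pz: "?p * z \<in> alg m" using alg_shifts[OF Xm] yz by (intro alg_mult)
      \<comment> \<open>By induction the norm of \<open>?v\<close> is a value of
        \<open>lin_ext f\<close> at a product containing \<open>?p\<close>, and this is 0 by
        \<open>gap\<close>.\<close>
      let ?v = "?p * z * w"
      have "tau (star ?v * ?v) = tau (star w * (star (?p * z) * (?p * z)) * w)"
        by (simp add: star_mult mult.assoc)
      also have "\<dots> = tau (star w * w) * lin_ext f (star (?p * z) * (?p * z))"
        by (rule IH) (use Suc.prems alg_mult alg_star pz in auto)
      also have "lin_ext f (star (?p * z) * (?p * z)) = 0"
        using D0[OF mn[OF alg_star[OF pz]] yz(2)] by (simp add: mult.assoc)
      finally have v: "?v = 0" by (simp only: tau_star_self_eq_0 mult_zero_right)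
      have "y * ?s \<in> alg n" using mn yz s by (intro alg_mult) auto
      then have "lin_ext f (y * ?s * (?p * z)) = 0"
        using D0[OF _ yz(2), of "y * ?s"] by (simp add: mult.assoc)
      moreover have "star w' * y * ?s * (?p * z) * w = star w' * y * ?s * ?v"
        by (simp add: mult.assoc)
      \<comment> \<open>By \<open>BD\<close> the same quantity is \<open>B y z\<close> times the
        value of the polynomial at \<open>?c\<close>, which is nonzero.\<close>
      ultimately have "B y (?p * z) = 0" unfolding B_def v by simp
      moreover have "(\<Prod>t\<leftarrow>D. ?c - t) \<noteq> 0" using D by (auto simp: prod_list_zero_iff)
      ultimately show ?thesis using BD[OF yz, of D] by simp
    qed
    have sg: "tau (star w' * single g 1 * w) = ?N * lin_ext f (single g 1)" if g: "g \<in> grp (Suc m)" for g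
      using grp_Suc_cases[OF g m(1,2)]
    proof cases
      case 1
      then show ?thesis using IH Suc.prems alg_single by blast
    next
      case (2 h k)
      then have "single g 1 = single h 1 * ?s * single k 1" by (simp add: tp_def mult_single)
      then show ?thesis using B0[of "single h 1" "single k 1"] 2 alg_single
        unfolding B_def by (simp add: mult.assoc)
    qed
    have "tau (star w' * (\<Sum>g\<in>keys y. single g (lookup y g)) * w) = ?N * lin_ext f (\<Sum>g\<in>keys y. single g (lookup y g))"
      unfolding sum_distrib_left sum_distrib_right tau_sum lin_ext_sum
    proof (rule sum.cong[OF refl])
      fix g assume "g \<in> keys y"
      then have "g \<in> grp (Suc m)" using Suc.prems by (auto simp: alg_def)
      from sg[OF this] show "tau (star w' * single g (lookup y g) * w) = ?N * lin_ext f (single g (lookup y g))"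
        by (subst (1 2) single_conv_sc) (simp add: sc_left_commute mult.assoc)
    qed
    then show ?thesis using galg_expand[of y] by simp
  qed
qed

definition F :: galg where "F = (\<Sum>g\<in>grp n. single g (f g))"

lemma lookup_F: "lookup F g = (if g \<in> grp n then f g else 0)"
  by (simp add: F_def lookup_sum lookup_single when_def sum.delta)

lemma alg_F: "F \<in> alg n"
  by (auto simp: alg_def in_keys_iff lookup_F split: if_splits)

lemma uminus_swap: "- Perm.swap i j = Perm.swap i j"
  by (rule perm_eq_applyI) (simp add: apply_uminus swap_apply)

lemma star_F: "star F = F"
  using f_uminus grp_uminus[of _ n]
  by (intro poly_mapping_eqI) (auto simp: lookup_F dest: grp_uminus[of "- _" n, simplified])

lemma F_eig:
  assumes k: "1 \<le> k" "k \<le> n"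
  shows "X k * F = sc (of_int (c k)) * F" "F * X k = sc (of_int (c k)) * F"
proof -
  let ?S = "{j \<in> {1..<k}. J j k}"
  show 1: "F * X k = sc (of_int (c k)) * F"
  proof (rule poly_mapping_eqI)
    fix h
    show "lookup (F * X k) h = lookup (sc (of_int (c k)) * F) h"
    proof (cases "h \<in> grp n")
      case True
      have sw: "Perm.swap j k \<in> grp n" if "j \<in> ?S" for j
        by (rule grp_swap) (use that k in auto)
      have hs: "h - Perm.swap j k = h + Perm.swap j k" for j
        using uminus_swap[of j k] by (metis add_uminus_conv_diff)
      have "lookup (F * X k) h = (\<Sum>j\<in>?S. f (h + Perm.swap j k))"
        unfolding X_def sum_distrib_left lookup_sum
        by (rule sum.cong) (use sw True grp_plus in \<open>auto simp: tp_def lookup_times_single hs lookup_F\<close>)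
      also have "\<dots> = lin_ext f (single h 1 * X k)"
        by (simp add: X_def sum_distrib_left lin_ext_sum tp_def mult_single)
      also have "\<dots> = of_int (c k) * f h"
        using X_right[of "single h 1" k] alg_single[OF True] k by simp
      finally show ?thesis using True by (simp add: lookup_F)
    next
      case False
      have "F * X k \<in> alg n" using alg_mult[OF alg_F alg_X] k by simp
      then show ?thesis using False by (auto simp: alg_def in_keys_iff lookup_F)
    qed
  qed
  from arg_cong[OF 1, of star] show "X k * F = sc (of_int (c k)) * F"
    by (simp add: star_mult star_F sc_commute)
qed

lemma tr_eig:
  assumes "\<And>k. 1 \<le> k \<Longrightarrow> k \<le> n \<Longrightarrow> a * X k = sc (of_int (c k)) * a"
  shows "eig n (tr a)"
  unfolding eig_def
proof safe
  fix k assume "1 \<le> k" "k \<le> n"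
  from arg_cong[OF assms[OF this], of tr] show "X k * tr a = sc (of_int (c k)) * tr a"
    by (simp add: tr_mult sc_commute)
qed

text \<open>The product \<open>tr F * E\<close> is computed twice. It is
  \<open>sc \<kappa> * E\<close>, because \<open>tr F\<close> is a nonzero multiple of an idempotent
  that fixes \<open>E\<close>; and it is a multiple of \<open>F\<close>, because matrix elements of
  joint eigenvectors are multiples of \<open>f\<close>. The coefficient of the identity identifies
  the two scalars.\<close>

theorem eigen_unique:
  assumes E: "E \<in> alg n" "lookup E 0 = 1"
    and e: "\<And>k. 1 \<le> k \<Longrightarrow> k \<le> n \<Longrightarrow> X k * E = sc (of_int (c k)) * E"
      "\<And>k. 1 \<le> k \<Longrightarrow> k \<le> n \<Longrightarrow> E * X k = sc (of_int (c k)) * E"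
  shows "E = F"
proof -
  \<comment> \<open>The idempotent attached to a matrix element has the coefficients
    \<open>f (- g)\<close>, so it comes from \<open>tr F\<close> and not directly from
    \<open>F\<close>.\<close>
  let ?F = "tr F"
  have eF: "eig n ?F" and eF': "eig n F" and eE: "eig n E" and etE: "eig n (tr E)"
    using tr_eig F_eig e by (simp_all add: eig_def)
  have sF: "star ?F = ?F"
  proof (rule poly_mapping_eqI)
    fix g show "lookup (star ?F) g = lookup ?F g"
      using arg_cong[OF star_F, of "\<lambda>a. lookup a (- g)"] by simp
  qed
  define \<kappa> where "\<kappa> = tau (?F * ?F)"
  have "?F \<noteq> 0" using f_0 lookup_F[of 0] by (metis grp_zero lookup_zero minus_zero one_neq_zero tr_simps(1))
  then have k0: "\<kappa> \<noteq> 0" using tau_star_self_eq_0[of ?F] by (simp add: sF \<kappa>_def)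
  have kr: "cnj \<kappa> = \<kappa>"
    unfolding \<kappa>_def by (metis sF star_mult tau_star)
  have FF: "?F * ?F = sc \<kappa> * ?F"
  proof (rule poly_mapping_eqI)
    fix g
    show "lookup (?F * ?F) g = lookup (sc \<kappa> * ?F) g"
    proof (cases "g \<in> grp n")
      case True
      have "lookup (?F * ?F) g = tau (?F * (single (- g) 1 * ?F))"
        unfolding lookup_conv_tau[of "?F * ?F"] by (metis mult.assoc tau_commute)
      also have "\<dots> = tau (star ?F * single (- g) 1 * ?F)"
        unfolding sF by (simp add: mult.assoc)
      also have "\<dots> = \<kappa> * f (- g)"
        using state_unique[OF order_refl eF eF alg_single[OF grp_uminus[OF True]], of 1]
        by (simp add: sF \<kappa>_def)
      finally show ?thesis using grp_uminus[OF True] by (simp add: lookup_F)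
    next
      case False
      then have "- g \<notin> grp n" using grp_uminus[of "- g" n] by auto
      moreover have "?F * ?F \<in> alg n" using alg_mult alg_tr alg_F by blast
      ultimately show ?thesis using False by (auto simp: alg_def in_keys_iff lookup_F)
    qed
  qed
  have aF: "?F \<in> alg n" using alg_tr alg_F by blast
  have oF: "lin_ext f ?F = \<kappa>"
  proof -
    have "tau (star ?F * ?F * ?F) = \<kappa> * lin_ext f ?F"
      using state_unique[OF order_refl eF eF aF] by (simp add: sF \<kappa>_def)
    moreover have "star ?F * ?F * ?F = sc \<kappa> * (?F * ?F)"
      unfolding sF by (subst FF) (rule mult.assoc)
    then have "tau (star ?F * ?F * ?F) = \<kappa> * \<kappa>"
      by (simp only: tau_sc flip: \<kappa>_def)
    ultimately show ?thesis using k0 by simp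
  qed
  have FE: "?F * E = sc \<kappa> * E"
  proof -
    \<comment> \<open>Expanding the norm of \<open>?v\<close> gives the multiples 1, -2 and 1 of
      \<open>\<kappa>\<^sup>2 * tau (star E * E)\<close>, which cancel.\<close>
    let ?v = "sc \<kappa> * E - ?F * E"
    have 1: "tau (star E * (?F * E)) = tau (star E * E) * \<kappa>"
      using state_unique[OF order_refl eE eE aF] oF by (simp add: mult.assoc)
    have "star ?v * ?v = sc \<kappa> * (sc \<kappa> * (star E * E)) - sc \<kappa> * (star E * (?F * E)) - sc \<kappa> * (star E * (?F * E))
      + star E * (?F * ?F * E)"
      by (simp add: star_diff star_mult sF kr left_diff_distrib right_diff_distrib mult.assoc sc_commute[of "star E"]
        sc_left_commute[of "star E"] sc_left_commute[of "?F"])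
    moreover have "star E * (?F * ?F * E) = sc \<kappa> * (star E * (?F * E))"
      unfolding FF by (simp only: mult.assoc sc_left_commute[of "star E"])
    ultimately have "tau (star ?v * ?v) = 0"
      by (simp only: tau_diff tau_add 1 tau_sc) simp
    then have "?v = 0" by (simp only: tau_star_self_eq_0)
    then show ?thesis by simp
  qed
  define c0 where "c0 = tau (F * tr E)"
  have FE2: "?F * E = sc c0 * F"
  proof (rule poly_mapping_eqI)
    fix g
    show "lookup (?F * E) g = lookup (sc c0 * F) g"
    proof (cases "g \<in> grp n")
      case True
      \<comment> \<open>Applying \<open>tr\<close> under the trace turns the coefficient at
        \<open>g\<close> into the matrix element of \<open>g\<close> between the eigenvectors
        \<open>F\<close> and \<open>tr E\<close>.\<close>
      have "lookup (?F * E) g = tau (tr (single (- g) 1 * (?F * E)))"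
        unfolding lookup_conv_tau[of "?F * E"] by simp
      also have "\<dots> = tau (tr E * F * single g 1)"
        by (simp add: tr_mult tr_single mult.assoc)
      also have "\<dots> = tau (star F * single g 1 * tr E)"
        unfolding star_F using tau_commute[of "tr E" "F * single g 1"] by (simp add: mult.assoc)
      also have "\<dots> = c0 * f g"
        using state_unique[OF order_refl etE eF' alg_single[OF True], of 1] by (simp add: c0_def star_F)
      finally show ?thesis using True by (simp add: lookup_F)
    next
      case False
      moreover have "?F * E \<in> alg n" using alg_mult aF E by blast
      ultimately show ?thesis by (auto simp: alg_def in_keys_iff lookup_F)
    qed
  qed
  have eq: "sc \<kappa> * E = sc c0 * F" using FE FE2 by simp
  from arg_cong[OF this, of "\<lambda>a. lookup a 0"] have "\<kappa> = c0"
    using E f_0 by (simp add: lookup_F)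
  then show ?thesis using eq k0 sc_cancel by blast
qed

end

section \<open>Standard tableaux as sequences of boxes\<close>

definition box_le :: "nat \<times> nat \<Rightarrow> nat \<times> nat \<Rightarrow> bool" where
  "box_le p q \<longleftrightarrow> fst p \<le> fst q \<and> snd p \<le> snd q"

context blocks
begin

text \<open>A tableau is encoded by the box \<open>p k\<close> of each entry \<open>k\<close>; it is standard iff every box weakly
  above and to the left of \<open>p k\<close> carries an entry \<open>\<le> k\<close> of the same block.\<close>

definition std_seq :: "nat \<Rightarrow> (nat \<Rightarrow> nat \<times> nat) \<Rightarrow> bool" where
  "std_seq n p \<longleftrightarrow>
    (\<forall>k\<in>{1..n}. 1 \<le> fst (p k) \<and> 1 \<le> snd (p k) \<and>
      (\<forall>q. 1 \<le> fst q \<and> 1 \<le> snd q \<and> box_le q (p k) \<longrightarrow> (\<exists>j\<in>{1..k}. J j k \<and> p j = q))) \<and>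
    (\<forall>i\<in>{1..n}. \<forall>j\<in>{1..n}. J i j \<and> p i = p j \<longrightarrow> i = j)"

context
  fixes n p
  assumes std: "std_seq n p"
begin

lemma std_pos: "1 \<le> k \<Longrightarrow> k \<le> n \<Longrightarrow> 1 \<le> fst (p k) \<and> 1 \<le> snd (p k)"
  using bspec[OF conjunct1[OF std[unfolded std_seq_def]], of k] by simp

lemma std_inj: "i \<in> {1..n} \<Longrightarrow> j \<in> {1..n} \<Longrightarrow> J i j \<Longrightarrow> p i = p j \<Longrightarrow> i = j"
  using std unfolding std_seq_def by blast

lemma std_box:
  assumes "1 \<le> k" "k \<le> n" "1 \<le> fst q" "1 \<le> snd q" "box_le q (p k)"
  obtains j where "1 \<le> j" "j \<le> k" "J j k" "p j = q"
proof -
  have "k \<in> {1..n}" using assms by auto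
  then have "\<exists>j\<in>{1..k}. J j k \<and> p j = q" using std assms(3-5) unfolding std_seq_def by blast
  then show ?thesis using that by auto
qed

lemma std_le:
  assumes "1 \<le> j" "j \<le> n" "1 \<le> k" "k \<le> n" "J j k" "box_le (p j) (p k)"
  shows "j \<le> k"
proof -
  obtain i where i: "1 \<le> i" "i \<le> k" "J i k" "p i = p j"
    using std_box[of k "p j"] std_pos[of j] assms by auto
  then have "i = j" using assms by (intro std_inj) (auto simp: J_def)
  then show ?thesis using i by simp
qed

text \<open>If both coordinates increased, the box to the right of \<open>p k\<close> would need an
  entry strictly between \<open>k\<close> and \<open>Suc k\<close>.\<close>

lemma std_Suc_cases:
  assumes k: "1 \<le> k" "k < n" "J k (Suc k)"
  shows "\<not> box_le (p (Suc k)) (p k)"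
    and "fst (p (Suc k)) \<le> fst (p k) \<or> snd (p (Suc k)) \<le> snd (p k)"
proof -
  show "\<not> box_le (p (Suc k)) (p k)"
    using std_le[of "Suc k" k] k by (auto simp: J_def)
  show "fst (p (Suc k)) \<le> fst (p k) \<or> snd (p (Suc k)) \<le> snd (p k)"
  proof (rule ccontr)
    assume n: "\<not> ?thesis"
    let ?q = "(fst (p k), Suc (snd (p k)))"
    obtain j where j: "1 \<le> j" "j \<le> Suc k" "J j (Suc k)" "p j = ?q"
      by (rule std_box[of "Suc k" ?q]) (use n k std_pos[of k] in \<open>auto simp: box_le_def\<close>)
    have "k \<le> j" by (rule std_le) (use j k in \<open>auto simp: box_le_def J_def\<close>)
    moreover have "j \<noteq> k" using j(4) by (metis n_not_Suc_n snd_conv)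
    moreover have "j \<noteq> Suc k" using j(4) n by auto
    ultimately show False using j by linarith
  qed
qed

lemma content_Suc_neq:
  assumes "1 \<le> k" "k < n" "J k (Suc k)"
  shows "box_content (p (Suc k)) \<noteq> box_content (p k)"
  using std_Suc_cases[OF assms] by (auto simp: box_content_def box_le_def)

text \<open>Incomparable boxes differ in both coordinates, with opposite signs, and the two
  differences add up in the content.\<close>

lemma content_Suc_gap:
  assumes "1 \<le> k" "k < n" "J k (Suc k)" "\<not> box_le (p k) (p (Suc k))"
  shows "\<bar>box_content (p k) - box_content (p (Suc k))\<bar> \<ge> 2"
  using std_Suc_cases[OF assms(1-3)] assms(4) by (auto simp: box_content_def box_le_def)

lemma std_seq_swp:
  assumes k: "1 \<le> k" "k < n" "J k (Suc k)" "\<not> box_le (p k) (p (Suc k))"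
  shows "std_seq n (swp k p)"
  unfolding std_seq_def
proof (intro conjI ballI allI impI)
  let ?t = "transpose k (Suc k)"
  have sw: "swp k p i = p (?t i)" for i by (simp add: swp_def)
  have Jt: "J (?t i) i" for i using k by (auto simp: transpose_def J_def)
  have tn: "?t i \<in> {1..n}" if "i \<in> {1..n}" for i using that k by (auto simp: transpose_def)
  fix i assume i: "i \<in> {1..n}"
  show "1 \<le> fst (swp k p i)" "1 \<le> snd (swp k p i)"
    unfolding sw using std_pos[of "?t i"] tn[OF i] by auto
  show "\<exists>j\<in>{1..i}. J j i \<and> swp k p j = q"
    if q: "1 \<le> fst q \<and> 1 \<le> snd q \<and> box_le q (swp k p i)" for q
  proof -
    obtain j where j: "1 \<le> j" "j \<le> ?t i" "J j (?t i)" "p j = q"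
    proof (rule std_box[of "?t i" q])
      show "1 \<le> ?t i" "?t i \<le> n" using tn[OF i] by auto
    qed (use q in \<open>auto simp: sw\<close>)
    have "?t j \<le> i"
    \<comment> \<open>The one case in which the exchange could spoil standardness; it would make
      \<open>p k\<close> and \<open>p (Suc k)\<close> comparable.\<close>
    proof (cases "i = k \<and> j = k")
      case True
      then have "box_le (p k) (p (Suc k))" using q j by (simp add: sw)
      with k show ?thesis by simp
    next
      case False
      then show ?thesis using j(2) by (auto simp: transpose_def split: if_splits)
    qed
    moreover have "1 \<le> ?t j" using j k by (auto simp: transpose_def)
    moreover have "J (?t j) i" using Jt[of j] Jt[of i] j(3) by (auto simp: J_def)
    moreover have "swp k p (?t j) = q" using j(4) by (simp add: sw)
    ultimately show ?thesis by auto
  qed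
  fix j assume j: "j \<in> {1..n}" and e: "J i j \<and> swp k p i = swp k p j"
  have "?t i = ?t j"
    by (rule std_inj) (use tn i j e Jt[of i] Jt[of j] in \<open>auto simp: sw J_def\<close>)
  then show "i = j" by (metis transpose_involutory)
qed

end

end

section \<open>Standard tableaux\<close>

definition tab_pos :: "nat \<Rightarrow> nat list \<Rightarrow> nat list \<Rightarrow> filling \<times> filling \<Rightarrow> nat \<Rightarrow> nat \<times> nat" where
  "tab_pos r lam mu T k = (if k \<le> r then inv_into (diagram lam) (fst T) k else inv_into (diagram mu) (snd T) k)"

lemma content_tab_pos: "content r lam mu T k = box_content (tab_pos r lam mu T k)"
  by (simp add: content_def tab_pos_def)

lemma diagram_down:
  assumes "partition_of m lam" "q \<in> diagram lam" "1 \<le> fst p" "1 \<le> snd p" "box_le p q"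
  shows "p \<in> diagram lam"
proof -
  obtain a b a' b' where e: "p = (a, b)" "q = (a', b')" by fastforce
  have "lam ! (a' - 1) \<le> lam ! (a - 1)"
  proof (cases "a = a'")
    case False
    then have "a - 1 < a' - 1" "a' - 1 < length lam"
      using assms by (auto simp: e box_le_def diagram_def)
    then show ?thesis using assms(1) unfolding partition_of_def sorted_wrt_iff_nth_less by blast
  qed simp
  then show ?thesis using assms by (auto simp: e box_le_def diagram_def)
qed

context
  fixes m lam A T
  assumes part: "partition_of m lam" and fil: "T \<in> std_filling lam A"
begin

lemma filling_bij: "bij_betw T (diagram lam) A"
  using fil by (auto simp: std_filling_def)

lemma filling_inv:
  assumes "k \<in> A"
  shows "inv_into (diagram lam) T k \<in> diagram lam" "T (inv_into (diagram lam) T k) = k"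
  using filling_bij assms by (auto simp: bij_betw_def inv_into_into f_inv_into_f)

lemma filling_inv_eq: "b \<in> diagram lam \<Longrightarrow> inv_into (diagram lam) T (T b) = b"
  using filling_bij by (auto simp: bij_betw_def)

text \<open>The comparison goes through the box in the row of \<open>p\<close> and the column of
  \<open>q\<close>, which a partition shape contains.\<close>

lemma filling_mono:
  assumes "p \<in> diagram lam" "q \<in> diagram lam" "box_le p q"
  shows "T p \<le> T q"
proof -
  obtain a b a' b' where e: "p = (a, b)" "q = (a', b')" by fastforce
  have 1: "(a, b') \<in> diagram lam"
    by (rule diagram_down[OF part assms(2)]) (use assms in \<open>auto simp: e box_le_def diagram_def\<close>)
  have "T (a, b) \<le> T (a, b')"
    using fil 1 assms by (cases "b = b'") (auto simp: e box_le_def std_filling_def less_imp_le)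
  also have "\<dots> \<le> T (a', b')"
    using fil 1 assms by (cases "a = a'") (auto simp: e box_le_def std_filling_def less_imp_le)
  finally show ?thesis by (simp add: e)
qed

lemma filling_box:
  assumes "k \<in> A" "1 \<le> fst q" "1 \<le> snd q" "box_le q (inv_into (diagram lam) T k)"
  shows "T q \<in> A" "T q \<le> k" "inv_into (diagram lam) T (T q) = q"
proof -
  have q: "q \<in> diagram lam" by (rule diagram_down[OF part filling_inv(1)[OF assms(1)] assms(2-4)])
  then show "inv_into (diagram lam) T (T q) = q" by (rule filling_inv_eq)
  show "T q \<in> A" using q filling_bij by (auto simp: bij_betw_def)
  show "T q \<le> k" using filling_mono[OF q filling_inv(1)[OF assms(1)] assms(4)] filling_inv(2)[OF assms(1)] by simp
qed

end

lemma diagram_pos: "q \<in> diagram lam \<Longrightarrow> 1 \<le> fst q \<and> 1 \<le> snd q"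
  by (auto simp: diagram_def)

lemma std_seq_tab_pos:
  assumes part: "partition_of r lam" "partition_of s mu" and T: "T \<in> std_tableaux r s lam mu"
  shows "blocks.std_seq r (r + s) (tab_pos r lam mu T)"
proof -
  interpret blocks r .
  have f1: "fst T \<in> std_filling lam {1..r}" and f2: "snd T \<in> std_filling mu {r+1..r+s}"
    using T by (auto simp: std_tableaux_def)
  note i1 = filling_inv[OF part(1) f1] and i2 = filling_inv[OF part(2) f2]
  note b1 = filling_box[OF part(1) f1] and b2 = filling_box[OF part(2) f2]
  show ?thesis
    unfolding std_seq_def
  proof (intro conjI ballI allI impI)
    fix k assume k: "k \<in> {1..r+s}"
    show "1 \<le> fst (tab_pos r lam mu T k)" "1 \<le> snd (tab_pos r lam mu T k)"
      using k diagram_pos[OF i1(1)[of k]] diagram_pos[OF i2(1)[of k]] by (auto simp: tab_pos_def)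
    fix q assume q: "1 \<le> fst q \<and> 1 \<le> snd q \<and> box_le q (tab_pos r lam mu T k)"
    show "\<exists>j\<in>{1..k}. J j k \<and> tab_pos r lam mu T j = q"
    proof (cases "k \<le> r")
      case True
      then show ?thesis using b1[of k q] q k by (intro bexI[of _ "fst T q"]) (auto simp: tab_pos_def J_def)
    next
      case False
      then show ?thesis using b2[of k q] q k by (intro bexI[of _ "snd T q"]) (auto simp: tab_pos_def J_def)
    qed
  next
    fix i j assume "i \<in> {1..r+s}" "j \<in> {1..r+s}" "J i j \<and> tab_pos r lam mu T i = tab_pos r lam mu T j"
    then have ij: "i \<in> {1..r+s}" "j \<in> {1..r+s}" "i \<le> r \<longleftrightarrow> j \<le> r"
      "tab_pos r lam mu T i = tab_pos r lam mu T j" by (auto simp: J_def)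
    have a: "(if k \<le> r then fst T else snd T) (tab_pos r lam mu T k) = k" if "k \<in> {1..r+s}" for k
      using that i1(2)[of k] i2(2)[of k] by (simp add: tab_pos_def)
    show "i = j" using a[OF ij(1)] a[OF ij(2)] ij(3,4) by metis
  qed
qed

lemma tab_pos_swap_entries:
  assumes part: "partition_of r lam" "partition_of s mu" and T: "T \<in> std_tableaux r s lam mu"
    and T': "swap_entries lam mu i T \<in> std_tableaux r s lam mu"
    and i: "i \<in> {1..<r} \<union> {r+1..<r+s}" and k: "k \<in> {1..r+s}"
  shows "tab_pos r lam mu (swap_entries lam mu i T) k = tab_pos r lam mu T (transpose i (Suc i) k)"
proof -
  let ?t = "transpose i (Suc i)"
  have f1: "fst T \<in> std_filling lam {1..r}" and f2: "snd T \<in> std_filling mu {r+1..r+s}"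
    using T by (auto simp: std_tableaux_def)
  have f1': "fst (swap_entries lam mu i T) \<in> std_filling lam {1..r}"
    and f2': "snd (swap_entries lam mu i T) \<in> std_filling mu {r+1..r+s}"
    using T' by (auto simp: std_tableaux_def)
  show ?thesis
  proof (cases "k \<le> r")
    case True
    then have tk: "?t k \<in> {1..r}" using i k by (auto simp: transpose_def)
    let ?b = "inv_into (diagram lam) (fst T) (?t k)"
    note b = filling_inv[OF part(1) f1 tk]
    have "fst (swap_entries lam mu i T) ?b = k"
      using b by (simp add: swap_entries_def)
    then show ?thesis
      using filling_inv_eq[OF part(1) f1' b(1)] True tk by (simp add: tab_pos_def)
  next
    case False
    then have tk: "?t k \<in> {r+1..r+s}" using i k by (auto simp: transpose_def)
    let ?b = "inv_into (diagram mu) (snd T) (?t k)"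
    note b = filling_inv[OF part(2) f2 tk]
    have "snd (swap_entries lam mu i T) ?b = k"
      using b by (simp add: swap_entries_def)
    then show ?thesis
      using filling_inv_eq[OF part(2) f2' b(1)] False tk by (simp add: tab_pos_def)
  qed
qed

lemma swap_entries_twice:
  assumes "T \<in> std_tableaux r s lam mu"
  shows "swap_entries lam mu i (swap_entries lam mu i T) = T"
proof (rule prod_eqI)
  have "fst T \<in> extensional (diagram lam)" "snd T \<in> extensional (diagram mu)"
    using assms by (auto simp: std_tableaux_def std_filling_def)
  then show "fst (swap_entries lam mu i (swap_entries lam mu i T)) = fst T"
    "snd (swap_entries lam mu i (swap_entries lam mu i T)) = snd T"
    by (auto simp: swap_entries_def fun_eq_iff restrict_def extensional_def)
qed

lemma grp_iff_SxS: "g \<in> blocks.grp r (r + s) \<longleftrightarrow> apply g \<in> SxS r s"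
proof -
  interpret blocks r .
  show ?thesis
  proof
    assume g: "g \<in> grp (r + s)"
    let ?h = "apply g"
    have inj: "?h x = ?h y \<longleftrightarrow> x = y" for x y by (rule apply_inj)
    have sur: "\<exists>x. ?h x = y" for y using bij_is_surj[OF bij_apply, of g] by (metis surjD)
    have J: "J k (?h k)" for k using g by (auto simp: grp_def)
    have Jr: "?h k \<le> r \<longleftrightarrow> k \<le> r" for k using J[of k] by (simp add: J_def)
    have fx: "k = 0 \<or> k > r + s \<Longrightarrow> ?h k = k" for k using g by (auto simp: grp_def)
    have z: "?h k = 0 \<longleftrightarrow> k = 0" for k using fx[of 0] inj[of k 0] by auto
    \<comment> \<open>\<open>?h\<close> on one side of \<open>r\<close> and the identity on the
      other.\<close>
    let ?p = "\<lambda>b x. if (x \<le> r) = b then ?h x else x"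
    have perm: "?p b permutes S" if "\<And>x. x \<notin> S \<Longrightarrow> ?p b x = x" for b S
      unfolding permutes_def
    proof (intro conjI allI impI that)
      fix y
      obtain x where x: "y = ?h x" using sur by metis
      show "\<exists>!x. ?p b x = y"
        unfolding x by (intro ex1I[of _ "if (y \<le> r) = b then x else y"]) (auto simp: x Jr inj split: if_splits)
    qed
    have "?p True permutes {1..r}" by (rule perm) (use fx in auto)
    moreover have "?p False permutes {r+1..r+s}" by (rule perm) (use fx in auto)
    moreover have "?h = ?p True \<circ> ?p False" by (auto simp: fun_eq_iff Jr)
    ultimately show "apply g \<in> SxS r s" unfolding SxS_def by blast
  next
    assume "apply g \<in> SxS r s"
    then obtain p q where pq: "p permutes {1..r}" "q permutes {r+1..r+s}" "apply g = p \<circ> q"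
      by (auto simp: SxS_def)
    have "J k (p (q k))" for k
    proof (cases "k \<in> {r+1..r+s}")
      case True
      then have "q k \<in> {r+1..r+s}" using permutes_in_image[OF pq(2)] by blast
      then show ?thesis using True permutes_not_in[OF pq(1), of "q k"] by (auto simp: J_def)
    next
      case False
      then have "q k = k" using permutes_not_in[OF pq(2)] by blast
      then show ?thesis using permutes_in_image[OF pq(1), of k] permutes_not_in[OF pq(1), of k]
        by (cases "k \<in> {1..r}") (auto simp: J_def)
    qed
    moreover have "p (q k) = k" if "k \<notin> {1..r+s}" for k
      using that permutes_not_in[OF pq(2), of k] permutes_not_in[OF pq(1), of k] by auto
    ultimately show "g \<in> grp (r + s)" using pq(3) by (auto simp: grp_def)
  qed
qed

lemma SxS_apply: "h \<in> SxS r s \<Longrightarrow> \<exists>g. apply g = h"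
proof -
  assume "h \<in> SxS r s"
  then obtain p q where pq: "p permutes {1..r}" "q permutes {r+1..r+s}" "h = p \<circ> q"
    by (auto simp: SxS_def)
  have "bij h" using pq permutes_bij bij_comp by metis
  moreover have "h x = x" if "x \<notin> {1..r+s}" for x
    using that permutes_not_in[OF pq(2), of x] permutes_not_in[OF pq(1), of x] pq(3) by auto
  then have "{x. h x \<noteq> x} \<subseteq> {1..r+s}" by blast
  then have "finite {x. h x \<noteq> x}" by (rule finite_subset) simp
  ultimately show ?thesis using Perm_inverse[of h] by blast
qed

lemma SxS_eq_image: "SxS r s = apply ` blocks.grp r (r + s)"
  using SxS_apply grp_iff_SxS by fastforce

context blocks
begin

text \<open>The corner must carry an entry of the same block that is at most \<open>k\<close>, and
  only \<open>k\<close> itself is available.\<close>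

lemma std_first:
  assumes "std_seq n p" "1 \<le> k" "k \<le> n" "\<And>j. 1 \<le> j \<Longrightarrow> j < k \<Longrightarrow> \<not> J j k"
  shows "p k = (1, 1)"
proof -
  obtain j where "1 \<le> j" "j \<le> k" "J j k" "p j = (1, 1)"
  proof (rule std_box[OF assms(1-3), of "(1, 1)"])
    show "box_le (1, 1) (p k)" using std_pos[OF assms(1-3)] by (auto simp: box_le_def)
  qed auto
  then show ?thesis using assms(4)[of j] by (cases "j = k") auto
qed

end

section \<open>Contents as Jucys-Murphy eigenvalues on the Young basis\<close>

context young_basis
begin

interpretation blk: blocks r .

definition ract :: "galg \<Rightarrow> 'v \<Rightarrow> 'v" where
  "ract a x = (\<Sum>g\<in>keys a. lookup a g *s act (apply g) x)"

lemma ract_on: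
  assumes "finite S" "keys a \<subseteq> S"
  shows "ract a x = (\<Sum>g\<in>S. lookup a g *s act (apply g) x)"
  unfolding ract_def
  by (rule sum.mono_neutral_left) (use assms in \<open>auto simp: in_keys_iff\<close>)

lemma ract_add: "ract (a + b) x = ract a x + ract b x"
proof -
  let ?S = "keys a \<union> keys b"
  have "ract (a + b) x = (\<Sum>g\<in>?S. lookup (a + b) g *s act (apply g) x)"
    by (rule ract_on) (use keys_add[of a b] in auto)
  also have "\<dots> = (\<Sum>g\<in>?S. lookup a g *s act (apply g) x) + (\<Sum>g\<in>?S. lookup b g *s act (apply g) x)"
    by (simp add: lookup_add scale_left_distrib sum.distrib)
  finally show ?thesis using ract_on[of ?S a x] ract_on[of ?S b x] by simp
qed

lemma ract_single: "ract (single g k) x = k *s act (apply g) x"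
  using ract_on[of "{g}" "single g k" x] by simp

lemma ract_0 [simp]: "ract 0 x = 0"
  by (simp add: ract_def)

lemma ract_sum: "ract (\<Sum>i\<in>I. h i) x = (\<Sum>i\<in>I. ract (h i) x)"
  by (induction I rule: infinite_finite_induct) (simp_all add: ract_add)

lemma grp_SxS: "g \<in> blk.grp (r + s) \<Longrightarrow> apply g \<in> SxS r s"
  by (simp add: grp_iff_SxS)

lemma algD: "a \<in> blk.alg (r + s) \<Longrightarrow> g \<in> keys a \<Longrightarrow> apply g \<in> SxS r s"
  using grp_SxS by (auto simp: blk.alg_def)

lemma ract_closed: "a \<in> blk.alg (r + s) \<Longrightarrow> x \<in> V \<Longrightarrow> ract a x \<in> V"
  unfolding ract_def
  by (intro subspace_sum[OF subspace_V] subspace_scale[OF subspace_V] act_closed algD) auto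

lemma act_sum:
  assumes "g \<in> SxS r s" "\<And>i. i \<in> I \<Longrightarrow> x i \<in> V"
  shows "act g (\<Sum>i\<in>I. x i) = (\<Sum>i\<in>I. act g (x i))"
proof -
  have "act g 0 = 0" using act_scale[OF assms(1), of 0 0] subspace_0[OF subspace_V] by simp
  with assms(2) show ?thesis
    by (induction I rule: infinite_finite_induct) (simp_all add: act_add assms(1) subspace_sum[OF subspace_V])
qed

lemma ract_plus:
  "a \<in> blk.alg (r + s) \<Longrightarrow> x \<in> V \<Longrightarrow> y \<in> V \<Longrightarrow> ract a (x + y) = ract a x + ract a y"
  unfolding ract_def by (simp add: act_add algD scale_right_distrib sum.distrib)

lemma ract_scale:
  "a \<in> blk.alg (r + s) \<Longrightarrow> x \<in> V \<Longrightarrow> ract a (k *s x) = k *s ract a x"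
  unfolding ract_def by (simp add: act_scale algD scale_sum_right mult.commute)

lemma ract_mult:
  assumes a: "a \<in> blk.alg (r + s)" and b: "b \<in> blk.alg (r + s)" and x: "x \<in> V"
  shows "ract (a * b) x = ract a (ract b x)"
proof -
  have "a * b = (\<Sum>g\<in>keys a. \<Sum>h\<in>keys b. single (g + h) (lookup a g * lookup b h))"
    by (subst (1) galg_expand[of a], subst (1) galg_expand[of b])
      (simp only: sum_distrib_left sum_distrib_right mult_single, rule sum.swap)
  then have "ract (a * b) x = (\<Sum>g\<in>keys a. \<Sum>h\<in>keys b. (lookup a g * lookup b h) *s act (apply (g + h)) x)"
    by (simp add: ract_sum ract_single)
  also have "\<dots> = (\<Sum>g\<in>keys a. lookup a g *s act (apply g) (\<Sum>h\<in>keys b. lookup b h *s act (apply h) x))"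
  proof (rule sum.cong[OF refl])
    fix g assume g: "g \<in> keys a"
    have "act (apply g) (\<Sum>h\<in>keys b. lookup b h *s act (apply h) x) =
        (\<Sum>h\<in>keys b. lookup b h *s act (apply (g + h)) x)"
      unfolding apply_plus
      using algD[OF a g] algD[OF b] x act_closed subspace_scale[OF subspace_V]
      by (subst act_sum) (auto simp: act_scale act_comp intro!: sum.cong)
    then show "(\<Sum>h\<in>keys b. (lookup a g * lookup b h) *s act (apply (g + h)) x) =
        lookup a g *s act (apply g) (\<Sum>h\<in>keys b. lookup b h *s act (apply h) x)"
      by (simp add: scale_sum_right)
  qed
  finally show ?thesis by (simp add: ract_def)
qed

lemma ract_sc: "x \<in> V \<Longrightarrow> ract (sc k) x = k *s x"
  by (simp add: sc_def ract_single act_id)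

lemma ract_1: "x \<in> V \<Longrightarrow> ract 1 x = x"
  using ract_sc[of x 1] by simp

lemma ip_0: "x \<in> V \<Longrightarrow> ip x 0 = 0"
  using ip_scale[of x x 0] by simp

lemma lin_ext_ip:
  assumes x: "x \<in> V" and a: "a \<in> blk.alg (r + s)"
  shows "lin_ext (\<lambda>g. ip x (act (apply g) x)) a = ip x (ract a x)"
proof -
  have "ip x (\<Sum>g\<in>S. lookup a g *s act (apply g) x) = (\<Sum>g\<in>S. lookup a g * ip x (act (apply g) x))"
    if "finite S" "S \<subseteq> keys a" for S
    using that
  proof induction
    case (insert g S)
    have "act (apply g) x \<in> V" using act_closed algD[OF a] insert.prems x by auto
    moreover have "(\<Sum>g\<in>S. lookup a g *s act (apply g) x) \<in> V"
      by (intro subspace_sum[OF subspace_V] subspace_scale[OF subspace_V] act_closed algD[OF a] x)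
        (use insert.prems in auto)
    ultimately show ?case using insert x subspace_scale[OF subspace_V] by (simp add: ip_add ip_scale)
  qed (simp add: ip_0 x)
  then show ?thesis by (simp add: lin_ext_def ract_def)
qed

lemma v_in_V: "S \<in> std_tableaux r s lam mu \<Longrightarrow> v S \<in> V"
  using span_v span_base by blast

lemma v_neq_0: "S \<in> std_tableaux r s lam mu \<Longrightarrow> v S \<noteq> 0"
  using orthonormal_v[of S S] ip_0[OF v_in_V[of S]] by auto

context
  assumes part: "partition_of r lam" "partition_of s mu"
begin

abbreviation "ct S k \<equiv> content r lam mu S k"

lemma ct_swap:
  assumes "S \<in> std_tableaux r s lam mu" "swap_entries lam mu i S \<in> std_tableaux r s lam mu"
    "i \<in> {1..<r} \<union> {r+1..<r+s}"
  shows "ct (swap_entries lam mu i S) i = ct S (Suc i)" "ct (swap_entries lam mu i S) (Suc i) = ct S i"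
proof -
  have "i \<in> {1..r+s}" "Suc i \<in> {1..r+s}" using assms(3) by auto
  from this[THEN tab_pos_swap_entries[OF part assms]]
  show "ct (swap_entries lam mu i S) i = ct S (Suc i)" "ct (swap_entries lam mu i S) (Suc i) = ct S i"
    by (simp_all add: content_tab_pos)
qed

lemma ct_neq:
  assumes "S \<in> std_tableaux r s lam mu" "1 \<le> k" "k < r + s" "blk.J k (Suc k)"
  shows "ct S (Suc k) \<noteq> ct S k"
  using blk.content_Suc_neq[OF std_seq_tab_pos[OF part assms(1)] assms(2-4)]
  by (simp add: content_tab_pos)

lemma ract_tp: "ract (tp i j) x = act (transpose i j) x"
  by (simp add: tp_def ract_single swap_apply)

text \<open>By \<open>X_Suc\<close> the action of \<open>X (Suc k)\<close> is computed from
  \<open>X k\<close> and the generator on the span of \<open>v S\<close> and the vector of the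
  exchanged tableau; the identity \<open>d * (b - a) = 1\<close> diagonalizes it.\<close>

lemma ract_X:
  assumes "S \<in> std_tableaux r s lam mu" "1 \<le> k" "k \<le> r + s"
  shows "ract (blk.X k) (v S) = of_int (ct S k) *s v S"
  using assms
proof (induction k arbitrary: S)
  case (Suc k)
  note std = std_seq_tab_pos[OF part Suc.prems(1)]
  show ?case
  proof (cases "k = 0 \<or> \<not> blk.J k (Suc k)")
    case True
    have "tab_pos r lam mu S (Suc k) = (1, 1)"
      by (rule blk.std_first[OF std]) (use Suc.prems True in \<open>auto simp: blk.J_def\<close>)
    moreover have "blk.X (Suc k) = 0" using True blk.X_start by auto
    ultimately show ?thesis by (simp add: content_tab_pos box_content_def)
  next
    case False
    then have k: "1 \<le> k" "blk.J k (Suc k)" "k \<in> {1..<r} \<union> {r+1..<r+s}" "k < r + s"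
      using Suc.prems by (auto simp: blk.J_def)
    let ?s = "tp k (Suc k)" and ?X = "blk.X k" and ?v = "v S" and ?S' = "swap_entries lam mu k S"
    define d e where "d = complex_of_real (axial_inv r lam mu S k)"
      and "e = complex_of_real (sqrt (1 - (axial_inv r lam mu S k)\<^sup>2))"
    define a b where "a = (of_int (ct S k) :: complex)" and "b = (of_int (ct S (Suc k)) :: complex)"
    have vV: "?v \<in> V" by (rule v_in_V[OF Suc.prems(1)])
    have s: "?s \<in> blk.alg (r + s)" by (rule blk.alg_tp) (use k in auto)
    have X: "?X \<in> blk.alg (r + s)" by (rule blk.alg_X) (use k in auto)
    have ab: "a \<noteq> b" using ct_neq[OF Suc.prems(1) k(1,4,2)] by (simp add: a_def b_def)
    have d: "d = 1 / (b - a)" by (simp add: d_def a_def b_def axial_inv_def)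
    have Xv: "ract ?X ?v = a *s ?v" using Suc.IH[OF Suc.prems(1) k(1)] k by (simp add: a_def)
    have sv: "ract ?s ?v = (if ?S' \<in> std_tableaux r s lam mu then d *s ?v + e *s v ?S' else d *s ?v)"
      using act_generator[OF k(3) Suc.prems(1)] by (simp add: ract_tp d_def e_def)
    have eq: "ract (blk.X (Suc k)) ?v = ract ?s (ract ?X (ract ?s ?v)) + ract ?s ?v"
      unfolding blk.X_Suc[OF k(1,2)] ract_add
      by (simp add: ract_mult blk.alg_mult s X vV ract_closed)
    have ss: "ract ?s (ract ?s ?v) = ?v"
      using ract_mult[OF s s vV] by (simp add: ract_1 vV)
    show ?thesis
    proof (cases "?S' \<in> std_tableaux r s lam mu")
      case True
      let ?w = "v ?S'"
      have wV: "?w \<in> V" by (rule v_in_V[OF True])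
      note cs = ct_swap[OF Suc.prems(1) True k(3)]
      have Xw: "ract ?X ?w = b *s ?w"
        using Suc.IH[OF True k(1)] k cs(1) by (simp add: b_def)
      have ax: "axial_inv r lam mu ?S' k = - axial_inv r lam mu S k"
        using cs by (simp add: axial_inv_def) (metis minus_diff_eq minus_divide_right)
      have sw: "ract ?s ?w = (- d) *s ?w + e *s ?v"
        using act_generator[OF k(3) True] swap_entries_twice[OF Suc.prems(1)] Suc.prems(1)
        by (simp add: ract_tp d_def e_def ax)
      \<comment> \<open>The argument of the square root must be nonnegative: \<open>sqrt\<close> of
        a negative real would give \<open>e * e\<close> the wrong sign.\<close>
      have "\<bar>real_of_int (ct S (Suc k) - ct S k)\<bar> \<ge> 1"
        using ct_neq[OF Suc.prems(1) k(1,4,2)] by linarith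
      then have "\<bar>axial_inv r lam mu S k\<bar> \<le> 1"
        unfolding axial_inv_def abs_divide by (simp add: divide_le_eq)
      then have "(axial_inv r lam mu S k)\<^sup>2 \<le> 1" by (simp add: abs_square_le_1)
      then have e2: "e * e = 1 - d * d"
        unfolding d_def e_def of_real_mult[symmetric] by (simp add: power2_eq_square)
      have sv': "ract ?s ?v = d *s ?v + e *s ?w" using sv True by simp
      have "ract ?X (ract ?s ?v) = (d * a) *s ?v + (e * b) *s ?w"
        unfolding sv' by (simp add: ract_plus ract_scale X vV wV subspace_scale[OF subspace_V] Xv Xw)
      then have "ract ?s (ract ?X (ract ?s ?v)) = (d * a) *s (d *s ?v + e *s ?w) + (e * b) *s ((- d) *s ?w + e *s ?v)"
        by (simp add: ract_plus ract_scale s vV wV subspace_scale[OF subspace_V] sv' sw)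
      then have "ract (blk.X (Suc k)) ?v = (d * a * d + e * b * e + d) *s ?v + (d * a * e - e * b * d + e) *s ?w"
        unfolding eq sv' by (simp add: scale_right_distrib scale_left_distrib scale_left_diff_distrib
          scale_minus_left scale_right_diff_distrib)
      moreover have "d * a * d + e * b * e + d = b"
      proof -
        have "d * (b - a) = 1" using ab d by simp
        moreover have "d * a * d + e * b * e + d = d * d * a + (e * e) * b + d" by (simp add: algebra_simps)
        moreover have "\<dots> = b - d * (d * (b - a)) + d" unfolding e2 by (simp add: algebra_simps)
        ultimately show ?thesis by simp
      qed
      moreover have "d * a * e - e * b * d + e = 0"
      proof -
        have "d * (b - a) = 1" using ab d by simp
        moreover have "d * a * e - e * b * d + e = e * (1 - d * (b - a))" by (simp add: algebra_simps)
        ultimately show ?thesis by simp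
      qed
      ultimately show ?thesis by (simp add: b_def)
    next
      case False
      then have sv': "ract ?s ?v = d *s ?v" using sv by simp
      \<comment> \<open>If the exchange is not standard, the generator acts by the scalar
        \<open>d\<close>; being an involution, it forces \<open>d * d = 1\<close>.\<close>
      have "?v = (d * d) *s ?v"
        using ss unfolding sv' by (simp add: ract_scale s vV sv')
      then have dd: "d * d = 1"
        using v_neq_0[OF Suc.prems(1)] by (metis scale_one scale_right_imp_eq)
      have "ract (blk.X (Suc k)) ?v = (d * d * a + d) *s ?v"
        unfolding eq sv' by (simp add: ract_scale X s vV Xv sv' subspace_scale[OF subspace_V] scale_left_distrib mult_ac)
      moreover have "d * d * a + d = b"
      proof -
        have "d * (b - a) = 1" using ab d by simp
        then have "d * d * (b - a) = d" by (simp add: mult.assoc)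
        then show ?thesis using dd by (simp add: algebra_simps)
      qed
      ultimately show ?thesis by (simp add: b_def)
    qed
  qed
qed simp

lemma ract_diff: "ract (a - b) x = ract a x - ract b x"
  using ract_add[of "a - b" b x] by (simp add: eq_diff_eq)

lemma ract_shifts:
  assumes "x \<in> V" "y \<in> blk.alg (r + s)" "ract y x = c *s x"
  shows "ract (shifts D y) x = (\<Prod>t\<leftarrow>D. c - t) *s x"
proof (induction D)
  case (Cons t D)
  have "ract (shifts (t # D) y) x = ract (y - sc t) (ract (shifts D y) x)"
    unfolding shifts_simps
    by (rule ract_mult) (use assms blk.alg_shifts blk.alg_diff in auto)
  also have "\<dots> = (\<Prod>t\<leftarrow>D. c - t) *s ract (y - sc t) x"
    unfolding Cons by (rule ract_scale) (use assms blk.alg_diff in auto)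
  also have "ract (y - sc t) x = (c - t) *s x"
    using assms by (simp add: ract_diff ract_sc scale_left_diff_distrib)
  finally show ?case by (simp add: mult.commute)
qed (simp add: ract_1 assms)

lemma finite_boxes: "T \<in> std_tableaux r s lam mu \<Longrightarrow> finite (diagram lam \<union> diagram mu)"
proof -
  assume "T \<in> std_tableaux r s lam mu"
  then have "bij_betw (fst T) (diagram lam) {1..r}" "bij_betw (snd T) (diagram mu) {r+1..r+s}"
    by (auto simp: std_tableaux_def std_filling_def)
  then show ?thesis by (simp add: bij_betw_finite)
qed

lemma ct_in_boxes:
  assumes "S \<in> std_tableaux r s lam mu" "1 \<le> k" "k \<le> r + s"
  shows "ct S k \<in> box_content ` (diagram lam \<union> diagram mu)"
proof -
  have "fst S \<in> std_filling lam {1..r}" "snd S \<in> std_filling mu {r+1..r+s}"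
    using assms by (auto simp: std_tableaux_def)
  then show ?thesis
    using filling_inv(1)[OF part(1), of "fst S" "{1..r}" k] filling_inv(1)[OF part(2), of "snd S" "{r+1..r+s}" k] assms
    by (auto simp: content_def)
qed

text \<open>In a standard tableau \<open>m\<close> and \<open>Suc m\<close> have different contents.
  So on each \<open>v S\<close> one of \<open>?p\<close>, \<open>?q\<close> vanishes, and
  \<open>?p * ?q\<close> is zero on \<open>V\<close>, whereas \<open>?q\<close> acts on
  \<open>w\<close> by a nonzero scalar.\<close>

lemma shifts_kill:
  assumes m: "1 \<le> m" "m < r + s" "blk.J m (Suc m)"
    and D: "complex_of_int c \<notin> set D" "\<And>b. b \<in> diagram lam \<union> diagram mu \<Longrightarrow> box_content b \<noteq> c \<Longrightarrow> of_int (box_content b) \<in> set D"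
    and w: "w \<in> V" "ract (blk.X (Suc m)) w = of_int c *s w"
  shows "ract (shifts D (blk.X m)) w = 0"
proof -
  let ?p = "shifts D (blk.X m)" and ?q = "shifts D (blk.X (Suc m))"
  have X: "blk.X m \<in> blk.alg (r + s)" "blk.X (Suc m) \<in> blk.alg (r + s)"
    by (rule blk.alg_X; use m in simp)+
  have p: "?p \<in> blk.alg (r + s)" and q: "?q \<in> blk.alg (r + s)"
    by (rule blk.alg_shifts, fact)+
  have "ract (?p * ?q) (v S) = 0" if S: "S \<in> std_tableaux r s lam mu" for S
  proof -
    have vV: "v S \<in> V" by (rule v_in_V[OF S])
    have 1: "ract ?q (v S) = (\<Prod>t\<leftarrow>D. of_int (ct S (Suc m)) - t) *s v S"
      by (rule ract_shifts[OF vV X(2)], rule ract_X[OF S]) (use m in auto)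
    have 2: "ract ?p (v S) = (\<Prod>t\<leftarrow>D. of_int (ct S m) - t) *s v S"
      by (rule ract_shifts[OF vV X(1)], rule ract_X[OF S]) (use m in auto)
    have in_D: "of_int (ct S k) \<in> set D" if "1 \<le> k" "k \<le> r + s" "ct S k \<noteq> c" for k
      using ct_in_boxes[OF S that(1,2)] D(2) that(3) by auto
    have "(\<Prod>t\<leftarrow>D. of_int (ct S m) - t) = 0 \<or> (\<Prod>t\<leftarrow>D. of_int (ct S (Suc m)) - t) = (0::complex)"
      using in_D[of m] in_D[of "Suc m"] ct_neq[OF S m] m by (auto simp: prod_list_zero_iff image_iff)
    then show ?thesis
      using ract_mult[OF p q vV] 1 2 ract_scale[OF p vV] by auto
  qed
  moreover have pq: "?p * ?q \<in> blk.alg (r + s)" by (rule blk.alg_mult[OF p q])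
  have "subspace {x \<in> V. ract (?p * ?q) x = 0}"
    using subspace_V ract_plus[OF pq] ract_scale[OF pq] ract_scale[OF pq, of 0 0]
    unfolding subspace_def by auto
  ultimately have "span (v ` std_tableaux r s lam mu) \<subseteq> {x \<in> V. ract (?p * ?q) x = 0}"
    by (intro span_minimal) (auto simp: v_in_V)
  then have "ract (?p * ?q) w = 0" using w span_v by auto
  moreover have "ract (?p * ?q) w = (\<Prod>t\<leftarrow>D. of_int c - t) *s ract ?p w"
    using ract_mult[OF p q w(1)] ract_shifts[OF w(1) X(2) w(2)] ract_scale[OF p w(1)] by simp
  moreover have "(\<Prod>t\<leftarrow>D. of_int c - t) \<noteq> (0::complex)" using D(1) by (auto simp: prod_list_zero_iff)
  ultimately show ?thesis by (simp add: scale_eq_0_iff)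
qed

lemma state_young:
  assumes T: "T \<in> std_tableaux r s lam mu"
  shows "state r (r + s) (ct T) (\<lambda>g. ip (v T) (act (apply g) (v T)))"
proof -
  let ?f = "\<lambda>g. ip (v T) (act (apply g) (v T))"
  have vV: "v T \<in> V" by (rule v_in_V[OF T])
  note le = lin_ext_ip[OF vV]
  show ?thesis
  proof (unfold_locales)
    fix y k assume y: "y \<in> blk.alg (r + s)" and k: "1 \<le> k" "k \<le> r + s"
    have X: "blk.X k \<in> blk.alg (r + s)" by (rule blk.alg_X[OF k(2)])
    show "lin_ext ?f (y * blk.X k) = of_int (ct T k) * lin_ext ?f y"
      using k by (simp add: le blk.alg_mult y X ract_mult vV ract_X[OF T k] ract_scale ip_scale ract_closed)
  next
    fix g assume g: "g \<in> blk.grp (r + s)"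
    have G: "apply g \<in> SxS r s" "apply (- g) \<in> SxS r s"
      using grp_SxS[OF g] grp_SxS[OF blk.grp_uminus[OF g]] .
    have "?f (- g) = ip (act (apply g) (v T)) (act (apply g) (act (apply (- g)) (v T)))"
      using ip_invariant[OF G(1) vV act_closed[OF G(2) vV]] by simp
    also have "act (apply g) (act (apply (- g)) (v T)) = act (apply (g + - g)) (v T)"
      unfolding apply_plus using act_comp[OF G vV] by simp
    also have "\<dots> = v T" by (simp add: act_id vV)
    finally show "?f (- g) = cnj (?f g)" using ip_cnj[OF vV act_closed[OF G(1) vV]] by simp
  next
    show "?f 0 = 1" using orthonormal_v[OF T T] by (simp add: act_id vV)
  next
    fix m assume m: "1 \<le> m" "m < r + s" "blk.J m (Suc m)"
    have fin: "finite (of_int ` box_content ` (diagram lam \<union> diagram mu) :: complex set)"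
      using finite_boxes[OF T] by blast
    obtain D' where D': "set D' = (of_int ` box_content ` (diagram lam \<union> diagram mu) :: complex set)"
      using finite_list[OF fin] by blast
    let ?c = "ct T (Suc m)"
    \<comment> \<open>The contents of all boxes except the value \<open>?c\<close> to be
      avoided.\<close>
    define D where "D = filter (\<lambda>t. t \<noteq> of_int ?c) D'"
    have D: "complex_of_int ?c \<notin> set D"
      "\<And>b. b \<in> diagram lam \<union> diagram mu \<Longrightarrow> box_content b \<noteq> ?c \<Longrightarrow> of_int (box_content b) \<in> set D"
      unfolding D_def set_filter D' by auto
    have "lin_ext ?f (y * shifts D (blk.X m) * z) = 0" if y: "y \<in> blk.alg (r + s)" and z: "z \<in> blk.alg m" for y z
    proof -
      have z': "z \<in> blk.alg (r + s)" using blk.alg_mono[OF _ z, of "r + s"] m by simp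
      have X: "blk.X (Suc m) \<in> blk.alg (r + s)" "blk.X m \<in> blk.alg (r + s)"
        by (rule blk.alg_X; use m in simp)+
      have p: "shifts D (blk.X m) \<in> blk.alg (r + s)" by (rule blk.alg_shifts[OF X(2)])
      \<comment> \<open>\<open>z\<close> commutes with \<open>X (Suc m)\<close>, so
        \<open>z v\<close> keeps the eigenvalue of \<open>v T\<close> and \<open>shifts_kill\<close>
        applies to it.\<close>
      have "ract (blk.X (Suc m)) (ract z (v T)) = ract (z * blk.X (Suc m)) (v T)"
        using blk.X_commute[OF z, of "Suc m"] ract_mult[OF X(1) z' vV] by simp
      also have "\<dots> = of_int ?c *s ract z (v T)"
        using ract_mult[OF z' X(1) vV] ract_X[OF T, of "Suc m"] ract_scale[OF z' vV] m by simp
      finally have "ract (shifts D (blk.X m)) (ract z (v T)) = 0"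
        using shifts_kill[OF m D ract_closed[OF z' vV]] by blast
      then have "ract (y * shifts D (blk.X m) * z) (v T) = ract y 0"
        by (simp add: ract_mult blk.alg_mult y p z' vV ract_closed)
      also have "\<dots> = 0" using ract_scale[OF y vV, of 0] by simp
      finally show ?thesis by (simp add: le blk.alg_mult y p z' ip_0 vV)
    qed
    with D(1) show "\<exists>D. complex_of_int ?c \<notin> set D \<and>
        (\<forall>y\<in>blk.alg (r + s). \<forall>z\<in>blk.alg m. lin_ext ?f (y * shifts D (blk.X m) * z) = 0)"
      by blast
  qed
qed

end

end

text \<open>\<open>L f a\<close> abstracts both regular values at a point and limits along a filter.\<close>

locale glim = blocks r for r +
  fixes n :: nat and L :: "('z \<Rightarrow> complex) \<Rightarrow> complex \<Rightarrow> bool"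
  assumes L_const: "\<And>a. L (\<lambda>z. a) a"
    and L_add: "\<And>f g a b. L f a \<Longrightarrow> L g b \<Longrightarrow> L (\<lambda>z. f z + g z) (a + b)"
    and L_mult: "\<And>f g a b. L f a \<Longrightarrow> L g b \<Longrightarrow> L (\<lambda>z. f z * g z) (a * b)"
begin

lemma L_sum: "(\<And>i. i \<in> I \<Longrightarrow> L (f i) (a i)) \<Longrightarrow> L (\<lambda>z. \<Sum>i\<in>I. f i z) (\<Sum>i\<in>I. a i)"
  by (induction I rule: infinite_finite_induct) (simp_all add: L_const L_add)

definition GL :: "('z \<Rightarrow> galg) \<Rightarrow> galg \<Rightarrow> bool" where
  "GL \<Phi> A \<longleftrightarrow> (\<forall>z. \<Phi> z \<in> alg n) \<and> A \<in> alg n \<and> (\<forall>g. L (\<lambda>z. lookup (\<Phi> z) g) (lookup A g))"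

lemma GL_const: "a \<in> alg n \<Longrightarrow> GL (\<lambda>z. a) a"
  by (simp add: GL_def L_const)

lemma GL_add: "GL \<Phi> A \<Longrightarrow> GL \<Psi> B \<Longrightarrow> GL (\<lambda>z. \<Phi> z + \<Psi> z) (A + B)"
  by (simp add: GL_def L_add alg_add lookup_add)

lemma GL_mult:
  assumes "GL \<Phi> A" "GL \<Psi> B"
  shows "GL (\<lambda>z. \<Phi> z * \<Psi> z) (A * B)"
  using assms by (auto simp: GL_def lookup_mult_alg[where n = n] alg_mult intro!: L_sum L_mult)

lemma GL_sc: "L f a \<Longrightarrow> GL (\<lambda>z. sc (f z)) (sc a)"
  unfolding GL_def
proof (intro conjI allI)
  fix g assume f: "L f a"
  have "lookup (sc (f z)) g = f z * lookup 1 g" "lookup (sc a) g = a * lookup 1 g" for z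
    by (metis lookup_sc_times mult_1_right)+
  then show "L (\<lambda>z. lookup (sc (f z)) g) (lookup (sc a) g)" using L_mult[OF f L_const] by simp
qed auto

lemma GL_diff: "GL \<Phi> A \<Longrightarrow> GL \<Psi> B \<Longrightarrow> GL (\<lambda>z. \<Phi> z - \<Psi> z) (A - B)"
  using GL_add[of \<Phi> A "\<lambda>z. sc (- 1) * \<Psi> z" "sc (- 1) * B"] GL_mult[OF GL_const[OF alg_sc[of "- 1"]], of \<Psi> B]
  by (simp add: sc_uminus)

text \<open>After fusion only denominators with distinct contents remain. The lemma serves twice:
  for regular values on the hook space and for the limit in the last parameter alone.\<close>

lemma GL_Kl:
  assumes s: "\<And>i. sing c m i \<Longrightarrow> Suc i < m \<and> J i (Suc i) \<and>
      L (\<lambda>z. 1 / (U z (Suc i) - U z m)) (1 / (u (Suc i) - u m))"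
    and ns: "\<And>i. \<not> sing c m i \<Longrightarrow> 1 \<le> i \<Longrightarrow> i < m \<Longrightarrow> J i m \<Longrightarrow>
      L (\<lambda>z. 1 / (U z i - U z m)) (1 / (u i - u m))"
    and m: "m \<le> n" "j < m"
  shows "GL (\<lambda>z. Kl c (U z) m j) (Kl c u m j)"
  using m(2)
proof (induction j)
  case 0
  show ?case by (simp add: GL_const)
next
  case (Suc j)
  let ?i = "Suc j"
  have "GL (\<lambda>z. kf c (U z) m ?i) (kf c u m ?i)"
  proof (cases "sing c m ?i")
    case True
    then have i: "J ?i m" "Suc ?i < m" "J (Suc ?i) m" using s[OF True] by (auto simp: sing_def J_def)
    have "tp ?i m + tp (Suc ?i) m \<in> alg n" using i m by (intro alg_add alg_tp) auto
    then show ?thesis using True s[OF True]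
      by (simp add: kf_def GL_diff GL_const GL_mult GL_sc)
  next
    case False
    show ?thesis
    proof (cases "sing c m j \<or> \<not> J ?i m")
      case True
      then show ?thesis using False by (auto simp: kf_def R_def GL_const)
    next
      case nJ: False
      then have "tp ?i m \<in> alg n" using Suc.prems m by (intro alg_tp) auto
      then show ?thesis using False nJ ns[OF False] Suc.prems
        by (simp add: kf_def R_def GL_diff GL_const GL_mult GL_sc)
    qed
  qed
  then show ?case using Suc by (simp add: GL_mult)
qed

end

section \<open>Regular values\<close>

lemma regular_valueE:
  assumes "regular_value n H U f x a"
  obtains P Q where "poly_fun n P" "poly_fun n Q" "Q x \<noteq> 0" "\<forall>z\<in>H \<inter> U. f z * Q z = P z" "P x / Q x = a"
  using assms unfolding regular_value_def by blast

lemma regular_valueI: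
  assumes "x \<in> H" "H \<inter> U \<noteq> {}" "poly_fun n P" "poly_fun n Q" "Q x \<noteq> 0"
    "\<And>z. z \<in> H \<inter> U \<Longrightarrow> f z * Q z = P z" "P x / Q x = a"
  shows "regular_value n H U f x a"
  using assms unfolding regular_value_def by blast

lemma regular_value_const: "x \<in> H \<Longrightarrow> H \<inter> U \<noteq> {} \<Longrightarrow> regular_value n H U (\<lambda>z. a) x a"
  by (rule regular_valueI[where P = "\<lambda>z. a" and Q = "\<lambda>z. 1"]) (auto intro: poly_fun.intros)

lemma regular_value_coord:
  "x \<in> H \<Longrightarrow> H \<inter> U \<noteq> {} \<Longrightarrow> i \<in> {1..n} \<Longrightarrow> regular_value n H U (\<lambda>z. z i) x (x i)"
  by (rule regular_valueI[where P = "\<lambda>z. z i" and Q = "\<lambda>z. 1"]) (auto intro: poly_fun.intros)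

lemma regular_value_base: "regular_value n H U f x a \<Longrightarrow> x \<in> H" "regular_value n H U f x a \<Longrightarrow> H \<inter> U \<noteq> {}"
  by (auto simp: regular_value_def)

context
  fixes n H U f g x a b
  assumes f: "regular_value n H U f x a" and g: "regular_value n H U g x b"
begin

lemma regular_value_add: "regular_value n H U (\<lambda>z. f z + g z) x (a + b)"
  and regular_value_mult: "regular_value n H U (\<lambda>z. f z * g z) x (a * b)"
  and regular_value_divide: "b \<noteq> 0 \<Longrightarrow> (\<And>z. z \<in> H \<inter> U \<Longrightarrow> q z * g z = f z) \<Longrightarrow> regular_value n H U q x (a / b)"
proof -
  obtain P Q where P: "poly_fun n P" "poly_fun n Q" "Q x \<noteq> 0" "\<forall>z\<in>H \<inter> U. f z * Q z = P z" "P x / Q x = a"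
    using f by (rule regular_valueE)
  obtain P' Q' where P': "poly_fun n P'" "poly_fun n Q'" "Q' x \<noteq> 0" "\<forall>z\<in>H \<inter> U. g z * Q' z = P' z" "P' x / Q' x = b"
    using g by (rule regular_valueE)
  note fP = bspec[OF P(4), symmetric] and gP = bspec[OF P'(4), symmetric]
  note I = regular_valueI[OF regular_value_base[OF f]]
  show "regular_value n H U (\<lambda>z. f z + g z) x (a + b)"
  proof (rule I[where P = "\<lambda>z. P z * Q' z + P' z * Q z" and Q = "\<lambda>z. Q z * Q' z"])
    show "(f z + g z) * (Q z * Q' z) = P z * Q' z + P' z * Q z" if "z \<in> H \<inter> U" for z
      unfolding fP[OF that] gP[OF that] by (simp add: algebra_simps)
  qed (use P(1-3,5) P'(1-3,5) in \<open>auto intro: poly_fun.intros simp: field_simps\<close>)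
  show "regular_value n H U (\<lambda>z. f z * g z) x (a * b)"
  proof (rule I[where P = "\<lambda>z. P z * P' z" and Q = "\<lambda>z. Q z * Q' z"])
    show "(f z * g z) * (Q z * Q' z) = P z * P' z" if "z \<in> H \<inter> U" for z
      unfolding fP[OF that] gP[OF that] by (simp add: algebra_simps)
  qed (use P(1-3,5) P'(1-3,5) in \<open>auto intro: poly_fun.intros\<close>)
  assume b: "b \<noteq> 0" and q: "\<And>z. z \<in> H \<inter> U \<Longrightarrow> q z * g z = f z"
  show "regular_value n H U q x (a / b)"
  proof (rule I[where P = "\<lambda>z. P z * Q' z" and Q = "\<lambda>z. P' z * Q z"])
    show "q z * (P' z * Q z) = P z * Q' z" if "z \<in> H \<inter> U" for z
      unfolding fP[OF that] gP[OF that] q[OF that, symmetric] by (simp add: algebra_simps)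
  qed (use P(1-3,5) P'(1-3,5) b in \<open>auto intro: poly_fun.intros simp: field_simps\<close>)
qed

end

lemma regular_value_cong:
  "regular_value n H U f x a \<Longrightarrow> (\<And>z. z \<in> H \<inter> U \<Longrightarrow> f z = g z) \<Longrightarrow> regular_value n H U g x a"
  unfolding regular_value_def by (elim conjE exE, intro conjI exI) auto

lemma regular_value_subst:
  assumes "regular_value n H' U' f x a"
    and "\<And>P. poly_fun n P \<Longrightarrow> poly_fun n (\<lambda>z. P (\<phi> z))" "\<phi> x = x"
    and "\<And>z. z \<in> H \<inter> U \<Longrightarrow> \<phi> z \<in> H' \<inter> U'" "x \<in> H" "H \<inter> U \<noteq> {}"
  shows "regular_value n H U (\<lambda>z. f (\<phi> z)) x a"
  using assms(1)
proof (rule regular_valueE)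
  fix P Q assume "poly_fun n P" "poly_fun n Q" "Q x \<noteq> 0" "\<forall>z\<in>H' \<inter> U'. f z * Q z = P z" "P x / Q x = a"
  then show ?thesis using assms
    by (intro regular_valueI[where P = "\<lambda>z. P (\<phi> z)" and Q = "\<lambda>z. Q (\<phi> z)"]) auto
qed

lemma poly_fun_tendsto:
  assumes "poly_fun n P" "\<And>i. i \<in> {1..n} \<Longrightarrow> (\<lambda>N. Z N i) \<longlonglongrightarrow> x i"
  shows "(\<lambda>N. P (Z N)) \<longlonglongrightarrow> P x"
  using assms(1) by induction (auto intro: tendsto_intros assms(2))

lemma regular_value_tendsto:
  assumes "regular_value n H U f x a" "\<And>i. i \<in> {1..n} \<Longrightarrow> (\<lambda>N. Z N i) \<longlonglongrightarrow> x i"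
    and "\<And>N. Z N \<in> H \<inter> U"
  shows "(\<lambda>N. f (Z N)) \<longlonglongrightarrow> a"
proof -
  obtain P Q where *: "poly_fun n P" "poly_fun n Q" "Q x \<noteq> 0" "\<forall>z\<in>H \<inter> U. f z * Q z = P z" "P x / Q x = a"
    using assms(1) by (rule regular_valueE)
  have Q: "(\<lambda>N. Q (Z N)) \<longlonglongrightarrow> Q x" and P: "(\<lambda>N. P (Z N)) \<longlonglongrightarrow> P x"
    using poly_fun_tendsto assms(2) * by blast+
  have "(\<lambda>N. P (Z N) / Q (Z N)) \<longlonglongrightarrow> a"
    using tendsto_divide[OF P Q *(3)] *(5) by simp
  moreover have "eventually (\<lambda>N. Q (Z N) \<noteq> 0) sequentially"
    using tendsto_imp_eventually_ne[OF Q *(3)] .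
  then have "eventually (\<lambda>N. P (Z N) / Q (Z N) = f (Z N)) sequentially"
    by eventually_elim (use * assms(3) in \<open>metis nonzero_mult_div_cancel_right\<close>)
  ultimately show ?thesis by (rule Lim_transform_eventually)
qed

section \<open>The hook space of a standard sequence\<close>

text \<open>The principal hook of \<open>(d, d)\<close> consists of the boxes where this value is
  \<open>d\<close>.\<close>

definition hook_ix :: "nat \<times> nat \<Rightarrow> nat" where "hook_ix q = min (fst q) (snd q)"

text \<open>A diagonal meets each principal hook at most once. Hence boxes of equal content have
  independent coordinates in the hook space.\<close>

lemma box_eqI: "box_content p = box_content q \<Longrightarrow> hook_ix p = hook_ix q \<Longrightarrow> p = q"
  by (cases p; cases q) (auto simp: box_content_def hook_ix_def min_def split: if_splits)

context blocks
begin

definition hsp :: "nat \<Rightarrow> (nat \<Rightarrow> nat \<times> nat) \<Rightarrow> (nat \<Rightarrow> complex) set" where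
  "hsp n p = {z \<in> affine_space n. \<forall>i\<in>{1..n}. \<forall>j\<in>{1..n}. J i j \<and> hook_ix (p i) = hook_ix (p j) \<longrightarrow> z i = z j}"

definition shf :: "(nat \<Rightarrow> nat \<times> nat) \<Rightarrow> (nat \<Rightarrow> complex) \<Rightarrow> nat \<Rightarrow> complex" where
  "shf p z k = z k + of_int (box_content (p k))"

definition udom :: "nat \<Rightarrow> (nat \<Rightarrow> nat \<times> nat) \<Rightarrow> (nat \<Rightarrow> complex) set" where
  "udom n p = {z. gen (shf p z) n}"

end

locale fusion = blocks r for r +
  fixes n :: nat and x :: "nat \<Rightarrow> complex" and p :: "nat \<Rightarrow> nat \<times> nat"
  assumes std: "std_seq n p" and x: "x \<in> diagonal_line n"
begin

abbreviation "c k \<equiv> box_content (p k)"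
abbreviation "H \<equiv> hsp n p"
abbreviation "U \<equiv> udom n p"

lemma x_const: "i \<in> {1..n} \<Longrightarrow> j \<in> {1..n} \<Longrightarrow> x i = x j"
  using x unfolding diagonal_line_def by blast

lemma x_H: "x \<in> H"
  using x unfolding hsp_def diagonal_line_def by blast

text \<open>The shifts depend only on the hook, so the point stays in the hook space. The sum in the
  denominator keeps every shift below 1, so that shifts cannot bridge the integer distance between
  different contents.\<close>

definition approx :: "nat \<Rightarrow> nat \<Rightarrow> complex" where
  "approx N = (\<lambda>k\<in>{1..n}. x k + of_nat (hook_ix (p k)) * inverse (of_nat (Suc N + (\<Sum>k\<in>{1..n}. hook_ix (p k)))))"

lemma approx_in: "approx N \<in> H \<inter> U"
proof
  show "approx N \<in> H"
    unfolding hsp_def affine_space_def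
  proof (intro CollectI conjI ballI impI)
    fix i j assume "i \<in> {1..n}" "j \<in> {1..n}" "J i j \<and> hook_ix (p i) = hook_ix (p j)"
    then show "approx N i = approx N j" using x_const[of i j] by (simp add: approx_def)
  qed (simp add: approx_def)
  let ?M = "Suc N + (\<Sum>k\<in>{1..n}. hook_ix (p k))"
  have le: "hook_ix (p k) < ?M" if "k \<in> {1..n}" for k
    using member_le_sum[of k "{1..n}" "\<lambda>k. hook_ix (p k)"] that by auto
  show "approx N \<in> U"
    unfolding udom_def gen_def mem_Collect_eq
  proof (intro allI impI)
    fix i j assume ij: "1 \<le> i \<and> i < j \<and> j \<le> n \<and> J i j"
    then have m: "i \<in> {1..n}" "j \<in> {1..n}" by auto
    show "shf p (approx N) i \<noteq> shf p (approx N) j"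
    proof
      assume "shf p (approx N) i = shf p (approx N) j"
      then have "of_int ((c i - c j) * int ?M) = (of_int (int (hook_ix (p j)) - int (hook_ix (p i))) :: complex)"
        using m x_const[OF m] by (simp add: shf_def approx_def field_simps del: of_nat_Suc of_nat_add)
      then have e: "(c i - c j) * int ?M = int (hook_ix (p j)) - int (hook_ix (p i))"
        by (simp only: of_int_eq_iff)
      have "c i = c j"
      proof (rule ccontr)
        assume "c i \<noteq> c j"
        then have "1 * int ?M \<le> \<bar>c i - c j\<bar> * int ?M"
          by (intro mult_right_mono[OF _ of_nat_0_le_iff]) linarith
        also have "\<dots> = \<bar>int (hook_ix (p j)) - int (hook_ix (p i))\<bar>"
          by (metis e abs_mult abs_of_nat)
        finally have "1 * int ?M \<le> \<bar>int (hook_ix (p j)) - int (hook_ix (p i))\<bar>" .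
        moreover have "int (hook_ix (p i)) < int ?M" "int (hook_ix (p j)) < int ?M"
          using le[OF m(1)] le[OF m(2)] by (simp_all only: of_nat_less_iff)
        moreover have "\<not> 1 * a \<le> \<bar>b - d\<bar>" if "d < a" "b < a" "0 \<le> b" "0 \<le> d" for a b d :: int
          using that by linarith
        ultimately show False using of_nat_0_le_iff by metis
      qed
      moreover from this e have "hook_ix (p i) = hook_ix (p j)" by simp
      ultimately have "p i = p j" by (rule box_eqI)
      then have "i = j" using std_inj[OF std m] ij by blast
      then show False using ij by simp
    qed
  qed
qed

lemma approx_tendsto:
  assumes "i \<in> {1..n}"
  shows "(\<lambda>N. approx N i) \<longlonglongrightarrow> x i"
proof -
  let ?S = "\<Sum>k\<in>{1..n}. hook_ix (p k)"
  have "(\<lambda>N. inverse (of_nat (N + Suc ?S)) :: complex) \<longlonglongrightarrow> 0"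
    by (rule LIMSEQ_ignore_initial_segment[OF lim_inverse_n])
  then have "(\<lambda>N. x i + of_nat (hook_ix (p i)) * inverse (of_nat (Suc N + ?S))) \<longlonglongrightarrow> x i + of_nat (hook_ix (p i)) * 0"
    by (intro tendsto_intros) (simp add: add.commute)
  then show ?thesis using assms by (simp add: approx_def)
qed

abbreviation "rv f a \<equiv> regular_value n H U f x a"

text \<open>Both values are limits of the same sequence along \<open>approx\<close>.\<close>

lemma rv_unique:
  assumes "rv f a" "rv g b" "\<And>z. z \<in> H \<inter> U \<Longrightarrow> f z = g z"
  shows "a = b"
proof -
  have "(\<lambda>N. f (approx N)) \<longlonglongrightarrow> a" "(\<lambda>N. g (approx N)) \<longlonglongrightarrow> b"
    using regular_value_tendsto assms(1,2) approx_tendsto approx_in by blast+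
  moreover have "(\<lambda>N. f (approx N)) = (\<lambda>N. g (approx N))" using assms(3) approx_in by blast
  ultimately show ?thesis using LIMSEQ_unique by metis
qed

lemma HU_ne: "H \<inter> U \<noteq> {}" using approx_in by blast

sublocale rvl: glim r n "\<lambda>f a. regular_value n (hsp n p) (udom n p) f x a"
  by unfold_locales
    (auto intro: regular_value_const[OF x_H HU_ne] regular_value_add regular_value_mult)

lemma rv_inverse_diff:
  assumes "i \<in> {1..n}" "j \<in> {1..n}" "J i j" "i \<noteq> j" "c i \<noteq> c j"
  shows "rv (\<lambda>z. 1 / (shf p z i - shf p z j)) (1 / (shf p x i - shf p x j))"
proof (rule regular_value_divide)
  show "rv (\<lambda>z. 1) 1" by (rule regular_value_const[OF x_H HU_ne])
  have "rv (\<lambda>z. (z i + of_int (c i)) + (- 1) * (z j + of_int (c j)))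
    ((x i + of_int (c i)) + (- 1) * (x j + of_int (c j)))"
    using assms by (intro regular_value_add regular_value_mult regular_value_const[OF x_H HU_ne]
      regular_value_coord[OF x_H HU_ne])
  moreover have "shf p z i - shf p z j = (z i + of_int (c i)) + (- 1) * (z j + of_int (c j))" for z
    by (simp add: shf_def)
  ultimately show "rv (\<lambda>z. shf p z i - shf p z j) (shf p x i - shf p x j)"
    by simp
  show "shf p x i - shf p x j \<noteq> 0" using x_const[OF assms(1,2)] assms(5) by (simp add: shf_def)
  fix z assume "z \<in> H \<inter> U"
  then have "gen (shf p z) n" by (simp add: udom_def)
  then have "shf p z i \<noteq> shf p z j"
    using assms J_sym[OF assms(3)] unfolding gen_def atLeastAtMost_iff by (metis nat_neq_iff)
  then show "1 / (shf p z i - shf p z j) * (shf p z i - shf p z j) = 1" by simp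
qed

lemma GL_unique:
  assumes "rvl.GL \<Phi> A" "rvl.GL \<Psi> B" "\<And>z. z \<in> H \<inter> U \<Longrightarrow> \<Phi> z = \<Psi> z"
  shows "A = B"
  by (rule poly_mapping_eqI, rule rv_unique[where f = "\<lambda>z. lookup (\<Phi> z) _" and g = "\<lambda>z. lookup (\<Psi> z) _"])
    (use assms in \<open>auto simp: rvl.GL_def\<close>)

lemma GL_tau: "rvl.GL (\<lambda>z. Ph (shf p z) m) E \<Longrightarrow> tau E = 1"
proof (rule rv_unique)
  assume "rvl.GL (\<lambda>z. Ph (shf p z) m) E"
  then show "rv (\<lambda>z. lookup (Ph (shf p z) m) 0) (tau E)" by (simp add: rvl.GL_def tau_def)
  show "rv (\<lambda>z. 1) 1" by (rule regular_value_const[OF x_H HU_ne])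
  show "lookup (Ph (shf p z) m) 0 = 1" for z using tau_Ph[of "shf p z" m] by (simp only: tau_def)
qed

lemma GL_tr:
  assumes E: "rvl.GL (\<lambda>z. Ph (shf p z) m) E" "m \<le> n"
  shows "tr E = E"
proof (rule poly_mapping_eqI)
  fix g
  have "lookup E (- g) = lookup E g"
  proof (rule rv_unique)
    show "rv (\<lambda>z. lookup (Ph (shf p z) m) (- g)) (lookup E (- g))"
      "rv (\<lambda>z. lookup (Ph (shf p z) m) g) (lookup E g)"
      using E by (simp_all add: rvl.GL_def)
    fix z assume "z \<in> H \<inter> U"
    then have "gen (shf p z) m" using gen_mono E(2) by (auto simp: udom_def)
    from tr_Ph[OF this] show "lookup (Ph (shf p z) m) (- g) = lookup (Ph (shf p z) m) g"
      by (metis tr_simps(1))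
  qed
  then show "lookup (tr E) g = lookup E g" by simp
qed

end

section \<open>Reading a diagram hook by hook\<close>

text \<open>The position in the reading order. With \<open>N\<close> above all coordinates, an arm
  uses offsets below \<open>N\<close> and a leg offsets between \<open>N\<close> and
  \<open>2 * N\<close>, so each hook fits into one period of length \<open>2 * N\<close>.\<close>

definition key :: "nat \<Rightarrow> nat \<times> nat \<Rightarrow> nat" where
  "key N q = hook_ix q * (2 * N) + (if fst q \<le> snd q then snd q - fst q else N + (fst q - snd q))"

lemma key_less_hook:
  assumes "hook_ix p < hook_ix q" "fst p < N" "snd p < N"
  shows "key N p < key N q"
proof -
  have "key N p < hook_ix p * (2 * N) + 2 * N"
    using assms(2,3) by (auto simp: key_def)
  also have "\<dots> = Suc (hook_ix p) * (2 * N)" by simp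
  also have "\<dots> \<le> hook_ix q * (2 * N)" using assms(1) by (intro mult_le_mono1) simp
  also have "\<dots> \<le> key N q" by (simp add: key_def)
  finally show ?thesis .
qed

text \<open>The reading order refines the box order; therefore adjacent entries in the wrong order
  occupy boxes that may be exchanged.\<close>

lemma key_less:
  assumes "box_le p q" "p \<noteq> q" "fst p < N" "snd p < N" "fst q < N" "snd q < N"
  shows "key N p < key N q"
proof (cases "hook_ix p = hook_ix q")
  case True
  then show ?thesis using assms
    by (cases p; cases q) (auto simp: key_def box_le_def hook_ix_def min_def split: if_splits)
next
  case False
  then have "hook_ix p < hook_ix q" using assms(1) by (auto simp: box_le_def hook_ix_def min_def split: if_splits)
  then show ?thesis using assms by (intro key_less_hook)
qed

lemma key_inj:
  assumes "key N p = key N q" "fst p < N" "snd p < N" "fst q < N" "snd q < N"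
  shows "p = q"
proof -
  have h: "hook_ix p = hook_ix q"
    using key_less_hook[of p q N] key_less_hook[of q p N] assms by (cases "hook_ix p" "hook_ix q" rule: linorder_cases) auto
  then show ?thesis using assms
    by (cases p; cases q) (auto simp: key_def hook_ix_def min_def split: if_splits)
qed

lemma eventually_avoid:
  fixes a :: complex
  assumes "finite S"
  shows "eventually (\<lambda>w. w \<notin> S) (at a)"
proof -
  have "eventually (\<lambda>w. \<forall>s\<in>S. w \<noteq> s) (at a)"
    using assms by (intro eventually_ball_finite) (auto intro: eventually_neq_at_within)
  then show ?thesis by eventually_elim auto
qed

context blocks
begin

lemma Kl_cong:
  assumes "\<And>i j. 1 \<le> i \<Longrightarrow> i \<le> m \<Longrightarrow> 1 \<le> j \<Longrightarrow> j \<le> m \<Longrightarrow> u i - u j = u' i - u' j"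
  shows "j < m \<Longrightarrow> Kl c u m j = Kl c u' m j"
proof (induction j)
  case (Suc j)
  have "u (Suc j) - u m = u' (Suc j) - u' m" "u (Suc (Suc j)) - u m = u' (Suc (Suc j)) - u' m"
    by (rule assms; use Suc.prems in simp)+
  then have "kf c u m (Suc j) = kf c u' m (Suc j)" by (simp add: kf_def R_def)
  with Suc show ?case by simp
qed simp

end

section \<open>Counting neighbouring boxes and fusion in the hook order\<close>

context fusion
begin

text \<open>The neighbour lies weakly above and to the left of the last box and differs from it, so
  it carries an earlier entry; distinct boxes have distinct neighbours.\<close>

lemma nbr_card:
  assumes M: "Suc m \<le> n"
    and S: "S \<subseteq> {j\<in>{1..Suc m}. J j (Suc m)}" and inj: "inj_on nb (p ` S)"
    and nb: "\<And>j. j \<in> S \<Longrightarrow> 1 \<le> fst (nb (p j)) \<and> 1 \<le> snd (nb (p j)) \<and>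
      box_le (nb (p j)) (p (Suc m)) \<and> nb (p j) \<noteq> p (Suc m) \<and> box_content (nb (p j)) = d"
  shows "card S \<le> card {i\<in>{1..m}. J i (Suc m) \<and> c i = d}"
proof -
  have "\<exists>i. i \<in> {1..m} \<and> J i (Suc m) \<and> p i = nb (p j)" if j: "j \<in> S" for j
  proof -
    obtain i where i: "1 \<le> i" "i \<le> Suc m" "J i (Suc m)" "p i = nb (p j)"
      by (rule std_box[OF std, of "Suc m" "nb (p j)"]) (use nb[OF j] M in auto)
    moreover have "i \<noteq> Suc m" using i(4) nb[OF j] by auto
    ultimately show ?thesis by (intro exI[of _ i]) auto
  qed
  then obtain \<phi> where \<phi>: "\<And>j. j \<in> S \<Longrightarrow> \<phi> j \<in> {1..m} \<and> J (\<phi> j) (Suc m) \<and> p (\<phi> j) = nb (p j)"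
    by metis
  show ?thesis
  proof (rule card_inj_on_le)
    show "inj_on \<phi> S"
    proof (rule inj_onI)
      fix i j assume ij: "i \<in> S" "j \<in> S" "\<phi> i = \<phi> j"
      then have "nb (p i) = nb (p j)" using \<phi> by metis
      then have "p i = p j" using inj ij by (auto dest: inj_onD)
      then show "i = j" by (rule std_inj[OF std, rotated 3]) (use S ij M in \<open>auto simp: J_def\<close>)
    qed
    show "\<phi> ` S \<subseteq> {i\<in>{1..m}. J i (Suc m) \<and> c i = d}" using \<phi> nb by auto
  qed simp
qed

lemma same_content:
  assumes "Suc m \<le> n" "j \<in> {1..m}" "J j (Suc m)" "c j = c (Suc m)"
  shows "fst (p j) < fst (p (Suc m))" "snd (p j) < snd (p (Suc m))"
proof -
  have "\<not> box_le (p (Suc m)) (p j)"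
    using std_le[OF std, of "Suc m" j] assms by (auto simp: J_def)
  then show "fst (p j) < fst (p (Suc m))" "snd (p j) < snd (p (Suc m))"
    using assms(4) by (auto simp: box_le_def box_content_def)
qed

text \<open>This count makes \<open>w * beta w\<close> vanish at the content of the last box, where each box of the
  same content contributes a double pole and each box of neighbouring content a simple zero.\<close>

lemma nbr_count:
  assumes M: "Suc m \<le> n"
  defines "K \<equiv> {j\<in>{1..m}. J j (Suc m) \<and> c j = c (Suc m)}"
    and "B \<equiv> {j\<in>{1..m}. J j (Suc m) \<and> \<bar>c j - c (Suc m)\<bar> = 1}"
  shows "2 * card K + 1 \<le> card B + (if c (Suc m) = 0 then 1 else 0)"
proof -
  let ?M = "Suc m" and ?d = "c (Suc m)"
  let ?B1 = "{i\<in>{1..m}. J i ?M \<and> c i = ?d + 1}" and ?B2 = "{i\<in>{1..m}. J i ?M \<and> c i = ?d - 1}"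
  have "B = ?B1 \<union> ?B2" by (auto simp: B_def abs_if split: if_splits)
  then have cB: "card B = card ?B1 + card ?B2"
    by (simp only:) (rule card_Un_disjoint; auto)
  have pos: "1 \<le> fst (p k) \<and> 1 \<le> snd (p k)" if "k \<in> {1..?M}" for k
    using std_pos[OF std, of k] that M by auto
  have K: "j \<in> K \<Longrightarrow> j \<in> {1..?M} \<and> J j ?M \<and> fst (p j) < fst (p ?M) \<and> snd (p j) < snd (p ?M) \<and> c j = ?d" for j
    using same_content[OF M, of j] by (auto simp: K_def)
  have Ks: "K \<subseteq> {j\<in>{1..?M}. J j ?M}" using K by blast
  have fK: "finite K" "?M \<notin> K" by (auto simp: K_def)
  \<comment> \<open>Boxes in \<open>K\<close> are strictly above and to the left of the last box, so
    their right and lower neighbours are already filled.\<close>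
  let ?ri = "\<lambda>q :: nat \<times> nat. (fst q, Suc (snd q))" and ?lo = "\<lambda>q :: nat \<times> nat. (Suc (fst q), snd q)"
  have bc: "box_content (?ri q) = box_content q + 1" "box_content (?lo q) = box_content q - 1" for q
    by (auto simp: box_content_def)
  have r1: "card K \<le> card ?B1"
  proof (rule nbr_card[OF M Ks, of ?ri])
    show "inj_on ?ri (p ` K)" by (auto simp: inj_on_def prod_eq_iff)
    fix j assume "j \<in> K"
    from K[OF this] pos[of j] show "1 \<le> fst (?ri (p j)) \<and> 1 \<le> snd (?ri (p j)) \<and>
      box_le (?ri (p j)) (p ?M) \<and> ?ri (p j) \<noteq> p ?M \<and> box_content (?ri (p j)) = ?d + 1"
      by (auto simp: bc box_le_def prod_eq_iff)
  qed
  have l1: "card K \<le> card ?B2"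
  proof (rule nbr_card[OF M Ks, of ?lo])
    show "inj_on ?lo (p ` K)" by (auto simp: inj_on_def prod_eq_iff)
    fix j assume "j \<in> K"
    from K[OF this] pos[of j] show "1 \<le> fst (?lo (p j)) \<and> 1 \<le> snd (?lo (p j)) \<and>
      box_le (?lo (p j)) (p ?M) \<and> ?lo (p j) \<noteq> p ?M \<and> box_content (?lo (p j)) = ?d - 1"
      by (auto simp: bc box_le_def prod_eq_iff)
  qed
  \<comment> \<open>The extra 1 of the count: off the main diagonal the last box, too, has an
    earlier neighbour, to the left for positive and above for negative content.\<close>
  let ?K' = "insert ?M K"
  have K': "?K' \<subseteq> {j\<in>{1..?M}. J j ?M}" using Ks by auto
  have cK': "card ?K' = card K + 1" using fK by simp
  have K'2: "j \<in> ?K' \<Longrightarrow> 1 \<le> fst (p j) \<and> 1 \<le> snd (p j) \<and> box_le (p j) (p ?M) \<and> c j = ?d" for j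
    using K[of j] pos[of j] pos[of ?M] by (auto simp: box_le_def)
  consider "?d = 0" | "?d > 0" | "?d < 0" by linarith
  then show ?thesis
  proof cases
    case 1
    then show ?thesis using r1 l1 cB by simp
  next
    case 2
    then have s2: "j \<in> ?K' \<Longrightarrow> 2 \<le> snd (p j)" for j using K'2[of j] by (auto simp: box_content_def)
    let ?le = "\<lambda>q :: nat \<times> nat. (fst q, snd q - 1)"
    have "card ?K' \<le> card ?B2"
    proof (rule nbr_card[OF M K', of ?le])
      show "inj_on ?le (p ` ?K')"
      proof (rule inj_onI)
        fix q q' assume a: "q \<in> p ` ?K'" "q' \<in> p ` ?K'" "?le q = ?le q'"
        then have "2 \<le> snd q" "2 \<le> snd q'" using s2 by blast+
        then show "q = q'" using a(3) by (auto simp: prod_eq_iff)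
      qed
      fix j assume j: "j \<in> ?K'"
      from K'2[OF j] s2[OF j] show "1 \<le> fst (?le (p j)) \<and> 1 \<le> snd (?le (p j)) \<and>
        box_le (?le (p j)) (p ?M) \<and> ?le (p j) \<noteq> p ?M \<and> box_content (?le (p j)) = ?d - 1"
        by (auto simp: box_content_def box_le_def prod_eq_iff)
    qed
    then show ?thesis using r1 cB cK' 2 by simp
  next
    case 3
    then have s2: "j \<in> ?K' \<Longrightarrow> 2 \<le> fst (p j)" for j using K'2[of j] by (auto simp: box_content_def)
    let ?up = "\<lambda>q :: nat \<times> nat. (fst q - 1, snd q)"
    have "card ?K' \<le> card ?B1"
    proof (rule nbr_card[OF M K', of ?up])
      show "inj_on ?up (p ` ?K')"
      proof (rule inj_onI)
        fix q q' assume a: "q \<in> p ` ?K'" "q' \<in> p ` ?K'" "?up q = ?up q'"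
        then have "2 \<le> fst q" "2 \<le> fst q'" using s2 by blast+
        then show "q = q'" using a(3) by (auto simp: prod_eq_iff)
      qed
      fix j assume j: "j \<in> ?K'"
      from K'2[OF j] s2[OF j] show "1 \<le> fst (?up (p j)) \<and> 1 \<le> snd (?up (p j)) \<and>
        box_le (?up (p j)) (p ?M) \<and> ?up (p j) \<noteq> p ?M \<and> box_content (?up (p j)) = ?d + 1"
        by (auto simp: box_content_def box_le_def prod_eq_iff)
    qed
    then show ?thesis using l1 cB cK' 3 by simp
  qed
qed

text \<open>A line of parameters on which \<open>X_Tl\<close> applies: all but the last are already
  at their contents.\<close>

definition vv :: "nat \<Rightarrow> complex \<Rightarrow> nat \<Rightarrow> complex" where
  "vv m w k = (if k = Suc m then w else of_int (c k))"

lemma beta_tendsto: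
  assumes M: "Suc m \<le> n"
  shows "((\<lambda>w. w * beta (vv m w) (Suc m) m) \<longlongrightarrow> 0) (at (of_int (c (Suc m))))"
proof -
  define C where "C = complex_of_int (c (Suc m))"
  define a where "a j = complex_of_int (c j)" for j
  define S K B where "S = {j\<in>{1..m}. J j (Suc m)}"
    and "K = {j\<in>{1..m}. J j (Suc m) \<and> c j = c (Suc m)}"
    and "B = {j\<in>{1..m}. J j (Suc m) \<and> \<bar>c j - c (Suc m)\<bar> = 1}"
  define f where "f j w = 1 - (1 / (a j - w))\<^sup>2" for j w
  \<comment> \<open>For neighbouring contents this is \<open>f j\<close> divided by its zero
    \<open>t = w - C\<close>: with \<open>e = a j - C\<close> and \<open>e * e = 1\<close> one has
    \<open>(e - t)^2 - 1 = t (t - 2 e)\<close>.\<close>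
  define g where "g j w = (w - C - 2 * (a j - C)) / (a j - w)\<^sup>2" for j w
  define G where "G w = (\<Prod>j\<in>S - K - B. f j w) * (\<Prod>j\<in>K. (w - C)\<^sup>2 - 1) * (\<Prod>j\<in>B. g j w)" for w
  have fin: "finite S" "finite K" "finite B" and sub: "K \<subseteq> S" "B \<subseteq> S - K"
    by (auto simp: S_def K_def B_def)
  have cnt: "2 * card K + 1 \<le> card B + (if c (Suc m) = 0 then 1 else 0)"
    using nbr_count[OF M] by (simp add: K_def B_def)
  have ne: "a j \<noteq> C" if "j \<in> S - K" for j using that by (auto simp: S_def K_def a_def C_def)
  have "((\<lambda>w. \<Prod>j\<in>S - K - B. f j w) \<longlongrightarrow> (\<Prod>j\<in>S - K - B. f j C)) (at C)"
    unfolding f_def by (intro tendsto_intros) (use ne in auto)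
  moreover have "((\<lambda>w. \<Prod>j\<in>K. (w - C)\<^sup>2 - 1) \<longlongrightarrow> (\<Prod>j\<in>K. (C - C)\<^sup>2 - 1)) (at C)"
    by (intro tendsto_intros)
  moreover have "((\<lambda>w. \<Prod>j\<in>B. g j w) \<longlongrightarrow> (\<Prod>j\<in>B. g j C)) (at C)"
    unfolding g_def by (intro tendsto_intros) (use ne sub in auto)
  ultimately obtain l where l: "(G \<longlongrightarrow> l) (at C)"
    unfolding G_def using tendsto_mult by blast
  \<comment> \<open>The order of the zero that survives the double poles. The count makes it
    positive unless \<open>C = 0\<close>, and then the factor \<open>w\<close> vanishes
    instead.\<close>
  define b where "b = card B - 2 * card K"
  have bb: "card B = b + 2 * card K" and b0: "C \<noteq> 0 \<Longrightarrow> 0 < b"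
    using cnt by (auto simp: b_def C_def split: if_splits)
  have eq: "w * beta (vv m w) (Suc m) m = w * (w - C) ^ b * G w" if w: "w \<noteq> C" "w \<notin> a ` S" for w
  proof -
    let ?t = "w - C"
    have t: "?t \<noteq> 0" using w by simp
    have "beta (vv m w) (Suc m) m = (\<Prod>j\<in>S. f j w)"
      unfolding beta_def S_def by (rule prod.cong) (auto simp: vv_def f_def a_def)
    also have "\<dots> = (\<Prod>j\<in>S - K. f j w) * (\<Prod>j\<in>K. f j w)"
      using sub(1) fin by (simp add: prod.subset_diff)
    also have "(\<Prod>j\<in>S - K. f j w) = (\<Prod>j\<in>S - K - B. f j w) * (\<Prod>j\<in>B. f j w)"
      using sub(2) fin by (simp add: prod.subset_diff)
    also have "(\<Prod>j\<in>B. f j w) = (\<Prod>j\<in>B. ?t * g j w)"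
    proof (rule prod.cong[OF refl])
      fix j assume j: "j \<in> B"
      define e where "e = a j - C"
      have "c j - c (Suc m) = 1 \<or> c j - c (Suc m) = -1" using j by (auto simp: B_def abs_if split: if_splits)
      then have "e = 1 \<or> e = -1" unfolding e_def a_def C_def
        by (metis of_int_1 of_int_diff of_int_minus)
      then have e: "e * e = 1" by auto
      have aw: "a j - w \<noteq> 0" using w(2) j sub by auto
      have "(a j - w)\<^sup>2 - 1 = ?t * (?t - 2 * e)"
      proof -
        have "a j - w = e - ?t" by (simp add: e_def)
        then show ?thesis using e by (simp add: power2_eq_square algebra_simps)
      qed
      moreover have "f j w = ((a j - w)\<^sup>2 - 1) / (a j - w)\<^sup>2"
        using aw by (simp add: f_def power_divide diff_divide_distrib)
      ultimately show "f j w = ?t * g j w" by (simp add: g_def e_def)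
    qed
    also have "\<dots> = ?t ^ card B * (\<Prod>j\<in>B. g j w)" by (simp add: prod.distrib)
    also have "(\<Prod>j\<in>K. f j w) = (\<Prod>j\<in>K. (?t\<^sup>2 - 1) / ?t\<^sup>2)"
    proof (rule prod.cong[OF refl])
      fix j assume "j \<in> K"
      then have "a j = C" by (simp add: K_def a_def C_def)
      then have "f j w = 1 - 1 / ?t\<^sup>2" by (simp add: f_def power_divide power2_commute)
      then show "f j w = (?t\<^sup>2 - 1) / ?t\<^sup>2" using t by (simp add: diff_divide_distrib)
    qed
    also have "\<dots> = (\<Prod>j\<in>K. ?t\<^sup>2 - 1) / ?t ^ (2 * card K)"
      by (simp add: prod_dividef power_mult power_divide)
    finally show ?thesis using t unfolding G_def bb by (simp add: power_add field_simps)
  qed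
  have "((\<lambda>w. w * (w - C) ^ b * G w) \<longlongrightarrow> C * (C - C) ^ b * l) (at C)"
    by (intro tendsto_intros l)
  moreover have z: "C * (C - C) ^ b * l = 0" using b0 by (cases "C = 0") auto
  ultimately have "((\<lambda>w. w * (w - C) ^ b * G w) \<longlongrightarrow> 0) (at C)" by (simp only: z)
  moreover have "eventually (\<lambda>w. w \<notin> insert C (a ` S)) (at C)"
    by (rule eventually_avoid) (use fin in auto)
  then have "eventually (\<lambda>w. w * (w - C) ^ b * G w = w * beta (vv m w) (Suc m) m) (at C)"
    by eventually_elim (rule eq[symmetric], auto)
  ultimately show ?thesis unfolding C_def by (rule Lim_transform_eventually)
qed

lemma GL_cong:
  assumes "rvl.GL \<Phi> A" "\<And>z. z \<in> H \<inter> U \<Longrightarrow> \<Phi> z = \<Psi> z" "\<And>z. \<Psi> z \<in> alg n"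
  shows "rvl.GL \<Psi> A"
  using assms unfolding rvl.GL_def
  by (auto intro: regular_value_cong[where f = "\<lambda>z. lookup (\<Phi> z) _"])

context
  fixes N
  assumes N: "\<And>k. k \<in> {1..n} \<Longrightarrow> fst (p k) < N \<and> snd (p k) < N"
    and mono: "\<And>k. 1 \<le> k \<Longrightarrow> k < n \<Longrightarrow> J k (Suc k) \<Longrightarrow> key N (p k) \<le> key N (p (Suc k))"
begin

lemma key_strict:
  assumes "1 \<le> j" "Suc j \<le> k" "k \<le> n" "J j k"
  shows "key N (p j) < key N (p k)"
proof -
  have st: "key N (p i) < key N (p (Suc i))" if "1 \<le> i" "i < n" "J i (Suc i)" for i
  proof -
    have "p i \<noteq> p (Suc i)" using std_inj[OF std, of i "Suc i"] that by auto
    then have "key N (p i) \<noteq> key N (p (Suc i))"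
      using key_inj[of N "p i" "p (Suc i)"] N[of i] N[of "Suc i"] that by auto
    then show ?thesis using mono[OF that] by simp
  qed
  from assms(2-4) show ?thesis
  proof (induction k rule: dec_induct)
    case base
    then show ?case using st assms(1) by auto
  next
    case (step k)
    then have "key N (p j) < key N (p k)" by (auto simp: J_def)
    also have "\<dots> < key N (p (Suc k))" using st[of k] step assms(1) by (auto simp: J_def)
    finally show ?case .
  qed
qed

text \<open>The change of content along a hook in reading direction: arms run to the right, legs
  downwards.\<close>

definition eps :: "nat \<Rightarrow> int" where "eps m = (if c m \<ge> 0 then 1 else - 1)"

text \<open>The next box in the hook has a key larger by one and precedes the box of
  \<open>Suc m\<close>. No entry of the block fits between, so it carries
  \<open>Suc j\<close>.\<close>

lemma sing_mate:
  assumes s: "sing (\<lambda>k. c k) (Suc m) j" and m: "Suc m \<le> n"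
  shows "Suc j < Suc m \<and> J j (Suc j) \<and> c (Suc j) = c j + eps (Suc m) \<and> hook_ix (p (Suc j)) = hook_ix (p j)"
proof -
  have j: "1 \<le> j" "j \<le> m" "J j (Suc m)" "c j = c (Suc m)" using s by (auto simp: sing_def)
  have lt: "fst (p j) < fst (p (Suc m))" "snd (p j) < snd (p (Suc m))"
    using same_content[OF m, of j] j by auto
  define q where "q = (if c (Suc m) \<ge> 0 then (fst (p j), Suc (snd (p j))) else (Suc (fst (p j)), snd (p j)))"
  have pj: "1 \<le> fst (p j)" "1 \<le> snd (p j)" using std_pos[OF std, of j] j m by auto
  have q: "box_content q = c j + eps (Suc m)" "hook_ix q = hook_ix (p j)" "key N q = Suc (key N (p j))"
    using j(4) pj by (auto simp: q_def eps_def box_content_def hook_ix_def key_def)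
  obtain i where i: "1 \<le> i" "i \<le> Suc m" "J i (Suc m)" "p i = q"
    by (rule std_box[OF std, of "Suc m" q]) (use m pj lt in \<open>auto simp: q_def box_le_def\<close>)
  have "i \<noteq> Suc m" using i(4) lt by (auto simp: q_def split: if_splits)
  moreover have "j \<le> i"
    by (rule std_le[OF std]) (use i j m in \<open>auto simp: q_def box_le_def J_def\<close>)
  moreover have "j \<noteq> i" using i(4) q(3) by auto
  ultimately have ij: "Suc j \<le> i" "i < Suc m" using i(2) by auto
  have "i = Suc j"
  proof (rule ccontr)
    assume "i \<noteq> Suc j"
    then have k: "Suc (Suc j) \<le> i" using ij by simp
    have "key N (p j) < key N (p (Suc j))"
      by (rule key_strict) (use j m i k ij in \<open>auto simp: J_def\<close>)
    moreover have "key N (p (Suc j)) < key N (p i)"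
      by (rule key_strict) (use j m i k ij in \<open>auto simp: J_def\<close>)
    ultimately show False using q(3) i(4) by simp
  qed
  then show ?thesis using i ij q j by (auto simp: J_def)
qed

text \<open>The new tail is regular after fusion. The eigenvalue equation for its limit is proved by
  a second limit, in which only the last parameter moves and \<open>X_Tl\<close> is
  available.\<close>

lemma base_fusion:
  "m \<le> n \<Longrightarrow> \<exists>E. rvl.GL (\<lambda>z. Ph (shf p z) m) E \<and> E \<in> alg m \<and>
    (\<forall>k. 1 \<le> k \<and> k \<le> m \<longrightarrow> X k * E = sc (of_int (c k)) * E)"
proof (induction m)
  case 0
  show ?case by (intro exI[of _ 1]) (auto simp: rvl.GL_const)
next
  case (Suc m)
  let ?M = "Suc m" and ?c = "\<lambda>k. c k"
  let ?e = "complex_of_int (eps ?M)" and ?C = "complex_of_int (c ?M)"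
  obtain E where E: "rvl.GL (\<lambda>z. Ph (shf p z) m) E" "E \<in> alg m"
    and X: "\<And>k. 1 \<le> k \<Longrightarrow> k \<le> m \<Longrightarrow> X k * E = sc (of_int (c k)) * E"
    using Suc by auto
  have trE: "tr E = E" using GL_tr[OF E(1)] Suc.prems by simp
  \<comment> \<open>\<open>E\<close> is symmetric, so \<open>tr\<close> turns left eigenvalues into
    right ones, as \<open>X_Tl\<close> requires.\<close>
  have XR: "E * X k = sc (of_int (c k)) * E" if "1 \<le> k" "k \<le> m" for k
    using arg_cong[OF X[OF that], of tr] by (simp add: tr_mult trE sc_commute)
  have e: "?e = 1 \<or> ?e = - 1" by (auto simp: eps_def)
  note mate = sing_mate[OF _ Suc.prems]
  have HU: "gen (shf p z) n" "shf p z (Suc i) = shf p z i + ?e" if "z \<in> H \<inter> U" "sing ?c ?M i" for z i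
  proof -
    show "gen (shf p z) n" using that by (simp add: udom_def)
    have i: "i \<in> {1..n}" "Suc i \<in> {1..n}" using that(2) mate[OF that(2)] Suc.prems by (auto simp: sing_def)
    then have "z (Suc i) = z i"
      using that(1) mate[OF that(2)] J_sym unfolding hsp_def by auto
    then show "shf p z (Suc i) = shf p z i + ?e"
      using mate[OF that(2)] by (simp add: shf_def)
  qed
  have Ptp: "Ph (shf p z) m * tp i (Suc i) = sc ?e * Ph (shf p z) m"
    if z: "z \<in> H \<inter> U" and s: "sing ?c ?M i" for z i
    by (rule Ph_tp_eigen[OF gen_mono[OF HU(1)[OF z s]]])
      (use mate[OF s] s Suc.prems HU(2)[OF z s] e in \<open>auto simp: sing_def\<close>)
  have cS: "c (Suc i) \<noteq> c ?M" if "sing ?c ?M i" for i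
    using mate[OF that] that by (auto simp: sing_def eps_def split: if_splits)
  \<comment> \<open>The relation with \<open>tp i (Suc i)\<close> survives the limit, so the tail
    behind \<open>E\<close> can be fused in the same way.\<close>
  have Etp: "E * tp i (Suc i) = sc ?e * E" if s: "sing ?c ?M i" for i
  proof (rule GL_unique)
    have "tp i (Suc i) \<in> alg n"
      by (rule alg_tp) (use s mate[OF s] Suc.prems in \<open>auto simp: sing_def\<close>)
    then show "rvl.GL (\<lambda>z. Ph (shf p z) m * tp i (Suc i)) (E * tp i (Suc i))"
      by (intro rvl.GL_mult rvl.GL_const E)
    show "rvl.GL (\<lambda>z. sc ?e * Ph (shf p z) m) (sc ?e * E)"
      by (intro rvl.GL_mult rvl.GL_const E alg_sc)
  qed (rule Ptp[OF _ s])
  have ns: "\<not> sing ?c ?M m" using mate[of m] by auto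
  define E' where "E' = E * Kl ?c (shf p x) ?M m"
  have En: "E \<in> alg n" using E(1) by (simp add: rvl.GL_def)
  have "rvl.GL (\<lambda>z. Ph (shf p z) m * Kl ?c (shf p z) ?M m) E'"
    unfolding E'_def
  proof (intro rvl.GL_mult E rvl.GL_Kl)
    fix i assume s: "sing ?c ?M i"
    have "rv (\<lambda>z. 1 / (shf p z (Suc i) - shf p z ?M)) (1 / (shf p x (Suc i) - shf p x ?M))"
      by (rule rv_inverse_diff)
        (use s mate[OF s] Suc.prems in \<open>auto simp: sing_def J_def eps_def split: if_splits\<close>)
    then show "Suc i < ?M \<and> J i (Suc i) \<and> rv (\<lambda>z. 1 / (shf p z (Suc i) - shf p z ?M)) (1 / (shf p x (Suc i) - shf p x ?M))"
      using mate[OF s] by simp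
  next
    fix i assume "\<not> sing ?c ?M i" "1 \<le> i" "i < ?M" "J i ?M"
    then show "rv (\<lambda>z. 1 / (shf p z i - shf p z ?M)) (1 / (shf p x i - shf p x ?M))"
      using Suc.prems by (intro rv_inverse_diff) (auto simp: sing_def)
  qed (use Suc.prems in auto)
  then have GL': "rvl.GL (\<lambda>z. Ph (shf p z) ?M) E'"
  proof (rule GL_cong)
    show "Ph (shf p z) ?M \<in> alg n" for z using alg_mono[OF Suc.prems alg_Ph] .
    fix z assume z: "z \<in> H \<inter> U"
    have g: "gen (shf p z) n" using z by (simp add: udom_def)
    have "Ph (shf p z) m * Tl (shf p z) ?M m = Ph (shf p z) m * Kl ?c (shf p z) ?M m"
    proof (rule Tl_eq_Kl[where e = ?e])
      fix i assume s: "sing ?c ?M i"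
      show "Suc i < ?M \<and> J i (Suc i) \<and> c (Suc i) \<noteq> c ?M \<and> shf p z (Suc i) = shf p z i + ?e \<and>
          Ph (shf p z) m * tp i (Suc i) = sc ?e * Ph (shf p z) m"
        using mate[OF s] HU(2)[OF z s] Ptp[OF z s] cS[OF s] by blast
    next
      fix i assume "1 \<le> i" "i < ?M" "J i ?M"
      then show "shf p z i \<noteq> shf p z ?M" using genD[OF g] Suc.prems by auto
    qed (use ns in auto)
    then show "Ph (shf p z) m * Kl ?c (shf p z) ?M m = Ph (shf p z) ?M" by simp
  qed
  \<comment> \<open>This identifies the value at the diagonal with the endpoint of the one-parameter
    limit.\<close>
  have E'C: "E' = E * Kl ?c (vv m ?C) ?M m"
  proof -
    have "shf p x i - shf p x j = vv m ?C i - vv m ?C j" if "1 \<le> i" "i \<le> ?M" "1 \<le> j" "j \<le> ?M" for i j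
      using x_const[of i j] that Suc.prems by (auto simp: shf_def vv_def)
    then show ?thesis unfolding E'_def using Kl_cong[of ?M "shf p x" "vv m ?C" m ?c] by simp
  qed
  interpret tl: glim r n "\<lambda>f a. (f \<longlongrightarrow> a) (at ?C)"
    by unfold_locales (auto intro: tendsto_intros)
  have GLw: "tl.GL (\<lambda>w. E * Kl ?c (vv m w) ?M m) E'"
    unfolding E'C
  proof (intro tl.GL_mult tl.GL_const En tl.GL_Kl)
    fix i assume s: "sing ?c ?M i"
    have "((\<lambda>w. 1 / (of_int (c (Suc i)) - w)) \<longlongrightarrow> 1 / (of_int (c (Suc i)) - ?C)) (at ?C)"
      by (intro tendsto_intros) (use mate[OF s] s in \<open>auto simp: sing_def eps_def split: if_splits\<close>)
    then show "Suc i < ?M \<and> J i (Suc i) \<and>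
      ((\<lambda>w. 1 / (vv m w (Suc i) - vv m w ?M)) \<longlongrightarrow> 1 / (vv m ?C (Suc i) - vv m ?C ?M)) (at ?C)"
      using mate[OF s] by (simp add: vv_def)
  next
    fix i assume i: "\<not> sing ?c ?M i" "1 \<le> i" "i < ?M" "J i ?M"
    then have "((\<lambda>w. 1 / (of_int (c i) - w)) \<longlongrightarrow> 1 / (of_int (c i) - ?C)) (at ?C)"
      by (intro tendsto_intros) (auto simp: sing_def)
    then show "((\<lambda>w. 1 / (vv m w i - vv m w ?M)) \<longlongrightarrow> 1 / (vv m ?C i - vv m ?C ?M)) (at ?C)"
      using i by (simp add: vv_def)
  qed (use Suc.prems in auto)
  have XM: "X ?M \<in> alg n" by (rule alg_X[OF Suc.prems])
  let ?G = "\<lambda>w. sc w * (E * Kl ?c (vv m w) ?M m) - X ?M * (E * Kl ?c (vv m w) ?M m)"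
  have lim1: "tl.GL ?G (sc ?C * E' - X ?M * E')"
    by (intro tl.GL_diff tl.GL_mult GLw tl.GL_const XM tl.GL_sc tendsto_ident_at)
  let ?S = "insert 0 ((\<lambda>j. of_int (c j)) ` {1..m})"
  have "eventually (\<lambda>w. w \<notin> insert ?C ?S) (at ?C)"
    by (rule eventually_avoid) simp
  \<comment> \<open>Off finitely many \<open>w\<close> no denominator vanishes, so the fused tail is
    again the original one. The value 0 is excluded because \<open>X_Tl\<close> divides by the last
    parameter.\<close>
  then have ev: "eventually (\<lambda>w. ?G w = sc (w * beta (vv m w) ?M m) * E) (at ?C)"
  proof eventually_elim
    case (elim w)
    have vM: "vv m w ?M = w" by (simp add: vv_def)
    have ne: "vv m w i \<noteq> vv m w ?M" if "1 \<le> i" "i < ?M" "J i ?M" for i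
      using elim that by (auto simp: vv_def)
    have "E * Tl (vv m w) ?M m = E * Kl ?c (vv m w) ?M m"
    proof (rule Tl_eq_Kl[where e = ?e])
      show "vv m w i \<noteq> vv m w ?M" if "1 \<le> i" "i < ?M" "J i ?M" for i by (rule ne[OF that])
    next
      fix i assume s: "sing ?c ?M i"
      have "vv m w (Suc i) = vv m w i + ?e"
        using mate[OF s] by (auto simp: vv_def)
      then show "Suc i < ?M \<and> J i (Suc i) \<and> c (Suc i) \<noteq> c ?M \<and> vv m w (Suc i) = vv m w i + ?e \<and>
          E * tp i (Suc i) = sc ?e * E"
        using mate[OF s] Etp[OF s] cS[OF s] by blast
    qed (use ns in auto)
    moreover have "sc (vv m w ?M) * (E * Tl (vv m w) ?M m) - X ?M * (E * Tl (vv m w) ?M m)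
        = sc (vv m w ?M * beta (vv m w) ?M m) * E"
    proof (rule X_Tl[OF E(2)])
      show "E * X j = sc (vv m w j) * E" if "1 \<le> j" "j \<le> m" for j
        using XR[OF that] that by (simp add: vv_def)
    qed (use elim ne vM in auto)
    ultimately show ?case using vM by simp
  qed
  have "sc ?C * E' - X ?M * E' = 0"
  proof (rule poly_mapping_eqI)
    fix g
    have l1: "((\<lambda>w. lookup (?G w) g) \<longlongrightarrow> lookup (sc ?C * E' - X ?M * E') g) (at ?C)"
      using lim1 by (simp add: tl.GL_def)
    have "((\<lambda>w. w * beta (vv m w) ?M m * lookup E g) \<longlongrightarrow> 0 * lookup E g) (at ?C)"
      by (intro tendsto_mult beta_tendsto[OF Suc.prems] tendsto_const)
    moreover have "eventually (\<lambda>w. w * beta (vv m w) ?M m * lookup E g = lookup (?G w) g) (at ?C)"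
      using ev by eventually_elim simp
    ultimately have "((\<lambda>w. lookup (?G w) g) \<longlongrightarrow> 0 * lookup E g) (at ?C)"
      by (rule Lim_transform_eventually)
    from tendsto_unique[OF at_neq_bot l1 this]
    have "lookup (sc ?C * E' - X ?M * E') g = 0 * lookup E g" .
    then show "lookup (sc ?C * E' - X ?M * E') g = lookup 0 g" by simp
  qed
  then have XM': "X ?M * E' = sc ?C * E'" by simp
  have Xk: "X k * E' = sc (of_int (c k)) * E'" if k: "1 \<le> k" "k \<le> ?M" for k
  proof (cases "k = ?M")
    case False
    then have "X k * E = sc (of_int (c k)) * E" using X k by simp
    then show ?thesis unfolding E'_def by (simp flip: mult.assoc)
  qed (use XM' in simp)
  have "E' \<in> alg ?M" unfolding E'_def
    by (intro alg_mult alg_Kl alg_mono[OF _ E(2)]) (use mate in auto)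
  then show ?case using GL' Xk by blast
qed

end

end

section \<open>Exchanging adjacent entries\<close>

lemma poly_fun_swp:
  assumes "poly_fun n P" "1 \<le> k" "k < n"
  shows "poly_fun n (\<lambda>z. P (swp k z))"
  using assms(1)
proof induction
  case (coord i)
  then have "transpose k (Suc k) i \<in> {1..n}" using assms by (auto simp: transpose_def)
  then show ?case unfolding swp_def comp_apply by (rule poly_fun.coord)
qed (auto intro: poly_fun.intros)

context blocks
begin

definition fused :: "nat \<Rightarrow> (nat \<Rightarrow> complex) \<Rightarrow> (nat \<Rightarrow> nat \<times> nat) \<Rightarrow> galg \<Rightarrow> bool" where
  "fused n x p E \<longleftrightarrow> E \<in> alg n \<and> tr E = E \<and> tau E = 1 \<and>
    (\<forall>k. 1 \<le> k \<and> k \<le> n \<longrightarrow> X k * E = sc (of_int (box_content (p k))) * E) \<and>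
    (\<forall>g. regular_value n (hsp n p) (udom n p) (\<lambda>z. lookup (Ph (shf p z) n) g) x (lookup E g))"

lemma gen_iff: "gen u n \<longleftrightarrow> (\<forall>i\<in>{1..n}. \<forall>j\<in>{1..n}. i \<noteq> j \<and> J i j \<longrightarrow> u i \<noteq> u j)"
proof (intro iffI ballI impI)
  fix i j assume g: "gen u n" and ij: "i \<in> {1..n}" "j \<in> {1..n}" "i \<noteq> j \<and> J i j"
  then have "i < j \<or> j < i" by auto
  then show "u i \<noteq> u j"
    using genD[OF g, of i j] genD[OF g, of j i] ij J_sym[of i j] by auto
qed (auto simp: gen_def)

lemma shf_swp: "shf (swp k p) (swp k z) = swp k (shf p z)"
  by (auto simp: shf_def swp_def fun_eq_iff)

lemma swp_in_hsp_udom: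
  assumes k: "1 \<le> k" "k < n" "J k (Suc k)" and z: "z \<in> hsp n p \<inter> udom n p"
  shows "swp k z \<in> hsp n (swp k p) \<inter> udom n (swp k p)"
proof
  let ?t = "transpose k (Suc k)"
  have t: "?t i \<in> {1..n} \<longleftrightarrow> i \<in> {1..n}" "J (?t i) i" for i
    using k by (auto simp: transpose_def J_def)
  have JJ: "J (?t i) (?t j) \<longleftrightarrow> J i j" for i j using t(2)[of i] t(2)[of j] unfolding J_def by argo
  have zh: "z \<in> hsp n p" and zz: "z \<in> affine_space n" "gen (shf p z) n"
    using z unfolding hsp_def udom_def by blast+
  have ext: "z i = undefined" if "i \<notin> {1..n}" for i
    using zz(1) that unfolding affine_space_def by (rule PiE_arb)
  have "swp k z \<in> affine_space n"
    unfolding affine_space_def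
  proof (rule PiE_I)
    fix i assume i: "i \<notin> {1..n}"
    then have "?t i \<notin> {1..n}" using t(1) by blast
    then show "swp k z i = undefined" using ext by (simp add: swp_def)
  qed simp
  show "swp k z \<in> hsp n (swp k p)"
  proof -
    have "z (?t i) = z (?t j)" if "i \<in> {1..n}" "j \<in> {1..n}" "J i j" "hook_ix (p (?t i)) = hook_ix (p (?t j))" for i j
      using zh that t(1)[of i] t(1)[of j] JJ[of i j] unfolding hsp_def by blast
    with \<open>swp k z \<in> affine_space n\<close> show ?thesis
      unfolding hsp_def swp_def comp_apply by blast
  qed
  have "gen (swp k (shf p z)) n"
    unfolding gen_iff
  proof (intro ballI impI)
    fix i j assume ij: "i \<in> {1..n}" "j \<in> {1..n}" "i \<noteq> j \<and> J i j"
    then have "?t i \<noteq> ?t j" by (metis transpose_involutory)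
    then have "shf p z (?t i) \<noteq> shf p z (?t j)"
      using zz(2)[unfolded gen_iff] ij t(1) JJ by blast
    then show "swp k (shf p z) i \<noteq> swp k (shf p z) j" by (simp add: swp_def)
  qed
  then show "swp k z \<in> udom n (swp k p)" by (simp add: udom_def shf_swp)
qed

text \<open>The value is read off from \<open>Ph_sandwich\<close>, where \<open>a\<close> is regular
  at \<open>x\<close>. The factor \<open>?s - sc (a x)\<close> carries eigenvectors for the
  exchanged contents to eigenvectors for the original ones.\<close>

lemma fused_swp:
  assumes x: "x \<in> diagonal_line n" and std: "std_seq n p"
    and k: "1 \<le> k" "k < n" "J k (Suc k)" "\<not> box_le (p k) (p (Suc k))"
    and E': "fused n x (swp k p) E'"
  shows "\<exists>E. fused n x p E"
proof -
  interpret P: fusion r n x p by unfold_locales (fact std, fact x)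
  let ?c = "\<lambda>k. box_content (p k)" and ?s = "tp k (Suc k)"
  have kn: "k \<in> {1..n}" "Suc k \<in> {1..n}" using k by auto
  have phx: "swp k x = x"
  proof
    fix j show "swp k x j = x j"
      using P.x_const[OF kn] by (cases "j = k \<or> j = Suc k") auto
  qed
  have s: "?s \<in> alg n" by (rule alg_tp) (use k in auto)
  have E'a: "E' \<in> alg n" using E' by (simp add: fused_def)
  have 1: "P.rvl.GL (\<lambda>z. Ph (swp k (shf p z)) n) E'"
    unfolding P.rvl.GL_def
  proof (intro conjI allI)
    fix g
    have "regular_value n (hsp n p) (udom n p) (\<lambda>z. lookup (Ph (shf (swp k p) (swp k z)) n) g) x (lookup E' g)"
    proof (rule regular_value_subst[where f = "\<lambda>z. lookup (Ph (shf (swp k p) z) n) g" and \<phi> = "swp k"])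
      show "regular_value n (hsp n (swp k p)) (udom n (swp k p)) (\<lambda>z. lookup (Ph (shf (swp k p) z) n) g) x (lookup E' g)"
        using E' by (simp add: fused_def)
    qed (use poly_fun_swp k phx swp_in_hsp_udom[OF k(1-3)] P.x_H P.HU_ne in blast)+
    then show "regular_value n (hsp n p) (udom n p) (\<lambda>z. lookup (Ph (swp k (shf p z)) n) g) x (lookup E' g)"
      by (simp add: shf_swp)
  qed (use E'a alg_Ph in auto)
  define a where "a z = 1 / (shf p z k - shf p z (Suc k))" for z
  have cne: "?c k \<noteq> ?c (Suc k)" and gap: "\<bar>?c k - ?c (Suc k)\<bar> \<ge> 2"
    using content_Suc_gap[OF std k] by auto
  have a: "P.rv a (a x)"
    unfolding a_def[abs_def] by (rule P.rv_inverse_diff) (use kn k cne in auto)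
  define d where "d = complex_of_int (?c k - ?c (Suc k))"
  have ax: "a x = 1 / d" using P.x_const[OF kn] by (simp add: a_def shf_def d_def)
  have d: "d \<noteq> 0" "d * d \<noteq> 1"
  proof -
    show "d \<noteq> 0" using cne by (simp add: d_def)
    have "(?c k - ?c (Suc k)) * (?c k - ?c (Suc k)) \<noteq> 1" using gap by (auto simp: square_eq_1_iff)
    then show "d * d \<noteq> 1" unfolding d_def by (metis of_int_eq_1_iff of_int_mult)
  qed
  \<comment> \<open>Nonzero because the contents differ by at least 2.\<close>
  have a1: "1 - (a x)\<^sup>2 \<noteq> 0" using d by (simp add: ax power2_eq_square field_simps)
  have q: "P.rv (\<lambda>z. 1 - (a z)\<^sup>2) (1 - (a x)\<^sup>2)"
    using P.rvl.L_add[OF P.rvl.L_const[of 1] P.rvl.L_mult[OF P.rvl.L_const[of "- 1"] P.rvl.L_mult[OF a a]]]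
    by (simp add: power2_eq_square)
  let ?S = "\<lambda>z. (?s - sc (a z)) * Ph (swp k (shf p z)) n * (?s - sc (a z))"
  let ?B = "(?s - sc (a x)) * E' * (?s - sc (a x))"
  have S: "P.rvl.GL ?S ?B"
    by (intro P.rvl.GL_mult P.rvl.GL_diff P.rvl.GL_const s P.rvl.GL_sc a 1)
  define E where "E = sc (1 / (1 - (a x)\<^sup>2)) * ?B"
  have Ea: "E \<in> alg n" unfolding E_def by (intro alg_mult alg_diff s E'a alg_sc)
  have GL: "P.rvl.GL (\<lambda>z. Ph (shf p z) n) E"
    unfolding P.rvl.GL_def
  proof (intro conjI allI)
    fix g
    have "P.rv (\<lambda>z. lookup (Ph (shf p z) n) g) (lookup ?B g / (1 - (a x)\<^sup>2))"
    proof (rule regular_value_divide[OF _ q a1])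
      show "P.rv (\<lambda>z. lookup (?S z) g) (lookup ?B g)" using S by (simp add: P.rvl.GL_def)
      fix z assume "z \<in> hsp n p \<inter> udom n p"
      then have "gen (shf p z) n" by (simp add: udom_def)
      from Ph_sandwich[OF this k(1,3)] k(2)
      have "sc (1 - (a z)\<^sup>2) * Ph (shf p z) n = ?S z" by (simp add: a_def)
      from arg_cong[OF this, of "\<lambda>b. lookup b g"]
      show "lookup (Ph (shf p z) n) g * (1 - (a z)\<^sup>2) = lookup (?S z) g" by (simp add: mult.commute)
    qed
    then show "P.rv (\<lambda>z. lookup (Ph (shf p z) n) g) (lookup E g)" by (simp add: E_def)
  qed (use Ea alg_Ph in auto)
  have X: "X j * E = sc (of_int (?c j)) * E" if j: "1 \<le> j" "j \<le> n" for j
  proof -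
    have XE': "X j * E' = sc (of_int (box_content (swp k p j))) * E'" if "1 \<le> j" "j \<le> n" for j
      using E' that by (simp add: fused_def)
    have k': "X k * E' = sc (of_int (?c (Suc k))) * E'" "X (Suc k) * E' = sc (of_int (?c k)) * E'"
      using XE'[of k] XE'[of "Suc k"] k by simp_all
    have da: "of_int (?c k) = of_int (?c (Suc k)) + d" by (simp add: d_def)
    \<comment> \<open>This balances the constant 1 in the relations \<open>tp_X\<close>.\<close>
    have ad: "a x * (y + d) = a x * y + 1" for y using d(1) by (simp add: ax field_simps)
    have "X j * (?s - sc (a x)) * E' = sc (of_int (?c j)) * ((?s - sc (a x)) * E')"
    proof -
      consider "j = k" | "j = Suc k" | "j \<noteq> k" "j \<noteq> Suc k" by blast
      then show ?thesis
      proof cases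
        case 1
        have "X k * (?s - sc (a x)) * E' = ?s * (X (Suc k) * E') - E' - sc (a x) * (X k * E')"
          using tp_X(3)[OF k(1,3)] by (simp add: right_diff_distrib left_diff_distrib sc_commute[of "X k"] mult.assoc)
        also have "\<dots> = sc (of_int (?c k)) * (?s * E') - sc (a x * of_int (?c (Suc k)) + 1) * E'"
          unfolding k' by (simp add: sc_left_commute[of ?s] sc_add sc_mult distrib_right mult.assoc)
        also have "a x * of_int (?c (Suc k)) + 1 = of_int (?c k) * a x"
          unfolding da using ad by (simp add: mult.commute)
        finally show ?thesis using 1 by (simp add: right_diff_distrib left_diff_distrib sc_mult mult.assoc)
      next
        case 2
        have "X (Suc k) * (?s - sc (a x)) * E' = ?s * (X k * E') + E' - sc (a x) * (X (Suc k) * E')"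
          using tp_X(1)[OF k(1,3)] by (simp add: right_diff_distrib left_diff_distrib sc_commute[of "X (Suc k)"] mult.assoc)
            (simp flip: mult.assoc add: distrib_right)
        also have "\<dots> = sc (of_int (?c (Suc k))) * (?s * E') - sc (a x * of_int (?c k) - 1) * E'"
          unfolding k' by (simp add: sc_left_commute[of ?s] sc_diff sc_mult left_diff_distrib mult.assoc)
        also have "a x * of_int (?c k) - 1 = of_int (?c (Suc k)) * a x"
          unfolding da using ad by (simp add: mult.commute)
        finally show ?thesis using 2 by (simp add: right_diff_distrib left_diff_distrib sc_mult mult.assoc)
      next
        case 3
        then have "X j * (?s - sc (a x)) = (?s - sc (a x)) * X j"
          using tp_X_other[OF k(1,3) 3] by (simp add: right_diff_distrib left_diff_distrib sc_commute)
        moreover have "X j * E' = sc (of_int (?c j)) * E'" using XE'[OF j] 3 by simp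
        ultimately show ?thesis by (simp only: mult.assoc sc_left_commute[of "?s - sc (a x)"])
      qed
    qed
    from arg_cong[OF this, of "\<lambda>b. sc (1 / (1 - (a x)\<^sup>2)) * (b * (?s - sc (a x)))"]
    show ?thesis unfolding E_def by (simp only: mult.assoc sc_left_commute[of "X j"] sc_left_commute[of "sc _"])
  qed
  have "fused n x p E"
    unfolding fused_def using Ea X GL P.GL_tr[OF GL order_refl] P.GL_tau[OF GL] by (simp add: P.rvl.GL_def)
  then show ?thesis ..
qed

text \<open>Sorting into the hook order by adjacent exchanges. The weights \<open>n - k\<close>
  decrease in \<open>k\<close>, so moving the smaller key to the earlier place lowers the sum.
  Without inversions inside the blocks \<open>base_fusion\<close> applies.\<close>

theorem fusion_exists:
  assumes x: "x \<in> diagonal_line n"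
  shows "std_seq n p \<Longrightarrow> (\<And>k. k \<in> {1..n} \<Longrightarrow> fst (p k) < N \<and> snd (p k) < N) \<Longrightarrow> \<exists>E. fused n x p E"
proof (induction "\<Sum>k\<in>{1..n}. (n - k) * key N (p k)" arbitrary: p rule: less_induct)
  case less
  note std = less.prems(1) and N = less.prems(2)
  show ?case
  proof (cases "\<exists>k. 1 \<le> k \<and> k < n \<and> J k (Suc k) \<and> key N (p (Suc k)) < key N (p k)")
    case True
    then obtain k where k: "1 \<le> k" "k < n" "J k (Suc k)" "key N (p (Suc k)) < key N (p k)" by blast
    have kn: "k \<in> {1..n}" "Suc k \<in> {1..n}" using k by auto
    have nb: "\<not> box_le (p k) (p (Suc k))"
    proof
      assume "box_le (p k) (p (Suc k))"
      moreover have "p k \<noteq> p (Suc k)" using k(4) by auto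
      ultimately show False using key_less[of "p k" "p (Suc k)" N] N[OF kn(1)] N[OF kn(2)] k(4) by auto
    qed
    have "(\<Sum>i\<in>{1..n}. (n - i) * key N (swp k p i)) < (\<Sum>i\<in>{1..n}. (n - i) * key N (p i))"
    proof -
      let ?R = "{1..n} - {k} - {Suc k}"
      have split: "(\<Sum>i\<in>{1..n}. f i) = f k + (f (Suc k) + (\<Sum>i\<in>?R. f i))" for f :: "nat \<Rightarrow> nat"
      proof -
        have "(\<Sum>i\<in>{1..n}. f i) = f k + (\<Sum>i\<in>{1..n} - {k}. f i)" by (rule sum.remove) (use kn in auto)
        also have "(\<Sum>i\<in>{1..n} - {k}. f i) = f (Suc k) + (\<Sum>i\<in>?R. f i)" by (rule sum.remove) (use kn in auto)
        finally show ?thesis .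
      qed
      have rest: "(\<Sum>i\<in>?R. (n - i) * key N (swp k p i)) = (\<Sum>i\<in>?R. (n - i) * key N (p i))"
        by (rule sum.cong) auto
      obtain l where l: "n - k = Suc l" "n - Suc k = l" using k by (metis Suc_diff_Suc)
      show ?thesis unfolding split rest l using k(4) by simp
    qed
    moreover have "std_seq n (swp k p)" by (rule std_seq_swp[OF std k(1-3) nb])
    moreover have "fst (swp k p i) < N \<and> snd (swp k p i) < N" if "i \<in> {1..n}" for i
      using N[OF that] N[OF kn(1)] N[OF kn(2)] by (cases "i = k \<or> i = Suc k") auto
    ultimately obtain E' where "fused n x (swp k p) E'" using less.hyps by blast
    then show ?thesis using fused_swp[OF x std k(1-3) nb] by blast
  next
    case False
    then have mono: "key N (p k) \<le> key N (p (Suc k))" if "1 \<le> k" "k < n" "J k (Suc k)" for k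
      using that by (meson not_less)
    interpret P: fusion r n x p by unfold_locales (fact std, fact x)
    obtain E where E: "P.rvl.GL (\<lambda>z. Ph (shf p z) n) E" "E \<in> alg n"
      "\<forall>k. 1 \<le> k \<and> k \<le> n \<longrightarrow> X k * E = sc (of_int (box_content (p k))) * E"
      using P.base_fusion[OF N mono, of n] by auto
    have "fused n x p E"
      unfolding fused_def using E P.GL_tr[OF E(1) order_refl] P.GL_tau[OF E(1)]
      by (simp add: P.rvl.GL_def)
    then show ?thesis ..
  qed
qed

end

section \<open>Coefficient functions and the main theorem\<close>

lemma inj_apply: "inj apply"
  by (rule injI) (rule perm_eq_applyI)

text \<open>The calculations use a ring type, the theorem uses coefficient functions; this is the
  passage between them.\<close>

definition coefs :: "galg \<Rightarrow> grp_alg" where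
  "coefs a h = (if h \<in> range apply then lookup a (inv apply h) else 0)"

lemma coefs_apply [simp]: "coefs a (apply g) = lookup a g"
  by (simp add: coefs_def inv_f_f[OF inj_apply])

lemma grp_alg_eqI:
  assumes "\<And>g. u (apply g) = v (apply g)" "\<And>h. h \<notin> range apply \<Longrightarrow> u h = v h"
  shows "u = (v :: grp_alg)"
proof
  fix h show "u h = v h" using assms by (cases "h \<in> range apply") auto
qed

lemma delta_apply: "delta (apply g) = coefs (single g 1)"
proof (rule grp_alg_eqI)
  show "delta (apply g) (apply h) = coefs (single g 1) (apply h)" for h
    by (auto simp: delta_def lookup_single when_def inj_eq[OF inj_apply])
  show "delta (apply g) h = coefs (single g 1) h" if "h \<notin> range apply" for h
    using that by (auto simp: delta_def coefs_def)
qed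

lemma delta_id: "delta id = coefs 1"
  using delta_apply[of 0] by simp

lemma delta_transpose: "delta (transpose i j) = coefs (tp i j)"
  using delta_apply[of "Perm.swap i j"] by (simp add: tp_def swap_apply)

context blocks
begin

lemma ga_mult_coefs:
  assumes a: "a \<in> alg (r + s)" and b: "b \<in> alg (r + s)"
  shows "ga_mult (SxS r s) (coefs a) (coefs b) = coefs (a * b)"
proof (rule grp_alg_eqI)
  let ?G = "grp (r + s)"
  have S: "(\<Sum>g\<in>SxS r s. \<phi> g) = (\<Sum>g\<in>?G. \<phi> (apply g))" for \<phi> :: "(nat \<Rightarrow> nat) \<Rightarrow> complex"
    unfolding SxS_eq_image by (subst sum.reindex) (auto intro: inj_on_subset[OF inj_apply])
  have m: "ga_mult (SxS r s) (coefs a) (coefs b) x =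
      (\<Sum>g\<in>?G. \<Sum>h\<in>?G. lookup a g * lookup b h * delta (apply (g + h)) x)" for x
    unfolding ga_mult_def S by (simp add: apply_plus)
  fix y
  have "(\<Sum>h\<in>?G. lookup a g * lookup b h * delta (apply (g + h)) (apply y)) = lookup a g * lookup b (- g + y)" for g
  proof -
    have "apply y = apply (g + h) \<longleftrightarrow> h = - g + y" for h
    proof -
      have "apply y = apply (g + h) \<longleftrightarrow> y = g + h" using inj_eq[OF inj_apply] by auto
      also have "\<dots> \<longleftrightarrow> h = - g + y" by (metis add.assoc add_0_left left_minus minus_add_cancel add_minus_cancel)
      finally show ?thesis .
    qed
    then have "(\<Sum>h\<in>?G. lookup a g * lookup b h * delta (apply (g + h)) (apply y)) =
        (\<Sum>h\<in>?G. if h = - g + y then lookup a g * lookup b h else 0)"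
      unfolding delta_def by (intro sum.cong) auto
    also have "\<dots> = lookup a g * lookup b (- g + y)"
      using b by (auto simp: sum.delta alg_def in_keys_iff)
    finally show ?thesis .
  qed
  then show "ga_mult (SxS r s) (coefs a) (coefs b) (apply y) = coefs (a * b) (apply y)"
    unfolding m coefs_apply lookup_mult_alg[OF a] by simp
next
  fix h :: "nat \<Rightarrow> nat" assume h: "h \<notin> range apply"
  have "delta (apply g) h = 0" for g using h by (auto simp: delta_def)
  then show "ga_mult (SxS r s) (coefs a) (coefs b) h = coefs (a * b) h"
    using h by (simp add: ga_mult_def coefs_def SxS_eq_image image_iff delta_def)
      (intro sum.neutral ballI, auto simp flip: apply_plus)
qed

lemma ga_prod_list_coefs:
  "set as \<subseteq> alg (r + s) \<Longrightarrow> ga_prod_list (SxS r s) (map coefs as) = coefs (prod_list as) \<and> prod_list as \<in> alg (r + s)"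
proof (induction as)
  case Nil
  show ?case by (simp add: ga_prod_list_def delta_id)
next
  case (Cons a as)
  then show ?case using ga_mult_coefs[of a s "prod_list as"] alg_mult by (simp add: ga_prod_list_def)
qed

lemma Phi_factor_coefs:
  assumes "J i j"
  shows "Phi_factor c z (i, j) = coefs (R (\<lambda>k. z k + of_int (c k)) i j)"
  unfolding Phi_factor_def R_def delta_id delta_transpose
  by (rule grp_alg_eqI) (use assms in \<open>auto simp: coefs_def lookup_minus\<close>)

section \<open>Lexicographic order and order by the larger index\<close>

definition row :: "(nat \<Rightarrow> complex) \<Rightarrow> nat \<Rightarrow> nat \<Rightarrow> galg" where
  "row u i b = prod_list (map (R u i) [i+1..<b+1])"

definition rows :: "(nat \<Rightarrow> complex) \<Rightarrow> nat \<Rightarrow> nat \<Rightarrow> galg" where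
  "rows u a b = prod_list (map (\<lambda>i. row u i b) [a..<b+1])"

definition col :: "(nat \<Rightarrow> complex) \<Rightarrow> nat \<Rightarrow> nat \<Rightarrow> galg" where
  "col u a m = prod_list (map (\<lambda>i. R u i m) [a..<m])"

lemma prod_lex_pairs: "prod_list (map (\<lambda>(i, j). R u i j) (lex_pairs a b)) = rows u a b"
proof -
  have 1: "prod_list (map ((\<lambda>(i, j). R u i j) \<circ> Pair i) js) = prod_list (map (R u i) js)" for i js
    by (induction js) auto
  have "prod_list (map (\<lambda>(i, j). R u i j) (concat (map (\<lambda>i. map (Pair i) [i+1..<b+1]) is))) =
      prod_list (map (\<lambda>i. row u i b) is)" for "is"
    by (induction "is") (simp_all add: 1 row_def del: upt_Suc)
  then show ?thesis by (simp add: lex_pairs_def rows_def)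
qed

lemma prod_list_commute: "(\<And>x. x \<in> set xs \<Longrightarrow> y * x = x * y) \<Longrightarrow> y * prod_list xs = prod_list xs * y" for y :: galg
proof (induction xs)
  case (Cons x xs)
  have "y * (x * prod_list xs) = (y * x) * prod_list xs" by (simp add: mult.assoc)
  also have "\<dots> = x * (y * prod_list xs)" using Cons.prems[of x] by (simp add: mult.assoc)
  also have "y * prod_list xs = prod_list xs * y" using Cons by simp
  finally show ?case by (simp add: mult.assoc)
qed simp

text \<open>The factor for \<open>(a, Suc b)\<close> ends its row and commutes with the later rows,
  whose indices lie in \<open>Suc a..b\<close>. Pushed to the right, the row ends assemble into the
  last column.\<close>

lemma rows_Suc:
  assumes "a \<le> Suc b"
  shows "rows u a (Suc b) = rows u a b * col u a (Suc b)"
  using assms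
proof (induction a rule: inc_induct)
  case base
  show ?case by (simp add: rows_def col_def row_def)
next
  case (step a)
  have ab: "a \<le> b" using step by simp
  have up: "rows u a b' = row u a b' * rows u (Suc a) b'" if "a \<le> b'" for b'
    using that by (simp add: rows_def upt_conv_Cons del: upt_Suc)
  have r: "row u a (Suc b) = row u a b * R u a (Suc b)"
    using ab by (simp add: row_def)
  have c: "col u a (Suc b) = R u a (Suc b) * col u (Suc a) (Suc b)"
    using ab by (simp add: col_def upt_conv_Cons del: upt_Suc)
  have com: "R u a (Suc b) * rows u (Suc a) b = rows u (Suc a) b * R u a (Suc b)"
    unfolding rows_def row_def
  proof (intro prod_list_commute)
    fix y assume "y \<in> set (map (\<lambda>i. prod_list (map (R u i) [i+1..<b+1])) [Suc a..<b+1])"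
    then obtain i where i: "Suc a \<le> i" "i \<le> b" "y = prod_list (map (R u i) [i+1..<b+1])" by auto
    show "R u a (Suc b) * y = y * R u a (Suc b)"
      unfolding i(3) by (intro prod_list_commute) (use i in \<open>auto intro!: R_commute\<close>)
  qed
  have "rows u a (Suc b) = row u a b * (R u a (Suc b) * rows u (Suc a) b) * col u (Suc a) (Suc b)"
    using up[of "Suc b"] ab r step.IH by (simp add: mult.assoc)
  also have "\<dots> = rows u a b * col u a (Suc b)"
    unfolding com c using up[of b] ab by (simp add: mult.assoc)
  finally show ?case .
qed

lemma col_1: "col u 1 (Suc m) = Tl u (Suc m) m"
proof -
  have "prod_list (map (\<lambda>i. R u i M) [1..<Suc j]) = Tl u M j" for M j
    by (induction j) simp_all
  then show ?thesis by (simp add: col_def del: upt_Suc)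
qed

lemma rows_1: "rows u 1 m = Ph u m"
proof (induction m)
  case 0
  show ?case by (simp add: rows_def)
next
  case (Suc m)
  then show ?case using rows_Suc[of 1 m u] col_1 by simp
qed

text \<open>Factors with indices in different blocks are 1, so the rows of the first block
  effectively end at \<open>r\<close>.\<close>

lemma rows_split: "rows u 1 (r + s) = rows u 1 r * rows u (r + 1) (r + s)"
proof -
  have "[1..<r+s+1] = [1..<r+1] @ [r+1..<r+s+1]"
    by (metis add.assoc add.commute le_add1 upt_add_eq_append)
  moreover have "row u i (r + s) = row u i r" if "i \<in> set [1..<r+1]" for i
  proof -
    have "[i+1..<r+s+1] = [i+1..<r+1] @ [r+1..<r+1+s]"
      using that upt_add_eq_append[of "i+1" "r+1" s] by (simp add: add.commute add.left_commute del: upt_Suc)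
    moreover have "prod_list (map (R u i) [r+1..<r+1+s]) = 1"
    proof -
      have "prod_list (map (R u i) js) = 1" if "\<forall>j\<in>set js. \<not> J i j" for js
        using that by (induction js) (auto simp: R_def)
      moreover have "\<forall>j\<in>set [r+1..<r+1+s]. \<not> J i j"
        using that by (auto simp: J_def simp del: upt_Suc)
      ultimately show ?thesis by blast
    qed
    ultimately show ?thesis by (simp add: row_def del: upt_Suc)
  qed
  then have "map (\<lambda>i. row u i (r + s)) [1..<r+1] = map (\<lambda>i. row u i r) [1..<r+1]"
    by (intro map_cong refl)
  ultimately show ?thesis unfolding rows_def by (simp only: map_append prod_list.append)
qed

lemma set_lex_pairs: "set (lex_pairs a b) = {(i, j). a \<le> i \<and> i < j \<and> j \<le> b}"
proof -
  have "set (lex_pairs a b) = (\<Union>i\<in>{a..<b+1}. Pair i ` {i+1..<b+1})"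
    by (simp add: lex_pairs_def del: upt_Suc)
  then show ?thesis by (auto simp: image_iff less_Suc_eq_le)
qed

lemma Phi_coefs: "Phi r s c z = coefs (Ph (\<lambda>k. z k + of_int (c k)) (r + s))"
proof -
  let ?u = "\<lambda>k. z k + of_int (c k)" and ?R = "\<lambda>u (i, j). R u i j"
  have 1: "ga_prod_list (SxS r s) (map (Phi_factor c z) (lex_pairs a b)) = coefs (rows ?u a b) \<and> rows ?u a b \<in> alg (r + s)"
    if ab: "1 \<le> a" "b \<le> r + s" "\<And>i j. a \<le> i \<Longrightarrow> i < j \<Longrightarrow> j \<le> b \<Longrightarrow> J i j" for a b
  proof -
    have "map (Phi_factor c z) (lex_pairs a b) = map coefs (map (\<lambda>(i, j). R ?u i j) (lex_pairs a b))"
      unfolding map_map comp_def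
      by (intro map_cong refl) (use ab Phi_factor_coefs in \<open>auto simp: set_lex_pairs\<close>)
    moreover have "set (map (\<lambda>(i, j). R ?u i j) (lex_pairs a b)) \<subseteq> alg (r + s)"
      using ab by (auto simp: set_lex_pairs intro!: alg_R)
    ultimately show ?thesis using ga_prod_list_coefs prod_lex_pairs by metis
  qed
  have a: "ga_prod_list (SxS r s) (map (Phi_factor c z) (lex_pairs 1 r)) = coefs (rows ?u 1 r) \<and> rows ?u 1 r \<in> alg (r + s)"
    by (rule 1) (auto simp: J_def)
  have b: "ga_prod_list (SxS r s) (map (Phi_factor c z) (lex_pairs (r + 1) (r + s))) = coefs (rows ?u (r + 1) (r + s)) \<and>
      rows ?u (r + 1) (r + s) \<in> alg (r + s)"
    by (rule 1) (auto simp: J_def)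
  show ?thesis
    unfolding Phi_def conjunct1[OF a] conjunct1[OF b] ga_mult_coefs[OF conjunct2[OF a] conjunct2[OF b]]
    by (subst rows_split[symmetric]) (simp only: rows_1)
qed

end

section \<open>The hook space and the domain in terms of boxes\<close>

lemma hook_iff: "b \<in> hook lam (d, d) \<longleftrightarrow> b \<in> diagram lam \<and> hook_ix b = d"
  by (cases b) (auto simp: hook_def hook_ix_def min_def)

text \<open>The witness \<open>d\<close> is the common hook index; \<open>(d, d)\<close> belongs to
  the diagram, being weakly above and to the left of a box of the hook.\<close>

lemma filling_same_hook:
  assumes part: "partition_of m lam" and T: "T \<in> std_filling lam A" and ij: "i \<in> A" "j \<in> A"
  defines "pos \<equiv> inv_into (diagram lam) T"
  shows "hook_ix (pos i) = hook_ix (pos j) \<longleftrightarrow>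
    (\<exists>d. (d, d) \<in> diagram lam \<and> i \<in> T ` hook lam (d, d) \<and> j \<in> T ` hook lam (d, d))"
proof -
  note inv = filling_inv[OF part T, folded pos_def] and inv_eq = filling_inv_eq[OF part T, folded pos_def]
  have mem: "k \<in> T ` hook lam (d, d) \<longleftrightarrow> hook_ix (pos k) = d" if "k \<in> A" for k d
    using inv[OF that] inv_eq hook_iff by (metis (no_types, lifting) image_iff)
  have "(hook_ix (pos i), hook_ix (pos i)) \<in> diagram lam"
    by (rule diagram_down[OF part inv(1)[OF ij(1)]])
      (use diagram_pos[OF inv(1)[OF ij(1)]] in \<open>auto simp: hook_ix_def box_le_def\<close>)
  then show ?thesis using mem ij by auto
qed

lemma hook_space_eq:
  assumes part: "partition_of r lam" "partition_of s mu" and T: "T \<in> std_tableaux r s lam mu"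
  shows "hook_space (r + s) lam mu T = blocks.hsp r (r + s) (tab_pos r lam mu T)"
proof -
  interpret blocks r .
  let ?p = "tab_pos r lam mu T" and ?H = "principal_hooks lam mu T"
  have f1: "fst T \<in> std_filling lam {1..r}" and f2: "snd T \<in> std_filling mu {r+1..r+s}"
    using T by (auto simp: std_tableaux_def)
  have s1: "fst T ` hook lam q \<subseteq> {1..r}" and s2: "snd T ` hook mu q \<subseteq> {r+1..r+s}" for q
    using filling_bij[OF part(1) f1] filling_bij[OF part(2) f2] by (auto simp: hook_def bij_betw_def)
  have A: "i \<in> {1..r+s} \<and> j \<in> {1..r+s} \<and> J i j \<and> hook_ix (?p i) = hook_ix (?p j) \<longleftrightarrow> (\<exists>h\<in>?H. i \<in> h \<and> j \<in> h)" for i j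
  proof -
    have "(\<exists>h\<in>?H. i \<in> h \<and> j \<in> h) \<longleftrightarrow>
      (\<exists>d. (d, d) \<in> diagram lam \<and> i \<in> fst T ` hook lam (d, d) \<and> j \<in> fst T ` hook lam (d, d)) \<or>
      (\<exists>d. (d, d) \<in> diagram mu \<and> i \<in> snd T ` hook mu (d, d) \<and> j \<in> snd T ` hook mu (d, d))"
      unfolding principal_hooks_def by blast
    also have "\<dots> \<longleftrightarrow> (i \<in> {1..r} \<and> j \<in> {1..r} \<and> hook_ix (?p i) = hook_ix (?p j)) \<or>
      (i \<in> {r+1..r+s} \<and> j \<in> {r+1..r+s} \<and> hook_ix (?p i) = hook_ix (?p j))"
    proof -
      have "?p k = inv_into (diagram lam) (fst T) k" if "k \<in> {1..r}" for k
        using that by (simp add: tab_pos_def)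
      moreover have "?p k = inv_into (diagram mu) (snd T) k" if "k \<in> {r+1..r+s}" for k
        using that by (simp add: tab_pos_def)
      ultimately show ?thesis
        using filling_same_hook[OF part(1) f1, of i j] filling_same_hook[OF part(2) f2, of i j]
          s1[THEN subsetD] s2[THEN subsetD] by metis
    qed
    also have "\<dots> \<longleftrightarrow> i \<in> {1..r+s} \<and> j \<in> {1..r+s} \<and> J i j \<and> hook_ix (?p i) = hook_ix (?p j)"
      by (auto simp: J_def)
    finally show ?thesis by blast
  qed
  have "(\<forall>h\<in>?H. \<forall>i\<in>h. \<forall>j\<in>h. z i = z j) \<longleftrightarrow>
    (\<forall>i\<in>{1..r+s}. \<forall>j\<in>{1..r+s}. J i j \<and> hook_ix (?p i) = hook_ix (?p j) \<longrightarrow> z i = z j)" for z :: "nat \<Rightarrow> complex"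
    using A by meson
  then show ?thesis unfolding hook_space_def hsp_def by simp
qed

lemma Phi_dom_eq: "Phi_dom r s (content r lam mu T) = blocks.udom r (r + s) (tab_pos r lam mu T)"
proof -
  interpret blocks r .
  have "set (lex_pairs 1 r) \<union> set (lex_pairs (r + 1) (r + s)) = {(i, j). 1 \<le> i \<and> i < j \<and> j \<le> r + s \<and> J i j}"
    by (auto simp: set_lex_pairs J_def)
  then show ?thesis
    unfolding Phi_dom_def udom_def gen_def shf_def by (auto simp: content_tab_pos)
qed

theorem theorem3p1:
  fixes r s n :: nat
    and lam mu :: "nat list"
    and T :: "filling \<times> filling"
    and scale :: "complex \<Rightarrow> 'v::ab_group_add \<Rightarrow> 'v"
    and V :: "'v set"
    and ip :: "'v \<Rightarrow> 'v \<Rightarrow> complex"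
    and act :: "(nat \<Rightarrow> nat) \<Rightarrow> 'v \<Rightarrow> 'v"
    and v :: "filling \<times> filling \<Rightarrow> 'v"
  assumes "r \<ge> 1" and "s \<ge> 1" and "n = r + s"
    and "partition_of r lam" and "partition_of s mu"
    and "T \<in> std_tableaux r s lam mu"
    and "young_basis scale r s V ip act lam mu v"
  shows "\<forall>p \<in> diagonal_line n.
    ga_regular_value n (hook_space n lam mu T) (Phi_dom r s (content r lam mu T))
      (Phi r s (content r lam mu T)) p
      (diag_element (SxS r s) ip act (v T))"
proof
  fix x assume x: "x \<in> diagonal_line n"
  let ?p = "tab_pos r lam mu T" and ?c = "content r lam mu T"
  interpret state r n ?c "\<lambda>g. ip (v T) (act (apply g) (v T))"
    using young_basis.state_young[OF assms(7,4,5,6)] assms(3) by simp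
  have std: "std_seq n ?p" using std_seq_tab_pos[OF assms(4,5,6)] assms(3) by simp
  interpret fusion r n x ?p by unfold_locales (fact std, fact x)
  let ?N = "Suc (\<Sum>k\<in>{1..n}. fst (?p k) + snd (?p k))"
  have "fst (?p k) < ?N \<and> snd (?p k) < ?N" if "k \<in> {1..n}" for k
    using member_le_sum[of k "{1..n}" "\<lambda>k. fst (?p k) + snd (?p k)"] that by auto
  then obtain E where "fused n x ?p E" using fusion_exists[OF x std] by blast
  then have E: "E \<in> alg n" "tr E = E" "tau E = 1"
    "\<And>k. 1 \<le> k \<Longrightarrow> k \<le> n \<Longrightarrow> X k * E = sc (of_int (?c k)) * E"
    "\<And>g. rv (\<lambda>z. lookup (Ph (shf ?p z) n) g) (lookup E g)"
    by (auto simp: fused_def content_tab_pos)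
  have "E * X k = sc (of_int (?c k)) * E" if "1 \<le> k" "k \<le> n" for k
    using arg_cong[OF E(4)[OF that], of tr] by (simp add: tr_mult E(2) sc_commute)
  \<comment> \<open>Here both halves meet: \<open>E\<close> comes from fusion, \<open>F\<close> from
    the Young basis vector, and they have the same eigenvalues on both sides.\<close>
  then have EF: "E = F" using eigen_unique E by (simp add: tau_def)
  have Phi: "Phi r s ?c z = coefs (Ph (shf ?p z) n)" for z
    using Phi_coefs[of s ?c z] by (simp add: shf_def[abs_def] content_tab_pos assms(3))
  have diag: "diag_element (SxS r s) ip act (v T) = coefs E"
  proof (rule grp_alg_eqI)
    have fin: "finite (SxS r s)" unfolding SxS_eq_image by simp
    have d: "diag_element (SxS r s) ip act (v T) h = (if h \<in> SxS r s then ip (v T) (act h (v T)) else 0)" for h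
      unfolding diag_element_def delta_def using fin by (simp add: sum.delta' if_distrib cong: if_cong)
    show "diag_element (SxS r s) ip act (v T) (apply g) = coefs E (apply g)" for g
      unfolding d EF coefs_apply lookup_F using grp_iff_SxS[of g r s] by (simp add: assms(3))
    show "diag_element (SxS r s) ip act (v T) h = coefs E h" if "h \<notin> range apply" for h
    proof -
      have "h \<notin> SxS r s" using that unfolding SxS_eq_image by blast
      then show ?thesis using that by (simp add: d coefs_def)
    qed
  qed
  show "ga_regular_value n (hook_space n lam mu T) (Phi_dom r s ?c) (Phi r s ?c) x
      (diag_element (SxS r s) ip act (v T))"
    unfolding ga_regular_value_def diag Phi
  proof
    fix h
    have H: "hook_space n lam mu T = hsp n ?p" "Phi_dom r s ?c = udom n ?p"
      using hook_space_eq[OF assms(4,5,6)] Phi_dom_eq[of r s lam mu T] assms(3) by simp_all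
    show "regular_value n (hook_space n lam mu T) (Phi_dom r s ?c) (\<lambda>z. coefs (Ph (shf ?p z) n) h) x (coefs E h)"
      unfolding H
    proof (cases "h \<in> range apply")
      case True
      then show "rv (\<lambda>z. coefs (Ph (shf ?p z) n) h) (coefs E h)" using E(5) by auto
    next
      \<comment> \<open>Off the finitely supported permutations the function and its value are
        zero.\<close>
      case False
      then show "rv (\<lambda>z. coefs (Ph (shf ?p z) n) h) (coefs E h)"
        using regular_value_const[OF x_H HU_ne] by (simp add: coefs_def)
    qed
  qed
qed

end
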